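(* Let $X$ be a Feller $Q$-process, i.e. the $Q$-process determined by a triple $(\gamma,\beta,\nu)\in\mathscr{Q}_F$, and let $X^{(n)}$, $n\in\mathbb{N}$, be Wang's approximating sequence of Doob processes for $X$ (defined in the context). For $\lambda^{(n)}\in\mathcal{P}(\mathbb{N}_\partial)$ let $\mathbb{P}^{(n)}_{\lambda^{(n)}}$ denote the law on $D_{\overline{\mathbb{N}}_\partial}[0,\infty)$ of $X^{(n)}$ under $\mathbb{P}_{\lambda^{(n)}}$. If $\lambda^{(n)}\in\mathcal{P}(\mathbb{N}_\partial)$ converges weakly to $\lambda\in\mathcal{P}(\mathbb{N}_\partial)$, then $\mathbb{P}^{(n)}_{\lambda^{(n)}}$ converges weakly to $\mathbb{P}_\lambda$ on $D_{\overline{\mathbb{N}}_\partial}[0,\infty)$ equipped with the Skorohod topology, i.e. $$\lim_{n\to\infty}\int_{D_{\overline{\mathbb{N}}_\partial}[0,\infty)}F(w)\,\mathbb{P}^{(n)}_{\lambda^{(n)}}(dw)=\int_{D_{\overline{\mathbb{N}}_\partial}[0,\infty)}F(w)\,\mathbb{P}_\lambda(dw)$$ for all bounded functions $F$ on $D_{\overline{\mathbb{N}}_\partial}[0,\infty)$ that are continuous in the Skorohod topology.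
   Context: Setting. $\mathbb{N}=\{0,1,2,\dots\}$. Fix a birth-death matrix $Q=(q_{ij})_{i,j\in\mathbb{N}}$: $q_{k,k-1}=a_k>0$ ($k\ge1$), $q_{k,k+1}=b_k>0$ ($k\ge0$), $q_{kk}=-q_k$ with $q_k=a_k+b_k$ and $a_0:=0$, all other entries $0$. Put $c_0=0$, $c_1=\frac1{2b_0}$, $c_k=\frac1{2b_0}+\sum_{i=2}^k\frac{a_1\cdots a_{i-1}}{2b_0\cdots b_{i-1}}$ ($k\ge2$), $c_\infty=\lim_kc_k$; $\mu_0=1$, $\mu_k=\frac{b_0\cdots b_{k-1}}{a_1\cdots a_k}$ ($k\ge1$); $R=\sum_{k\ge0}(c_{k+1}-c_k)\sum_{i=0}^k\mu_i$, $S=\sum_{k\ge0}c_k\mu_k$. The point $\infty$ is regular if $R,S<\infty$ and an exit if $R<\infty,S=\infty$. Standing assumption: $\infty$ is regular or an exit (then $c_\infty<\infty$). A $Q$-process is a continuous-time Markov chain on $\mathbb{N}$ (possibly non-honest) with standard transition matrix $(p_{ij}(t))$ such that $p'_{ij}(0)=q_{ij}$. The minimal $Q$-process has transition matrix $p^{\min}_{ij}(t)$, the minimal nonnegative solution of the Kolmogorov backward equation; $\Phi^{\min}_{ij}(\alpha)=\int_0^\infty e^{-\alpha t}p^{\min}_{ij}(t)\,dt$ and $u^{\min}_\alpha(i)=1-\alpha\sum_j\Phi^{\min}_{ij}(\alpha)$. $\mathscr{Q}$ is the set of triples $(\gamma,\beta,\nu)$ with $\gamma,\beta\ge0$ constants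 and $\nu=(\nu_k)_{k\in\mathbb{N}}$ a nonnegative measure on $\mathbb{N}$, $|\nu|:=\sum_k\nu_k$, such that $\sum_k\nu_k\big(\sum_{j\ge k}(c_{j+1}-c_j)\sum_{i=0}^j\mu_i\big)<\infty$, $|\nu|+\beta\ne0$, and $\beta=0$ if $\infty$ is an exit. The $Q$-process determined by $(\gamma,\beta,\nu)$ is the one whose resolvent matrix $\Phi_{ij}(\alpha)=\int_0^\infty e^{-\alpha t}p_{ij}(t)\,dt$ is $$\Phi_{ij}(\alpha)=\Phi^{\min}_{ij}(\alpha)+u^{\min}_\alpha(i)\frac{\sum_k\nu_k\Phi^{\min}_{kj}(\alpha)+\beta\mu_ju^{\min}_\alpha(j)}{\gamma+\sum_k\nu_k(1-u^{\min}_\alpha(k))+\beta\alpha\sum_k\mu_ku^{\min}_\alpha(k)}.$$ $\mathscr{Q}_D=\{(\gamma,\beta,\nu)\in\mathscr{Q}:\beta=0,\ 0<|\nu|<\infty\}$ (Doob processes) and $\mathscr{Q}_F=\mathscr{Q}\setminus\mathscr{Q}_D$ (Feller $Q$-processes). State spaces. $\overline{\mathbb{N}}_\partial=\mathbb{N}\cup\{\infty\}\cup\{\partial\}$ is the compact metric space obtained by identifying $n\in\mathbb{N}$ with $\frac1{n+1}$, $\infty$ with $0$, and the cemetery $\partial$ with $-1$ in $\mathbb{R}$; $\mathbb{N}_\partial=\mathbb{N}\cup\{\partial\}$ (discrete). $\mathcal{P}(\mathbb{N}_\partial)$ is the set of probability measures on $\mathbb{N}_\partial$; weak convergence $\lambda^{(n)}\to\lambda$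 means $\lambda^{(n)}(f)\to\lambda(f)$ for all bounded functions $f$ on $\mathbb{N}_\partial$. Path space and laws. $D_{\overline{\mathbb{N}}_\partial}[0,\infty)$ is the space of càdlàg functions $[0,\infty)\to\overline{\mathbb{N}}_\partial$ with the Skorohod ($J_1$) topology; its Borel $\sigma$-algebra is generated by the coordinate maps. Extend $(p_{ij}(t))$ to $\mathbb{N}_\partial$ by $p_{i\partial}(t)=1-\sum_{j\in\mathbb{N}}p_{ij}(t)$, $p_{\partial\partial}(t)=1$. $\Omega$ is the set of càdlàg $\omega:[0,\infty)\to\overline{\mathbb{N}}_\partial$ with $\omega(t)=\partial$ for all $t\ge\zeta(\omega):=\inf\{t\ge0:\omega(t)=\partial\}$, and $X_t(\omega)=\omega(t)$. For $\lambda\in\mathcal{P}(\mathbb{N}_\partial)$, $\mathbb{P}_\lambda$ is the law on $\Omega\subset D_{\overline{\mathbb{N}}_\partial}[0,\infty)$ of the càdlàg (Ray-Knight) realization of the $Q$-process $X$ with initial distribution $\lambda$: its finite-dimensional distributions are those of the Markov chain on $\mathbb{N}_\partial$ with initial law $\lambda$ and transition probabilities the extended $(p_{ij}(t))$. $C(\alpha_m,\beta_m)$-transformation. Given a càdlàg function $x$ and a (finite or infinite) sequence of constants $0=:\beta_0<\alpha_1\le\beta_1<\alpha_2\le\beta_2<\cdots$, the transformed function $y$ is given by $y(t)=x(t)$ for $0\le t<\alpha_1$ and $y(d_m+t)=x(\beta_m+t)$ for $0\le t<\alpha_{m+1}-\beta_m$, where $d_1=\alpha_1$, $d_{m+1}=d_m+(\alpha_{m+1}-\beta_m)$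 (if the sequence ends with $\beta_M$, set $\alpha_{M+1}=\infty$). That is, the pieces of $x$ on $[\alpha_m,\beta_m)$ are discarded and the remaining pieces are glued in order. Wang's approximation. Fix $n\in\mathbb{N}$. Put $\eta^{(n)}_1=\inf\{t>0:X_{t-}=\infty\}$, $\sigma^{(n)}_m=\inf\{t\ge\eta^{(n)}_m:X_t\in\{0,1,\dots,n,\partial\}\}$ for $m\ge1$, and $\eta^{(n)}_m=\inf\{t>\sigma^{(n)}_{m-1}:X_{t-}=\infty\}\wedge\zeta$ for $m\ge2$ ($\inf\emptyset=\infty$); the sequence stops once $X_{\sigma^{(n)}_m}=\partial$ or an infinite time is reached. $X^{(n)}_\cdot(\omega)$ is the trajectory obtained from $X_\cdot(\omega)$ by the $C(\eta^{(n)}_m(\omega),\sigma^{(n)}_m(\omega))$-transformation. Under $(\mathbb{P}_x)$, $X^{(n)}$ is a Doob process with parameters $\gamma^{(n)}=\gamma$, $\beta^{(n)}=0$, $\nu^{(n)}_k=\nu_k$ for $0\le k\le n-1$, $\nu^{(n)}_n=\frac{\frac\beta2+\sum_{k\ge n}(c_\infty-c_k)\nu_k}{c_\infty-c_n}$, $\nu^{(n)}_k=0$ for $k\ge n+1$. The map $\omega\mapsto X^{(n)}_\cdot(\omega)$ into $D_{\overline{\mathbb{N}}_\partial}[0,\infty)$ is measurable, and $\mathbb{P}^{(n)}_{\lambda^{(n)}}$ is the image of $\mathbb{P}_{\lambda^{(n)}}$ under it. *)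

theory Defs
  imports "HOL-Probability.Probability"
begin

section \<open>Birth-death matrices\<close>

definition birth_death :: "(nat \<Rightarrow> real) \<Rightarrow> (nat \<Rightarrow> real) \<Rightarrow> bool" where
  "birth_death a b \<longleftrightarrow> a 0 = 0 \<and> (\<forall>k\<ge>1. a k > 0) \<and> (\<forall>k. b k > 0)"

definition bd_matrix :: "(nat \<Rightarrow> real) \<Rightarrow> (nat \<Rightarrow> real) \<Rightarrow> nat \<Rightarrow> nat \<Rightarrow> real" where
  "bd_matrix a b i j =
     (if i = Suc j then a i else if j = Suc i then b i else if i = j then - (a i + b i) else 0)"

definition scale :: "(nat \<Rightarrow> real) \<Rightarrow> (nat \<Rightarrow> real) \<Rightarrow> nat \<Rightarrow> real" where
  "scale a b k = (if k = 0 then 0 else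
     1 / (2 * b 0) + (\<Sum>i=2..k. (\<Prod>l=1..<i. a l) / (2 * (\<Prod>l<i. b l))))"

definition speed :: "(nat \<Rightarrow> real) \<Rightarrow> (nat \<Rightarrow> real) \<Rightarrow> nat \<Rightarrow> real" where
  "speed a b k = (\<Prod>l<k. b l) / (\<Prod>l=1..k. a l)"

text \<open>The value at \<open>k\<close> is \<open>\<Sum>j\<ge>k. (c (j+1) - c j) * (\<Sum>i\<le>j. \<mu> i)\<close>; the value at \<open>0\<close> is \<open>R\<close>.\<close>

definition R_tail :: "(nat \<Rightarrow> real) \<Rightarrow> (nat \<Rightarrow> real) \<Rightarrow> nat \<Rightarrow> ennreal" where
  "R_tail a b k = (\<Sum>j. ennreal ((scale a b (Suc (k + j)) - scale a b (k + j))
                                  * (\<Sum>i\<le>k + j. speed a b i)))"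

definition S_sum :: "(nat \<Rightarrow> real) \<Rightarrow> (nat \<Rightarrow> real) \<Rightarrow> ennreal" where
  "S_sum a b = (\<Sum>k. ennreal (scale a b k * speed a b k))"

definition infinity_regular :: "(nat \<Rightarrow> real) \<Rightarrow> (nat \<Rightarrow> real) \<Rightarrow> bool" where
  "infinity_regular a b \<longleftrightarrow> R_tail a b 0 < \<infinity> \<and> S_sum a b < \<infinity>"

definition infinity_exit :: "(nat \<Rightarrow> real) \<Rightarrow> (nat \<Rightarrow> real) \<Rightarrow> bool" where
  "infinity_exit a b \<longleftrightarrow> R_tail a b 0 < \<infinity> \<and> S_sum a b = \<infinity>"


section \<open>Transition matrices\<close>

text \<open>Transition matrices are functions of a real time; only times in \<open>[0, \<infinity>)\<close> are ever used.\<close>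

definition Q_process :: "(nat \<Rightarrow> nat \<Rightarrow> real) \<Rightarrow> (real \<Rightarrow> nat \<Rightarrow> nat \<Rightarrow> real) \<Rightarrow> bool" where
  "Q_process q p \<longleftrightarrow>
     (\<forall>t\<ge>0. \<forall>i j. p t i j \<ge> 0) \<and>
     (\<forall>t\<ge>0. \<forall>i. summable (p t i) \<and> (\<Sum>j. p t i j) \<le> 1) \<and>
     (\<forall>i j. p 0 i j = (if i = j then 1 else 0)) \<and>
     (\<forall>s\<ge>0. \<forall>t\<ge>0. \<forall>i j. (\<lambda>k. p s i k * p t k j) sums p (s + t) i j) \<and>
     (\<forall>i j. ((\<lambda>t. p t i j) \<longlongrightarrow> (if i = j then 1 else 0)) (at_right 0)) \<and>
     (\<forall>i j. ((\<lambda>t. p t i j) has_real_derivative q i j) (at 0 within {0..}))"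

text \<open>The rows of a birth-death matrix are finitely supported, so the series below is a finite sum.\<close>

definition backward_solution ::
  "(nat \<Rightarrow> nat \<Rightarrow> real) \<Rightarrow> (real \<Rightarrow> nat \<Rightarrow> nat \<Rightarrow> real) \<Rightarrow> bool" where
  "backward_solution q p \<longleftrightarrow>
     (\<forall>t\<ge>0. \<forall>i j. p t i j \<ge> 0) \<and>
     (\<forall>i j. p 0 i j = (if i = j then 1 else 0)) \<and>
     (\<forall>t\<ge>0. \<forall>i j. ((\<lambda>s. p s i j) has_real_derivative (\<Sum>k. q i k * p t k j)) (at t within {0..}))"

definition minimal_backward_solution ::
  "(nat \<Rightarrow> nat \<Rightarrow> real) \<Rightarrow> (real \<Rightarrow> nat \<Rightarrow> nat \<Rightarrow> real) \<Rightarrow> bool" where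
  "minimal_backward_solution q p \<longleftrightarrow> backward_solution q p \<and>
     (\<forall>p'. backward_solution q p' \<longrightarrow> (\<forall>t\<ge>0. \<forall>i j. p t i j \<le> p' t i j))"

definition resolvent :: "(real \<Rightarrow> nat \<Rightarrow> nat \<Rightarrow> real) \<Rightarrow> real \<Rightarrow> nat \<Rightarrow> nat \<Rightarrow> real" where
  "resolvent p \<alpha> i j = (LINT t:{0..}|lborel. exp (- \<alpha> * t) * p t i j)"

definition u_fun :: "(real \<Rightarrow> nat \<Rightarrow> nat \<Rightarrow> real) \<Rightarrow> real \<Rightarrow> nat \<Rightarrow> real" where
  "u_fun pmin \<alpha> i = 1 - \<alpha> * (\<Sum>j. resolvent pmin \<alpha> i j)"


section \<open>Parameters\<close>

definition total_mass :: "(nat \<Rightarrow> real) \<Rightarrow> ennreal" where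
  "total_mass \<nu> = (\<Sum>k. ennreal (\<nu> k))"

text \<open>The integrability condition on \<open>\<nu>\<close> forces every \<open>\<nu> k\<close> to be finite, so real weights
  suffice; the total mass may be infinite.\<close>

definition Q_params :: "(nat \<Rightarrow> real) \<Rightarrow> (nat \<Rightarrow> real) \<Rightarrow> (real \<times> real \<times> (nat \<Rightarrow> real)) set" where
  "Q_params a b = {(\<gamma>, \<beta>, \<nu>). \<gamma> \<ge> 0 \<and> \<beta> \<ge> 0 \<and> (\<forall>k. \<nu> k \<ge> 0) \<and>
     (\<Sum>k. ennreal (\<nu> k) * R_tail a b k) < \<infinity> \<and>
     total_mass \<nu> + ennreal \<beta> \<noteq> 0 \<and>
     (infinity_exit a b \<longrightarrow> \<beta> = 0)}"

definition Q_Doob :: "(nat \<Rightarrow> real) \<Rightarrow> (nat \<Rightarrow> real) \<Rightarrow> (real \<times> real \<times> (nat \<Rightarrow> real)) set" where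
  "Q_Doob a b = {(\<gamma>, \<beta>, \<nu>) \<in> Q_params a b. \<beta> = 0 \<and> 0 < total_mass \<nu> \<and> total_mass \<nu> < \<infinity>}"

definition Q_Feller :: "(nat \<Rightarrow> real) \<Rightarrow> (nat \<Rightarrow> real) \<Rightarrow> (real \<times> real \<times> (nat \<Rightarrow> real)) set" where
  "Q_Feller a b = Q_params a b - Q_Doob a b"

text \<open>For parameters in \<open>Q_params\<close> all series below converge, except possibly
  \<open>\<Sum>k. \<mu> k * u k\<close> in the exit case, where it is multiplied by \<open>\<beta> = 0\<close>.\<close>

definition determined_by ::
  "(nat \<Rightarrow> real) \<Rightarrow> (nat \<Rightarrow> real) \<Rightarrow> (real \<Rightarrow> nat \<Rightarrow> nat \<Rightarrow> real) \<Rightarrow> real \<Rightarrow> real \<Rightarrow> (nat \<Rightarrow> real)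
    \<Rightarrow> (real \<Rightarrow> nat \<Rightarrow> nat \<Rightarrow> real) \<Rightarrow> bool" where
  "determined_by a b pmin \<gamma> \<beta> \<nu> p \<longleftrightarrow> (\<forall>\<alpha>>0. \<forall>i j.
     resolvent p \<alpha> i j = resolvent pmin \<alpha> i j + u_fun pmin \<alpha> i *
       (((\<Sum>k. \<nu> k * resolvent pmin \<alpha> k j) + \<beta> * speed a b j * u_fun pmin \<alpha> j) /
        (\<gamma> + (\<Sum>k. \<nu> k * (1 - u_fun pmin \<alpha> k))
           + \<beta> * \<alpha> * (\<Sum>k. speed a b k * u_fun pmin \<alpha> k))))"


section \<open>State space\<close>

datatype bstate = St nat | Infty | Cem

primrec coord :: "bstate \<Rightarrow> real" where
  "coord (St n) = 1 / (real n + 1)"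
| "coord Infty = 0"
| "coord Cem = -1"

lemma coord_pos: "coord (St n) > 0"
  by (simp add: add_nonneg_pos)

lemma coord_inject: "coord x = coord y \<longleftrightarrow> x = y"
  using coord_pos[of "case x of St n \<Rightarrow> n | _ \<Rightarrow> 0"] coord_pos[of "case y of St n \<Rightarrow> n | _ \<Rightarrow> 0"]
  by (cases x; cases y) (auto simp: divide_simps)

instantiation bstate :: metric_space
begin

definition dist_bstate :: "bstate \<Rightarrow> bstate \<Rightarrow> real" where
  "dist_bstate x y = \<bar>coord x - coord y\<bar>"

definition uniformity_bstate :: "(bstate \<times> bstate) filter" where
  "uniformity_bstate = (INF e\<in>{0<..}. principal {(x, y). dist x y < e})"

definition open_bstate :: "bstate set \<Rightarrow> bool" where
  "open_bstate U \<longleftrightarrow> (\<forall>x\<in>U. eventually (\<lambda>(x', y). x' = x \<longrightarrow> y \<in> U) uniformity)"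

instance
  by standard
    (auto simp: dist_bstate_def uniformity_bstate_def open_bstate_def coord_inject)

end

text \<open>The discrete space \<open>\<nat> \<union> {\<partial>}\<close> is represented by \<open>nat option\<close>, with \<open>None\<close> for the
  cemetery; its probability measures are the elements of \<open>nat option pmf\<close>.\<close>

primrec emb :: "nat option \<Rightarrow> bstate" where
  "emb None = Cem"
| "emb (Some k) = St k"


section \<open>Path space and Skorohod topology\<close>

text \<open>Functions on \<open>[0, \<infinity>)\<close> are represented as functions on the reals that are
  \<open>undefined\<close> at negative times.\<close>

definition cadlag_paths :: "(real \<Rightarrow> bstate) set" where
  "cadlag_paths = {w \<in> extensional {0..}.
     (\<forall>t\<ge>0. (w \<longlongrightarrow> w t) (at_right t)) \<and> (\<forall>t>0. \<exists>l. (w \<longlongrightarrow> l) (at_left t))}"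

definition path_space :: "(real \<Rightarrow> bstate) measure" where
  "path_space = restrict_space (\<Pi>\<^sub>M t\<in>{0..}. borel) cadlag_paths"

definition time_change :: "(real \<Rightarrow> real) \<Rightarrow> bool" where
  "time_change l \<longleftrightarrow> strict_mono_on {0..} l \<and> l ` {0..} = {0..}"

text \<open>Sequential convergence in the Skorohod topology is: \<open>x\<^sub>n \<rightarrow> x\<close> iff for every \<open>T\<close> there are
  time changes \<open>l\<^sub>n\<close> such that both \<open>sup {\<bar>l\<^sub>n t - t\<bar> | t. t \<le> T}\<close> and
  \<open>sup {dist (x\<^sub>n t) (x (l\<^sub>n t)) | t. t \<le> T}\<close> tend to \<open>0\<close> (Skorohod's own definition; see also
  Ethier and Kurtz, \<open>Markov Processes\<close>, Proposition 3.5.3). As the topology is metrizable, the sets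
  below, decreasing as \<open>T\<close> grows and \<open>e\<close> shrinks, therefore form a base of (not necessarily
  open) neighbourhoods of \<open>x\<close>.\<close>

definition skorohod_nbhd :: "(real \<Rightarrow> bstate) \<Rightarrow> real \<Rightarrow> real \<Rightarrow> (real \<Rightarrow> bstate) set" where
  "skorohod_nbhd x T e = {y \<in> cadlag_paths.
     \<exists>l. time_change l \<and> (\<forall>t\<in>{0..T}. \<bar>l t - t\<bar> < e \<and> dist (y t) (x (l t)) < e)}"

definition skorohod_open :: "(real \<Rightarrow> bstate) set \<Rightarrow> bool" where
  "skorohod_open G \<longleftrightarrow> G \<subseteq> cadlag_paths \<and> (\<forall>x\<in>G. \<exists>T. \<exists>e>0. skorohod_nbhd x T e \<subseteq> G)"

definition skorohod_topology :: "(real \<Rightarrow> bstate) topology" where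
  "skorohod_topology = topology skorohod_open"

lemma skorohod_nbhd_mono:
  "T \<le> T' \<Longrightarrow> e' \<le> e \<Longrightarrow> skorohod_nbhd x T' e' \<subseteq> skorohod_nbhd x T e"
  unfolding skorohod_nbhd_def
  by (clarsimp, rename_tac y l, rule_tac x=l in exI) (auto intro: order.strict_trans2)

lemma istopology_skorohod_open: "istopology skorohod_open"
  unfolding istopology_def
proof (intro conjI allI impI)
  fix G H assume G: "skorohod_open G" and H: "skorohod_open H"
  show "skorohod_open (G \<inter> H)"
    unfolding skorohod_open_def
  proof (intro conjI ballI)
    show "G \<inter> H \<subseteq> cadlag_paths" using G by (auto simp: skorohod_open_def)
  next
    fix x assume x: "x \<in> G \<inter> H"
    obtain T e where 1: "e > 0" "skorohod_nbhd x T e \<subseteq> G"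
      using G x by (auto simp: skorohod_open_def)
    obtain T' e' where 2: "e' > 0" "skorohod_nbhd x T' e' \<subseteq> H"
      using H x by (auto simp: skorohod_open_def)
    have "skorohod_nbhd x (max T T') (min e e') \<subseteq> G \<inter> H"
      using skorohod_nbhd_mono[of T "max T T'" "min e e'" e x]
        skorohod_nbhd_mono[of T' "max T T'" "min e e'" e' x] 1(2) 2(2) by auto
    then show "\<exists>T. \<exists>e>0. skorohod_nbhd x T e \<subseteq> G \<inter> H"
      using 1(1) 2(1) by (intro exI[of _ "max T T'"] exI[of _ "min e e'"]) auto
  qed
next
  fix K assume K: "\<forall>G\<in>K. skorohod_open G"
  show "skorohod_open (\<Union>K)"
    unfolding skorohod_open_def
  proof (intro conjI ballI)
    show "\<Union>K \<subseteq> cadlag_paths" using K by (auto simp: skorohod_open_def)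
  next
    fix x assume "x \<in> \<Union>K"
    then obtain G where "G \<in> K" "x \<in> G" by auto
    moreover from this K obtain T e where "e > 0" "skorohod_nbhd x T e \<subseteq> G"
      unfolding skorohod_open_def by meson
    ultimately show "\<exists>T. \<exists>e>0. skorohod_nbhd x T e \<subseteq> \<Union>K" by blast
  qed
qed

lemma openin_skorohod: "openin skorohod_topology = skorohod_open"
  unfolding skorohod_topology_def by (simp add: topology_inverse' istopology_skorohod_open)

lemma topspace_skorohod: "topspace skorohod_topology = cadlag_paths"
proof -
  have "skorohod_open cadlag_paths"
    unfolding skorohod_open_def by (auto simp: skorohod_nbhd_def intro!: exI[of _ 1])
  then show ?thesis
    unfolding topspace_def openin_skorohod by (auto simp: skorohod_open_def)
qed


section \<open>Laws of the process\<close>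

definition lifetime :: "(real \<Rightarrow> bstate) \<Rightarrow> ereal" where
  "lifetime w = Inf (ereal ` {t. 0 \<le> t \<and> w t = Cem})"

definition Omega :: "(real \<Rightarrow> bstate) set" where
  "Omega = {w \<in> cadlag_paths. \<forall>t\<ge>0. lifetime w \<le> ereal t \<longrightarrow> w t = Cem}"

definition extend_trans ::
  "(real \<Rightarrow> nat \<Rightarrow> nat \<Rightarrow> real) \<Rightarrow> real \<Rightarrow> nat option \<Rightarrow> nat option \<Rightarrow> real" where
  "extend_trans p t x y = (case (x, y) of
      (Some i, Some j) \<Rightarrow> p t i j
    | (Some i, None) \<Rightarrow> 1 - (\<Sum>j. p t i j)
    | (None, Some j) \<Rightarrow> 0
    | (None, None) \<Rightarrow> 1)"

text \<open>Probability that a chain which is in state \<open>x\<close> at time \<open>s\<close> is in state \<open>y\<^sub>1\<close> at time \<open>t\<^sub>1\<close>, in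
  state \<open>y\<^sub>2\<close> at time \<open>t\<^sub>2\<close>, and so on, for times \<open>s \<le> t\<^sub>1 \<le> t\<^sub>2 \<le> \<dots>\<close>.\<close>

primrec chain_prob ::
  "(real \<Rightarrow> 's \<Rightarrow> 's \<Rightarrow> real) \<Rightarrow> (real \<times> 's) list \<Rightarrow> real \<Rightarrow> 's \<Rightarrow> real" where
  "chain_prob r [] s x = 1"
| "chain_prob r (z # zs) s x =
     r (fst z - s) x (snd z) * chain_prob r zs (fst z) (snd z)"

text \<open>Since the extended transition matrix is honest, these cylinder probabilities determine
  \<open>P\<close> uniquely, although they only involve states in \<open>\<nat> \<union> {\<partial>}\<close>.\<close>

definition process_law ::
  "(real \<Rightarrow> nat \<Rightarrow> nat \<Rightarrow> real) \<Rightarrow> nat option pmf \<Rightarrow> (real \<Rightarrow> bstate) measure \<Rightarrow> bool" where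
  "process_law p \<rho> P \<longleftrightarrow> prob_space P \<and> sets P = sets path_space \<and> (AE w in P. w \<in> Omega) \<and>
     (\<forall>zs. sorted (0 # map fst zs) \<longrightarrow>
        measure P {w \<in> space P. \<forall>z\<in>set zs. w (fst z) = emb (snd z)}
          = measure_pmf.expectation \<rho> (chain_prob (extend_trans p) zs 0))"


section \<open>Cutting and gluing; Wang's approximation\<close>

text \<open>The cut points are \<open>\<beta> 0 = 0\<close>, \<open>\<alpha> 1\<close>, \<open>\<beta> 1\<close>, \<open>\<alpha> 2\<close>, \<open>\<dots>\<close> (the value \<open>\<alpha> 0\<close> is irrelevant). A sequence
  ending with \<open>\<beta> M\<close> is represented by \<open>\<alpha> m = \<beta> m = \<infinity>\<close> for all \<open>m > M\<close>. The piece of \<open>x\<close> on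
  \<open>[\<beta> m, \<alpha> (m+1))\<close> becomes the piece of the new function on \<open>[d m, d (m+1))\<close>.\<close>

primrec glue_time :: "(nat \<Rightarrow> ereal) \<Rightarrow> (nat \<Rightarrow> ereal) \<Rightarrow> nat \<Rightarrow> ereal" where
  "glue_time \<alpha> \<beta> 0 = 0"
| "glue_time \<alpha> \<beta> (Suc m) = glue_time \<alpha> \<beta> m + (\<alpha> (Suc m) - \<beta> m)"

definition in_piece :: "(nat \<Rightarrow> ereal) \<Rightarrow> (nat \<Rightarrow> ereal) \<Rightarrow> real \<Rightarrow> nat \<Rightarrow> bool" where
  "in_piece \<alpha> \<beta> t m \<longleftrightarrow>
     \<beta> m < \<infinity> \<and> glue_time \<alpha> \<beta> m \<le> ereal t \<and> ereal t < glue_time \<alpha> \<beta> (Suc m)"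

definition C_transform ::
  "(nat \<Rightarrow> ereal) \<Rightarrow> (nat \<Rightarrow> ereal) \<Rightarrow> (real \<Rightarrow> bstate) \<Rightarrow> real \<Rightarrow> bstate" where
  "C_transform \<alpha> \<beta> x = (\<lambda>t\<in>{0..}. let m = (LEAST m. in_piece \<alpha> \<beta> t m)
     in x (real_of_ereal (\<beta> m) + (t - real_of_ereal (glue_time \<alpha> \<beta> m))))"

text \<open>\<open>inf {t > s. w (t-) = \<infinity>}\<close> for \<open>s \<ge> 0\<close>\<close>

definition explosion_after :: "(real \<Rightarrow> bstate) \<Rightarrow> ereal \<Rightarrow> ereal" where
  "explosion_after w s = Inf (ereal ` {t. s < ereal t \<and> (w \<longlongrightarrow> Infty) (at_left t)})"

definition return_after :: "nat \<Rightarrow> (real \<Rightarrow> bstate) \<Rightarrow> ereal \<Rightarrow> ereal" where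
  "return_after n w s = Inf (ereal ` {t. 0 \<le> t \<and> s \<le> ereal t \<and> w t \<in> insert Cem (St ` {0..n})})"

text \<open>\<open>wang_eta n w m\<close> and \<open>wang_sigma n w m\<close> are \<open>\<eta>\<^sub>m\<close> and \<open>\<sigma>\<^sub>m\<close> for \<open>m \<ge> 1\<close>, with
  \<open>wang_sigma n w 0 = 0\<close>. All times after the sequence has stopped are \<open>\<infinity>\<close>.\<close>

primrec wang_eta :: "nat \<Rightarrow> (real \<Rightarrow> bstate) \<Rightarrow> nat \<Rightarrow> ereal" where
  "wang_eta n w 0 = 0"
| "wang_eta n w (Suc m) =
     (if m = 0 then explosion_after w 0
      else let s = return_after n w (wang_eta n w m)
           in if s = \<infinity> \<or> w (real_of_ereal s) = Cem then \<infinity>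
              else min (explosion_after w s) (lifetime w))"

definition wang_sigma :: "nat \<Rightarrow> (real \<Rightarrow> bstate) \<Rightarrow> nat \<Rightarrow> ereal" where
  "wang_sigma n w m = (if m = 0 then 0 else return_after n w (wang_eta n w m))"

text \<open>On the exceptional null set where the path is not in \<open>Omega\<close> or where the glued pieces do
  not cover \<open>[0, \<infinity>)\<close>, the transformed path is by convention the one that is always dead.\<close>

definition wang_path :: "nat \<Rightarrow> (real \<Rightarrow> bstate) \<Rightarrow> real \<Rightarrow> bstate" where
  "wang_path n w =
     (if w \<in> Omega \<and> (\<forall>t\<ge>0. \<exists>m. in_piece (wang_eta n w) (wang_sigma n w) t m)
      then C_transform (wang_eta n w) (wang_sigma n w) w
      else (\<lambda>t\<in>{0..}. Cem))"

text \<open>The times \<open>wang_eta\<close> involve an infimum over an uncountable set of left limits, so on all of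
  \<open>Omega\<close> the map \<open>wang_path n\<close> is measurable only up to null sets; hence the completion.\<close>

definition wang_law :: "nat \<Rightarrow> (real \<Rightarrow> bstate) measure \<Rightarrow> (real \<Rightarrow> bstate) measure" where
  "wang_law n P = distr (completion P) path_space (wang_path n)"

end

theory Submission
  imports Defs
begin

text \<open>Almost surely the process is in \<open>\<nat>\<close> or dead at Lebesgue-almost every time, so the time spent
  outside \<open>An n = {0, \<dots>, n, \<partial>}\<close> before any fixed time tends to 0. Wang's transformation discards
  only such times, and while the path is outside \<open>An n\<close> it is close to \<open>\<infinity>\<close>. Stretching a short
  interval just before each cut over the discarded piece gives a time change which shows that the
  transformed path converges to the original one in the Skorohod topology. This needs that the path
  leaves \<open>\<nat>\<close> only by explosion (a jump out of a state of \<open>\<nat>\<close> goes to a neighbouring state, as the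
  rows of the matrix sum to 0) and that \<open>An n\<close> is occupied for an infinite time, for otherwise the
  glued pieces do not cover \<open>[0, \<infinity>)\<close>. The latter holds because the resolvent at 1 is bounded below by
  \<open>\<delta> > 0\<close> on one column, which follows from the form of the resolvent and the explosiveness of the
  minimal process.

  Dominated convergence then settles deterministic starting points. As both laws are mixtures over
  the starting point and weak convergence on a discrete space allows for test functions that tend to 0
  pointwise and boundedly, the general case follows.\<close>

text \<open>Apart from the regularity of its paths the process is given only by its probabilities at
  finitely many fixed times, so every almost sure statement is drawn from the Markov property at
  fixed times: jumps are detected on grids, and the infinite occupation time by approximating an
  event by events of the past. The lower bound on the resolvent has to be uniform in the starting
  state \<open>i\<close>. In the resolvent formula the correction is \<open>u_fun pmin 1 i\<close>
  times a factor depending on the column only, so \<open>u_fun pmin 1\<close> is to be bounded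
  below, i.e. \<open>pmin\<close> above. Minimality bounds \<open>pmin\<close> by any solution of
  the backward equation; hence a solution is built explicitly, with a Laplace transform at 1
  controlled by \<open>gbound\<close>. The constant that results is \<open>exp (- ftime 0)\<close>,
  where \<open>ftime 0\<close> is the mean explosion time \<open>2 * R\<close>. On a single path all
  estimates rest on \<open>occ n s \<le> d \<le> s\<close>, where \<open>d\<close> is a glueing time
  and \<open>s\<close> the time at which the original path is resumed: the glued clock may lag
  behind the original one, but never behind the time spent in \<open>An n\<close>.\<close>

lemma nn_integral_exp_tail:
  assumes "q > 0"
  shows "(\<integral>\<^sup>+t. ennreal (exp (- q * (t - s))) * indicator {s..} t \<partial>lborel) = ennreal (1 / q)"
proof -
  have "(\<integral>\<^sup>+t. ennreal (exp (- q * (t - s))) * indicator {s..} t \<partial>lborel)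
      = 0 - (- exp (- q * (s - s)) / q)"
  proof (rule nn_integral_FTC_atLeast[where F = "\<lambda>t. - exp (- q * (t - s)) / q"])
    show "((\<lambda>t. - exp (- q * (t - s)) / q) \<longlongrightarrow> 0) at_top"
    proof -
      have "filterlim (\<lambda>t. - s + t) at_top at_top"
        by (rule filterlim_tendsto_add_at_top[OF tendsto_const filterlim_ident])
      then have "filterlim (\<lambda>t. - q * (- s + t)) at_bot at_top"
        using assms by (intro filterlim_tendsto_neg_mult_at_bot[OF tendsto_const]) auto
      then have "((\<lambda>t. exp (- q * (- s + t))) \<longlongrightarrow> 0) at_top"
        by (rule filterlim_compose[OF exp_at_bot])
      then have "((\<lambda>t. - exp (- q * (- s + t)) / q) \<longlongrightarrow> - 0 / q) at_top"
        using assms by (intro tendsto_intros) auto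
      then show "((\<lambda>t. - exp (- q * (t - s)) / q) \<longlongrightarrow> 0) at_top" by (simp add: algebra_simps)
    qed
  qed (use assms in \<open>auto intro!: derivative_eq_intros\<close>)
  then show ?thesis by simp
qed

subsection \<open>Birth-death rates and the mean explosion time\<close>

locale explosive_bd =
  fixes a b :: "nat \<Rightarrow> real"
  assumes bd: "birth_death a b" and R_fin: "R_tail a b 0 < \<infinity>"
begin

lemma a0 [simp]: "a 0 = 0" and a_pos: "k \<ge> 1 \<Longrightarrow> a k > 0" and b_pos [simp]: "b k > 0"
  using bd by (auto simp: birth_death_def)

lemma a_nonneg [simp]: "a k \<ge> 0"
  using a_pos[of k] by (cases k) auto

lemma b_nonneg [simp]: "b k \<ge> 0"
  using b_pos[of k] by linarith

lemma q_pos [simp]: "a k + b k > 0"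
  using b_pos[of k] a_nonneg[of k] by linarith

lemma speed_pos [simp]: "speed a b k > 0"
  unfolding speed_def by (intro divide_pos_pos prod_pos) (auto intro: a_pos)

lemma speed_0 [simp]: "speed a b 0 = 1"
  by (simp add: speed_def)

text \<open>Detailed balance: the chain is reversible with respect to \<open>speed\<close>.\<close>

lemma speed_Suc: "a (Suc k) * speed a b (Suc k) = b k * speed a b k"
  using a_pos[of "Suc k"] by (simp add: speed_def field_simps)

lemma scale_diff: "scale a b (Suc k) - scale a b k = 1 / (2 * b k * speed a b k)"
proof (cases k)
  case 0
  then show ?thesis by (simp add: scale_def)
next
  case (Suc m)
  have "(\<Prod>l=1..<Suc k. a l) = (\<Prod>l=1..k. a l)"
    by (rule prod.cong) auto
  then show ?thesis using Suc
    by (simp add: scale_def speed_def field_simps)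
qed

text \<open>The \<open>k\<close>-th term of the series R. Twice this number is the mean time of
  passage from \<open>k\<close> to \<open>k + 1\<close>; the factor 2 undoes the 1/2 in
  \<open>scale\<close>.\<close>

definition incr :: "nat \<Rightarrow> real" where
  "incr k = (scale a b (Suc k) - scale a b k) * (\<Sum>i\<le>k. speed a b i)"

lemma incr_nonneg [simp]: "incr k \<ge> 0"
  unfolding incr_def scale_diff
  by (intro mult_nonneg_nonneg sum_nonneg divide_nonneg_nonneg) (auto intro: less_imp_le)

text \<open>The first-step equation for mean passage times: a step down from \<open>Suc k\<close>
  costs an additional passage from \<open>k\<close> back to \<open>Suc k\<close>. For the closed
  form it comes from detailed balance.\<close>

lemma incr_step: "a (Suc k) * (2 * incr k) + 1 = b (Suc k) * (2 * incr (Suc k))"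
proof -
  have *: "b (Suc k) * (2 * incr (Suc k)) = (\<Sum>i\<le>Suc k. speed a b i) / speed a b (Suc k)"
    using b_pos[of "Suc k"] speed_pos[of "Suc k"]
    by (simp add: incr_def scale_diff field_simps del: b_pos speed_pos)
  have "2 * incr k = (\<Sum>i\<le>k. speed a b i) / (b k * speed a b k)"
    using b_pos[of k] speed_pos[of k]
    by (simp add: incr_def scale_diff del: b_pos speed_pos)
  then have "2 * incr k = (\<Sum>i\<le>k. speed a b i) / (a (Suc k) * speed a b (Suc k))"
    by (simp add: speed_Suc)
  then have "a (Suc k) * (2 * incr k) = (\<Sum>i\<le>k. speed a b i) / speed a b (Suc k)"
    using a_pos[of "Suc k"] by simp
  then have "a (Suc k) * (2 * incr k) + 1 = ((\<Sum>i\<le>k. speed a b i) + speed a b (Suc k)) / speed a b (Suc k)"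
    using speed_pos[of "Suc k"] by (simp add: add_divide_distrib del: speed_pos)
  then show ?thesis using * by simp
qed

lemma incr_0: "b 0 * (2 * incr 0) = 1"
  using b_pos[of 0] by (simp add: incr_def scale_diff del: b_pos)

lemma summable_incr: "summable incr"
proof (rule summable_suminf_not_top)
  show "(\<Sum>k. ennreal (incr k)) \<noteq> top"
    using R_fin by (simp add: R_tail_def incr_def less_top)
qed simp

text \<open>The mean explosion time from \<open>i\<close>, as the sum of the mean passage times;
  finite because R is.\<close>

definition ftime :: "nat \<Rightarrow> real" where
  "ftime i = 2 * (\<Sum>j. incr (i + j))"

lemma summable_incr_shift: "summable (\<lambda>j. incr (i + j))"
  using summable_incr summable_iff_shift[of incr i] by (simp add: add.commute)

lemma R_tail_eq: "ennreal (ftime i) = 2 * R_tail a b i"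
proof -
  have "R_tail a b i = ennreal (\<Sum>j. incr (i + j))"
    unfolding R_tail_def incr_def[symmetric]
    using summable_incr_shift[of i] by (intro suminf_ennreal2) auto
  moreover have "ennreal (2 * x) = 2 * ennreal x" for x
    by (metis ennreal_mult' ennreal_numeral zero_le_numeral)
  ultimately show ?thesis
    by (simp add: ftime_def)
qed

lemma ftime_nonneg: "ftime i \<ge> 0"
  unfolding ftime_def using summable_incr_shift by (auto intro!: suminf_nonneg)

lemma ftime_Suc: "ftime i - ftime (Suc i) = 2 * incr i"
proof -
  have "(\<Sum>j. incr (i + j)) = incr i + (\<Sum>j. incr (i + Suc j))"
    using suminf_split_head[OF summable_incr_shift[of i]] by simp
  then show ?thesis by (simp add: ftime_def)
qed

lemma ftime_le_0: "ftime i \<le> ftime 0"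
proof (induction i)
  case (Suc i)
  then show ?case using ftime_Suc[of i] incr_nonneg[of i] by linarith
qed simp

text \<open>The generator maps the mean explosion time to -1; this is the first-step equation read
  through \<open>ftime_Suc\<close>. At 0 the truncated \<open>i - 1\<close> is harmless because
  \<open>a 0 = 0\<close>.\<close>

lemma Q_ftime: "a i * (ftime (i - 1) - ftime i) + b i * (ftime (Suc i) - ftime i) = -1"
proof (cases i)
  case 0
  then show ?thesis using ftime_Suc[of 0] incr_0 by (simp add: algebra_simps)
next
  case (Suc k)
  then show ?thesis using incr_step[of k] ftime_Suc[of k] ftime_Suc[of "Suc k"]
    by (simp add: algebra_simps)
qed

text \<open>By Jensen's inequality \<open>exp (- ftime i)\<close> is a lower bound for the Laplace transform at 1 of the
  explosion time from \<open>i\<close>; analytically it is a subsolution of the resolvent equation.\<close>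

definition gbound :: "nat \<Rightarrow> real" where
  "gbound i = 1 - exp (- ftime i)"

lemma gbound_nonneg: "gbound i \<ge> 0"
  using ftime_nonneg[of i] by (simp add: gbound_def)

lemma gbound_le: "gbound i \<le> ftime i"
  using exp_ge_add_one_self[of "- ftime i"] by (simp add: gbound_def)

text \<open>The exponential lies above its tangent, so at the neighbours of \<open>i\<close> the
  function \<open>exp (- ftime)\<close> dominates its linearisation at \<open>ftime i\<close>, on
  which the generator acts by \<open>Q_ftime\<close>. Divided by \<open>1 + a i + b i\<close> this
  is the induction step of \<open>laplace_pic\<close>.\<close>

lemma gbound_super:
  "1 + (a i * gbound (i - 1) + b i * gbound (Suc i)) \<le> (1 + a i + b i) * gbound i"
proof -
  define e where "e = exp (- ftime i)"
  have e: "e > 0" by (simp add: e_def)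
  have 1: "exp (- ftime k) \<ge> e * (1 + (ftime i - ftime k))" for k
  proof -
    have "exp (- ftime k) = e * exp (ftime i - ftime k)"
      by (simp add: e_def exp_add[symmetric])
    then show ?thesis using e exp_ge_add_one_self[of "ftime i - ftime k"] by simp
  qed
  have "a i * exp (- ftime (i - 1)) + b i * exp (- ftime (Suc i))
      \<ge> a i * (e * (1 + (ftime i - ftime (i - 1)))) + b i * (e * (1 + (ftime i - ftime (Suc i))))"
    using 1 by (intro add_mono mult_left_mono) auto
  also have "a i * (e * (1 + (ftime i - ftime (i - 1)))) + b i * (e * (1 + (ftime i - ftime (Suc i))))
    = e * (a i + b i - (a i * (ftime (i - 1) - ftime i) + b i * (ftime (Suc i) - ftime i)))"
    by (simp add: algebra_simps)
  also have "\<dots> = e * (1 + a i + b i)" by (simp only: Q_ftime) (simp add: algebra_simps)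
  finally show ?thesis by (simp add: gbound_def e_def[symmetric] algebra_simps)
qed

subsection \<open>Picard iteration for the backward equation\<close>

text \<open>The probability of going from \<open>i\<close> to \<open>j\<close> in time
  \<open>t\<close> with fewer than \<open>n\<close> jumps, obtained by conditioning on the first
  jump, which leaves the time \<open>s\<close>. Values in \<open>ennreal\<close> let monotone
  limits, sums over \<open>j\<close> and Fubini pass without integrability conditions.\<close>

primrec pic :: "nat \<Rightarrow> nat \<Rightarrow> nat \<Rightarrow> real \<Rightarrow> ennreal" where
  "pic 0 i j t = 0"
| "pic (Suc n) i j t = ennreal ((if i = j then 1 else 0) * exp (- (a i + b i) * t)) +
     (\<integral>\<^sup>+s. indicator {0..t} s * (ennreal (exp (- (a i + b i) * (t - s))) *
        (ennreal (a i) * pic n (i - 1) j s + ennreal (b i) * pic n (Suc i) j s)) \<partial>lborel)"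

lemma measurable_pic [measurable]: "(\<lambda>t. pic n i j t) \<in> borel_measurable borel"
proof (induction n arbitrary: i)
  case (Suc n)
  note Suc.IH [measurable]
  have [measurable]: "Measurable.pred (borel \<Otimes>\<^sub>M lborel) (\<lambda>x::real\<times>real. snd x \<in> {0..fst x})"
    unfolding atLeastAtMost_iff by measurable
  show ?case by simp
next
  case 0
  show ?case by (simp add: fun_eq_iff[symmetric])
qed

lemma incseq_pic: "pic n i j t \<le> pic (Suc n) i j t"
proof (induction n arbitrary: i t)
  case (Suc n)
  show ?case unfolding pic.simps(2)[of "Suc n" i j t] pic.simps(2)[of n i j t]
    by (intro add_left_mono nn_integral_mono mult_left_mono add_mono Suc.IH) simp_all
qed simp

lemma nn_integral_exp_piece:
  assumes "t \<ge> 0" "q > 0"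
  shows "(\<integral>\<^sup>+s. indicator {0..t} s * ennreal (q * exp (- q * (t - s))) \<partial>lborel)
     = ennreal (1 - exp (- q * t))"
proof -
  have "(\<integral>\<^sup>+s. ennreal (q * exp (- q * (t - s))) * indicator {0..t} s \<partial>lborel)
      = exp (- q * (t - t)) - exp (- q * (t - 0))"
    using assms by (intro nn_integral_FTC_Icc)
      (auto intro!: derivative_eq_intros simp: algebra_simps)
  then show ?thesis by (simp add: mult.commute)
qed

text \<open>The integrand is at most the density of the first jump, of total mass
  \<open>1 - exp (- q * t)\<close>, and the term without jump contributes at most
  \<open>exp (- q * t)\<close>.\<close>

lemma pic_le_1: "t \<ge> 0 \<Longrightarrow> pic n i j t \<le> 1"
proof (induction n arbitrary: i t)
  case (Suc n)
  let ?q = "a i + b i"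
  have "(\<integral>\<^sup>+s. indicator {0..t} s * (ennreal (exp (- ?q * (t - s))) *
        (ennreal (a i) * pic n (i - 1) j s + ennreal (b i) * pic n (Suc i) j s)) \<partial>lborel)
     \<le> (\<integral>\<^sup>+s. indicator {0..t} s * ennreal (?q * exp (- ?q * (t - s))) \<partial>lborel)"
  proof (rule nn_integral_mono)
    fix s :: real
    show "indicator {0..t} s * (ennreal (exp (- ?q * (t - s))) *
        (ennreal (a i) * pic n (i - 1) j s + ennreal (b i) * pic n (Suc i) j s))
      \<le> indicator {0..t} s * ennreal (?q * exp (- ?q * (t - s)))"
    proof (cases "s \<in> {0..t}")
      case True
      then have "ennreal (a i) * pic n (i - 1) j s + ennreal (b i) * pic n (Suc i) j s
         \<le> ennreal (a i) * 1 + ennreal (b i) * 1"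
        using Suc.IH by (intro add_mono mult_left_mono) auto
      also have "\<dots> = ennreal ?q" by (simp add: ennreal_plus[symmetric] del: ennreal_plus)
      finally have "ennreal (exp (- ?q * (t - s))) *
        (ennreal (a i) * pic n (i - 1) j s + ennreal (b i) * pic n (Suc i) j s)
         \<le> ennreal (exp (- ?q * (t - s))) * ennreal ?q"
        by (rule mult_left_mono) simp
      also have "\<dots> = ennreal (?q * exp (- ?q * (t - s)))"
        using q_pos[of i] by (simp add: ennreal_mult'[symmetric] mult.commute del: ennreal_plus)
      finally show ?thesis using True by simp
    qed simp
  qed
  also have "\<dots> = ennreal (1 - exp (- ?q * t))"
    using Suc.prems by (intro nn_integral_exp_piece) auto
  finally have "pic (Suc n) i j t \<le> ennreal ((if i = j then 1 else 0) * exp (- ?q * t))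
      + ennreal (1 - exp (- ?q * t))"
    unfolding pic.simps by (intro add_left_mono)
  also have "\<dots> \<le> ennreal (exp (- ?q * t)) + ennreal (1 - exp (- ?q * t))"
    by (intro add_mono ennreal_leI) auto
  also have "\<dots> = 1"
    using Suc.prems mult_nonneg_nonneg[of t "a i"] mult_nonneg_nonneg[of t "b i"]
    by (subst ennreal_plus[symmetric]) (auto simp: algebra_simps simp del: mult_nonneg_nonneg)
  finally show ?case .
qed simp

text \<open>The Laplace transform at 1 turns the convolution with \<open>exp (- q * t)\<close> into
  a division by \<open>1 + q\<close>, so the induction on the number of jumps closes by
  \<open>gbound_super\<close>. Summing over \<open>j\<close> inside gives a bound on the total mass,
  which is what \<open>u_fun\<close> measures.\<close>

lemma laplace_pic:
  "(\<integral>\<^sup>+t. indicator {0..} t * (ennreal (exp (- t)) * (\<Sum>j. pic n i j t)) \<partial>lborel)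
     \<le> ennreal (gbound i)"
proof (induction n arbitrary: i)
  case (Suc n)
  let ?q = "a i + b i"
  define r where "r s = ennreal (a i) * (\<Sum>j. pic n (i - 1) j s) + ennreal (b i) * (\<Sum>j. pic n (Suc i) j s)" for s
  let ?J = "\<lambda>t s. indicator {0..t} s * (ennreal (exp (- ?q * (t - s))) * r s)"
  let ?K = "\<lambda>t s j. indicator {0..t} s * (ennreal (exp (- ?q * (t - s))) *
    (ennreal (a i) * pic n (i - 1) j s + ennreal (b i) * pic n (Suc i) j s))"
  let ?T = "\<lambda>s t. ennreal (exp (- (1 + ?q) * (t - s))) * indicator {s..} t"
  let ?W = "\<lambda>s. indicator {0..} s * (ennreal (exp (- s)) * r s)"
  have r_meas [measurable]: "r \<in> borel_measurable borel" unfolding r_def by measurable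
  have ind [measurable]: "Measurable.pred (borel \<Otimes>\<^sub>M borel) (\<lambda>x::real\<times>real. snd x \<in> {0..fst x})"
    "Measurable.pred (borel \<Otimes>\<^sub>M borel) (\<lambda>x::real\<times>real. fst x \<in> {0..snd x})"
    "Measurable.pred (lborel \<Otimes>\<^sub>M lborel) (\<lambda>x::real\<times>real. snd x \<in> {0..fst x})"
    "Measurable.pred (lborel \<Otimes>\<^sub>M lborel) (\<lambda>x::real\<times>real. fst x \<in> {0..snd x})"
    unfolding atLeastAtMost_iff by measurable
  have r_meas' [measurable]: "(\<lambda>x. r (fst x)) \<in> borel_measurable (lborel \<Otimes>\<^sub>M lborel)"
    "(\<lambda>x. r (snd x)) \<in> borel_measurable (lborel \<Otimes>\<^sub>M lborel)"
    by measurable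
  have sm: "(\<Sum>j. pic (Suc n) i j t) = ennreal (exp (- ?q * t)) +
     (\<integral>\<^sup>+s. ?J t s \<partial>lborel)" for t
  proof -
    have 1: "(\<Sum>j. ennreal ((if i = j then 1 else 0) * exp (- ?q * t))) = ennreal (exp (- ?q * t))"
      by (subst suminf_finite[of "{i}"]) auto
    have "(\<Sum>j. \<integral>\<^sup>+s. ?K t s j \<partial>lborel)
      = (\<integral>\<^sup>+s. (\<Sum>j. ?K t s j) \<partial>lborel)"
      by (rule nn_integral_suminf[symmetric]) measurable
    also have "\<dots> = (\<integral>\<^sup>+s. ?J t s \<partial>lborel)"
      unfolding r_def by (simp add: suminf_add[symmetric])
    finally show ?thesis using 1 by (simp add: suminf_add[symmetric])
  qed
  have "(\<integral>\<^sup>+t. indicator {0..} t * (ennreal (exp (- t)) * (\<Sum>j. pic (Suc n) i j t)) \<partial>lborel)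
    = (\<integral>\<^sup>+t. indicator {0..} t * (ennreal (exp (- t)) * ennreal (exp (- ?q * t))) \<partial>lborel)
     + (\<integral>\<^sup>+t. indicator {0..} t * (ennreal (exp (- t)) * (\<integral>\<^sup>+s. ?J t s \<partial>lborel)) \<partial>lborel)"
    unfolding sm by (subst nn_integral_add[symmetric]) (auto simp: distrib_left)
  also have "(\<integral>\<^sup>+t. indicator {0..} t * (ennreal (exp (- t)) * ennreal (exp (- ?q * t))) \<partial>lborel)
    = (\<integral>\<^sup>+t. ennreal (exp (- (1 + ?q) * (t - 0))) * indicator {0..} t \<partial>lborel)"
    by (intro nn_integral_cong)
      (auto simp: ennreal_mult'[symmetric] exp_add[symmetric] algebra_simps split: split_indicator)
  also have "\<dots> = ennreal (1 / (1 + ?q))"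
    using q_pos[of i] by (intro nn_integral_exp_tail) linarith
  also have "(\<integral>\<^sup>+t. indicator {0..} t * (ennreal (exp (- t)) * (\<integral>\<^sup>+s. ?J t s \<partial>lborel)) \<partial>lborel)
    = (\<integral>\<^sup>+t. \<integral>\<^sup>+s. indicator {0..} t * (ennreal (exp (- t)) * (?J t s)) \<partial>lborel \<partial>lborel)"
    by (simp add: nn_integral_cmult[symmetric])
  also have "\<dots> = (\<integral>\<^sup>+s. \<integral>\<^sup>+t. indicator {0..} t * (ennreal (exp (- t)) * (?J t s)) \<partial>lborel \<partial>lborel)"
    by (rule lborel_pair.Fubini') measurable
  \<comment> \<open>Splitting the discount at \<open>s\<close>, \<open>exp (- t) * exp (- q * (t -
    s)) = exp (- s) * exp (- (1 + q) * (t - s))\<close>, separates the two integrals.\<close>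
  also have "\<dots> = (\<integral>\<^sup>+s. \<integral>\<^sup>+t. (?W s) * (?T s t) \<partial>lborel \<partial>lborel)"
  proof (intro nn_integral_cong)
    fix s t :: real
    show "indicator {0..} t * (ennreal (exp (- t)) * (?J t s))
      = (?W s) * (?T s t)"
    proof (cases "0 \<le> s \<and> s \<le> t")
      case True
      have "ennreal (exp (- t)) * ennreal (exp (- ?q * (t - s))) = ennreal (exp (- s)) * ennreal (exp (- (1 + ?q) * (t - s)))"
        by (simp add: ennreal_mult'[symmetric] exp_add[symmetric] algebra_simps)
      then have "ennreal (exp (- t)) * (ennreal (exp (- ?q * (t - s))) * r s) = ennreal (exp (- s)) * r s * ennreal (exp (- (1 + ?q) * (t - s)))"
        by (metis mult.assoc mult.commute)
      then show ?thesis using True by simp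
    qed auto
  qed
  also have "\<dots> = (\<integral>\<^sup>+s. (?W s) * ennreal (1 / (1 + ?q)) \<partial>lborel)"
  proof (intro nn_integral_cong)
    fix s :: real
    have "(\<integral>\<^sup>+t. (?W s) * (?T s t) \<partial>lborel)
      = (?W s) * (\<integral>\<^sup>+t. ?T s t \<partial>lborel)"
      by (rule nn_integral_cmult) measurable
    also have "(\<integral>\<^sup>+t. ?T s t \<partial>lborel) = ennreal (1 / (1 + ?q))"
      using q_pos[of i] by (intro nn_integral_exp_tail) linarith
    finally show "(\<integral>\<^sup>+t. (?W s) * (?T s t) \<partial>lborel)
      = (?W s) * ennreal (1 / (1 + ?q))" .
  qed
  also have "\<dots> = (\<integral>\<^sup>+s. ?W s \<partial>lborel) * ennreal (1 / (1 + ?q))"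
    by (rule nn_integral_multc) measurable
  also have "(\<integral>\<^sup>+s. ?W s \<partial>lborel)
     = ennreal (a i) * (\<integral>\<^sup>+s. indicator {0..} s * (ennreal (exp (- s)) * (\<Sum>j. pic n (i - 1) j s)) \<partial>lborel)
      + ennreal (b i) * (\<integral>\<^sup>+s. indicator {0..} s * (ennreal (exp (- s)) * (\<Sum>j. pic n (Suc i) j s)) \<partial>lborel)"
    unfolding r_def
    by (subst (1 2) nn_integral_cmult[symmetric], simp, simp, subst nn_integral_add[symmetric])
       (auto simp: algebra_simps intro!: nn_integral_cong)
  finally have "(\<integral>\<^sup>+t. indicator {0..} t * (ennreal (exp (- t)) * (\<Sum>j. pic (Suc n) i j t)) \<partial>lborel)
    \<le> ennreal (1 / (1 + ?q)) + (ennreal (a i) * ennreal (gbound (i - 1)) + ennreal (b i) * ennreal (gbound (Suc i))) * ennreal (1 / (1 + ?q))"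
    using Suc.IH[of "i - 1"] Suc.IH[of "Suc i"]
    by (auto intro!: add_mono mult_mono elim!: order_trans)
  also have "\<dots> = ennreal ((1 + (a i * gbound (i - 1) + b i * gbound (Suc i))) / (1 + ?q))"
    using gbound_nonneg a_nonneg[of i] b_nonneg[of i]
    by (simp add: ennreal_mult'[symmetric] ennreal_plus[symmetric] add_divide_distrib add_nonneg_nonneg del: ennreal_plus)
  also have "\<dots> \<le> ennreal (gbound i)"
    using gbound_super[of i] q_pos[of i]
    by (intro ennreal_leI) (simp add: pos_divide_le_eq mult.commute add.assoc add_pos_pos)
  finally show ?case .
qed (simp add: gbound_nonneg)


lemma bd_matrix_sums:
  "(\<lambda>k. bd_matrix a b i k * f k) sums (a i * f (i - 1) + b i * f (Suc i) - (a i + b i) * f i)"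
proof -
  have "(\<lambda>k. bd_matrix a b i k * f k) sums (\<Sum>k\<in>{i - 1, i, Suc i}. bd_matrix a b i k * f k)"
    by (rule sums_finite) (auto simp: bd_matrix_def)
  moreover have "(\<Sum>k\<in>{i - 1, i, Suc i}. bd_matrix a b i k * f k)
      = a i * f (i - 1) + b i * f (Suc i) - (a i + b i) * f i"
    by (cases i) (auto simp: bd_matrix_def algebra_simps)
  ultimately show ?thesis by simp
qed

section \<open>The limit of the iterates as a solution of the backward equation\<close>

definition pic_lim :: "nat \<Rightarrow> nat \<Rightarrow> real \<Rightarrow> ennreal" where
  "pic_lim i j t = (SUP n. pic n i j t)"

lemma measurable_pic_lim [measurable]: "(\<lambda>t. pic_lim i j t) \<in> borel_measurable borel"
  unfolding pic_lim_def by measurable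

lemma pic_lim_le_1: "t \<ge> 0 \<Longrightarrow> pic_lim i j t \<le> 1"
  unfolding pic_lim_def by (intro SUP_least pic_le_1)

lemma pic_lim_eq:
  "pic_lim i j t = ennreal ((if i = j then 1 else 0) * exp (- (a i + b i) * t)) +
     (\<integral>\<^sup>+s. indicator {0..t} s * (ennreal (exp (- (a i + b i) * (t - s))) *
        (ennreal (a i) * pic_lim (i - 1) j s + ennreal (b i) * pic_lim (Suc i) j s)) \<partial>lborel)"
proof -
  let ?I = "\<lambda>n s. indicator {0..t} s * (ennreal (exp (- (a i + b i) * (t - s))) *
        (ennreal (a i) * pic n (i - 1) j s + ennreal (b i) * pic n (Suc i) j s))"
  have inc: "incseq (\<lambda>n. pic n i j s)" for i s
    by (intro incseq_SucI incseq_pic)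
  have inc': "incseq (\<lambda>n. ennreal c * pic n i j s)" for i s c
    using inc[of i s] by (auto simp: incseq_def intro!: mult_left_mono)
  have "pic_lim i j t = (SUP n. pic (Suc n) i j t)"
    unfolding pic_lim_def
    by (intro SUP_eq) (auto intro: incseq_pic exI[of _ "Suc n" for n] simp del: pic.simps)
  also have "\<dots> = ennreal ((if i = j then 1 else 0) * exp (- (a i + b i) * t)) +
      (SUP n. integral\<^sup>N lborel (?I n))"
    unfolding pic.simps by (subst ennreal_SUP_add_right) auto
  also have "(SUP n. integral\<^sup>N lborel (?I n)) = (\<integral>\<^sup>+s. (SUP n. ?I n s) \<partial>lborel)"
    by (rule nn_integral_monotone_convergence_SUP[symmetric])
       (auto intro!: incseq_SucI le_funI mult_left_mono add_mono incseq_pic)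
  also have "\<dots> = (\<integral>\<^sup>+s. indicator {0..t} s * (ennreal (exp (- (a i + b i) * (t - s))) *
        (ennreal (a i) * pic_lim (i - 1) j s + ennreal (b i) * pic_lim (Suc i) j s)) \<partial>lborel)"
    unfolding pic_lim_def
    by (simp only: SUP_mult_left_ennreal[symmetric] ennreal_SUP_add[OF inc' inc'])
  finally show ?thesis .
qed

definition preal :: "real \<Rightarrow> nat \<Rightarrow> nat \<Rightarrow> real" where
  "preal t i j = enn2real (pic_lim i j t)"

lemma ennreal_preal: "t \<ge> 0 \<Longrightarrow> ennreal (preal t i j) = pic_lim i j t"
  using pic_lim_le_1[of t i j] unfolding preal_def
  by (intro ennreal_enn2real) (auto simp: order_le_less_trans[OF _ ennreal_one_less_top])

lemma preal_nonneg: "preal t i j \<ge> 0" by (simp add: preal_def)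

lemma preal_le_1: "t \<ge> 0 \<Longrightarrow> preal t i j \<le> 1"
  using pic_lim_le_1[of t i j] ennreal_preal[of t i j] by (metis ennreal_le_1)

lemma measurable_preal [measurable]: "(\<lambda>t. preal t i j) \<in> borel_measurable borel"
  unfolding preal_def by measurable

abbreviation hfun :: "nat \<Rightarrow> nat \<Rightarrow> real \<Rightarrow> real" where
  "hfun i j s \<equiv> a i * preal s (i - 1) j + b i * preal s (Suc i) j"

lemma hfun_nonneg: "hfun i j s \<ge> 0"
  by (simp add: preal_nonneg)

lemma hfun_le: "s \<ge> 0 \<Longrightarrow> hfun i j s \<le> a i + b i"
  using mult_left_mono[OF preal_le_1[of s "i - 1" j] a_nonneg[of i]]
    mult_left_mono[OF preal_le_1[of s "Suc i" j] b_nonneg[of i]] by linarith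

lemma set_integrable_hfun:
  "set_integrable lborel {0..t} (\<lambda>s. exp ((a i + b i) * s) * hfun i j s)"
  unfolding set_integrable_def
proof (rule integrableI_bounded_set_indicator[where B = "exp ((a i + b i) * t) * (a i + b i)"])
  show "AE s in lborel. s \<in> {0..t} \<longrightarrow> norm (exp ((a i + b i) * s) * hfun i j s) \<le> exp ((a i + b i) * t) * (a i + b i)"
  proof (intro AE_I2 impI)
    fix s assume s: "s \<in> {0..t}"
    have "norm (exp ((a i + b i) * s) * hfun i j s) = exp ((a i + b i) * s) * hfun i j s"
      using hfun_nonneg[of i s j] by (simp only: real_norm_def abs_mult abs_exp_cancel abs_of_nonneg)
    also have "\<dots> \<le> exp ((a i + b i) * t) * (a i + b i)"
      using s hfun_le[of s i j] hfun_nonneg[of i s j] q_pos[of i] by (intro mult_mono) auto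
    finally show "norm (exp ((a i + b i) * s) * hfun i j s) \<le> exp ((a i + b i) * t) * (a i + b i)" .
  qed
qed (auto simp: emeasure_lborel_Icc_eq)

text \<open>Pulling \<open>exp (- q * t)\<close> out of the convolution leaves an indefinite
  integral. This form yields continuity at once, and with the integrand thereby continuous,
  differentiability by the fundamental theorem of calculus.\<close>

lemma preal_eq:
  assumes "t \<ge> 0"
  shows "preal t i j = exp (- (a i + b i) * t) *
     ((if i = j then 1 else 0) + integral {0..t} (\<lambda>s. exp ((a i + b i) * s) * hfun i j s))"
proof -
  let ?q = "a i + b i"
  let ?f = "\<lambda>s. exp (?q * s) * hfun i j s"
  have "(\<integral>\<^sup>+s. indicator {0..t} s * (ennreal (exp (- ?q * (t - s))) *
        (ennreal (a i) * pic_lim (i - 1) j s + ennreal (b i) * pic_lim (Suc i) j s)) \<partial>lborel)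
    = (\<integral>\<^sup>+s. ennreal (exp (- ?q * t)) * ennreal (indicator {0..t} s *\<^sub>R ?f s) \<partial>lborel)"
  proof (intro nn_integral_cong)
    fix s
    have "exp (- ?q * t) * (exp (?q * s) * hfun i j s) = exp (- ?q * (t - s)) * hfun i j s"
      by (subst mult.assoc[symmetric], subst exp_add[symmetric]) (simp add: algebra_simps)
    then show "indicator {0..t} s * (ennreal (exp (- ?q * (t - s))) *
        (ennreal (a i) * pic_lim (i - 1) j s + ennreal (b i) * pic_lim (Suc i) j s))
      = ennreal (exp (- ?q * t)) * ennreal (indicator {0..t} s *\<^sub>R ?f s)"
      using hfun_nonneg[of i s j] preal_nonneg
      by (auto simp: ennreal_preal[symmetric] ennreal_mult'[symmetric] ennreal_plus[symmetric]
         simp del: ennreal_plus split: split_indicator)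
  qed
  also have "\<dots> = ennreal (exp (- ?q * t)) * (\<integral>\<^sup>+s. ennreal (indicator {0..t} s *\<^sub>R ?f s) \<partial>lborel)"
    by (rule nn_integral_cmult) measurable
  also have "(\<integral>\<^sup>+s. ennreal (indicator {0..t} s *\<^sub>R ?f s) \<partial>lborel) = ennreal (LINT s:{0..t}|lborel. ?f s)"
    unfolding set_lebesgue_integral_def
    using set_integrable_hfun[of t i j] hfun_nonneg[of i _ j]
    by (intro nn_integral_eq_integral) (auto simp: set_integrable_def intro!: AE_I2)
  also have "(LINT s:{0..t}|lborel. ?f s) = integral {0..t} ?f"
    by (rule set_borel_integral_eq_integral(2)[OF set_integrable_hfun])
  finally have *: "pic_lim i j t = ennreal ((if i = j then 1 else 0) * exp (- ?q * t)) +
      ennreal (exp (- ?q * t)) * ennreal (integral {0..t} ?f)"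
    by (subst pic_lim_eq) simp
  have "integral {0..t} ?f \<ge> 0"
    using set_borel_integral_eq_integral(1)[OF set_integrable_hfun[of t i j]] hfun_nonneg
    by (intro integral_nonneg) auto
  then have "pic_lim i j t = ennreal (exp (- ?q * t) * ((if i = j then 1 else 0) + integral {0..t} ?f))"
    unfolding * by (subst ennreal_mult'[symmetric], simp, subst ennreal_plus[symmetric])
      (auto simp: algebra_simps)
  then show ?thesis using \<open>integral {0..t} ?f \<ge> 0\<close>
    unfolding preal_def by (simp add: enn2real_ennreal)
qed

lemma continuous_on_preal: "continuous_on {0..T} (\<lambda>t. preal t i j)"
proof -
  have "continuous_on {0..T} (\<lambda>t. exp (- (a i + b i) * t) *
     ((if i = j then 1 else 0) + integral {0..t} (\<lambda>s. exp ((a i + b i) * s) * hfun i j s)))"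
    by (intro continuous_intros indefinite_integral_continuous_1
         set_borel_integral_eq_integral(1) set_integrable_hfun)
  then show ?thesis by (rule continuous_on_eq) (simp add: preal_eq)
qed

lemma preal_derivative:
  assumes "t \<ge> 0"
  shows "((\<lambda>t. preal t i j) has_real_derivative (hfun i j t - (a i + b i) * preal t i j)) (at t within {0..})"
proof -
  let ?q = "a i + b i"
  let ?f = "\<lambda>s. exp (?q * s) * hfun i j s"
  let ?G = "\<lambda>t. exp (- ?q * t) * ((if i = j then 1 else 0) + integral {0..t} ?f)"
  have "continuous_on {0..t + 1} ?f"
    by (intro continuous_intros continuous_on_preal)
  then have "((\<lambda>x. integral {0..x} ?f) has_real_derivative ?f t) (at t within {0..t + 1})"
    using assms by (intro integral_has_real_derivative) auto
  also have "at t within {0..t + 1} = at t within {0..}"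
    by (rule at_within_nhd[of t "{..<t + 1}"]) auto
  finally have D: "((\<lambda>x. integral {0..x} ?f) has_real_derivative ?f t) (at t within {0..})" .
  have E: "((\<lambda>t. exp (- ?q * t)) has_real_derivative (- ?q * exp (- ?q * t))) (at t within {0..})"
    by (auto intro!: derivative_eq_intros)
  have "(?G has_real_derivative (exp (- ?q * t) * (0 + ?f t) + - ?q * exp (- ?q * t) *
      ((if i = j then 1 else 0) + integral {0..t} ?f))) (at t within {0..})"
    by (rule DERIV_mult'[OF E DERIV_add[OF DERIV_const D]])
  also have "exp (- ?q * t) * (0 + ?f t) + - ?q * exp (- ?q * t) *
      ((if i = j then 1 else 0) + integral {0..t} ?f) = exp (- ?q * t) * ?f t - ?q * ?G t"
    by (simp only: mult.assoc minus_mult_left add_0_left diff_conv_add_uminus)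
  also have "exp (- ?q * t) * ?f t - ?q * ?G t = hfun i j t - ?q * preal t i j"
  proof -
    have "exp (- ?q * t) * ?f t = hfun i j t"
      by (subst mult.assoc[symmetric], subst exp_add[symmetric]) (simp add: algebra_simps)
    then show ?thesis using preal_eq[OF assms, of i j] by simp
  qed
  finally show ?thesis
    by (rule has_field_derivative_transform_within[OF _ zero_less_one])
      (use assms in \<open>auto simp only: atLeast_iff intro!: preal_eq[symmetric]\<close>)
qed

text \<open>Makes \<open>preal\<close> a competitor in the definition of the minimal solution, so
  that \<open>pmin\<close> inherits the bound on its Laplace transform.\<close>

lemma backward_preal: "backward_solution (bd_matrix a b) preal"
  unfolding backward_solution_def
proof (intro conjI allI impI)
  fix i j and t :: real assume "t \<ge> 0"
  have "(\<Sum>k. bd_matrix a b i k * preal t k j) = hfun i j t - (a i + b i) * preal t i j"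
    using sums_unique[OF bd_matrix_sums[of i "\<lambda>k. preal t k j"]] by simp
  then show "((\<lambda>s. preal s i j) has_real_derivative (\<Sum>k. bd_matrix a b i k * preal t k j)) (at t within {0..})"
    using preal_derivative[OF \<open>t \<ge> 0\<close>, of i j] by simp
qed (auto simp: preal_nonneg preal_eq[of 0])

lemma laplace_pic_lim:
  "(\<Sum>j. \<integral>\<^sup>+t. indicator {0..} t * (ennreal (exp (- t)) * pic_lim i j t) \<partial>lborel) \<le> ennreal (gbound i)"
proof -
  have inc: "incseq (\<lambda>n. pic n i j s)" for i j s
    by (intro incseq_SucI incseq_pic)
  have "(\<Sum>j. \<integral>\<^sup>+t. indicator {0..} t * (ennreal (exp (- t)) * pic_lim i j t) \<partial>lborel)
     = (\<integral>\<^sup>+t. (\<Sum>j. indicator {0..} t * (ennreal (exp (- t)) * pic_lim i j t)) \<partial>lborel)"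
    by (rule nn_integral_suminf[symmetric]) measurable
  also have "\<dots> = (\<integral>\<^sup>+t. (SUP n. indicator {0..} t * (ennreal (exp (- t)) * (\<Sum>j. pic n i j t))) \<partial>lborel)"
    unfolding pic_lim_def
    by (simp add: SUP_mult_left_ennreal[symmetric] ennreal_suminf_SUP_eq[OF inc, symmetric])
  also have "\<dots> = (SUP n. \<integral>\<^sup>+t. indicator {0..} t * (ennreal (exp (- t)) * (\<Sum>j. pic n i j t)) \<partial>lborel)"
    by (rule nn_integral_monotone_convergence_SUP)
       (auto intro!: incseq_SucI le_funI mult_left_mono suminf_le incseq_pic simp del: pic.simps)
  also have "\<dots> \<le> ennreal (gbound i)"
    by (intro SUP_least laplace_pic)
  finally show ?thesis .
qed

end

subsection \<open>A uniform lower bound for the resolvent\<close>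

locale explosive_bd_min = explosive_bd +
  fixes pmin :: "real \<Rightarrow> nat \<Rightarrow> nat \<Rightarrow> real"
  assumes pmin: "minimal_backward_solution (bd_matrix a b) pmin"
begin

lemma pmin_nonneg: "t \<ge> 0 \<Longrightarrow> pmin t i j \<ge> 0"
  and pmin_0: "pmin 0 i j = (if i = j then 1 else 0)"
  using pmin by (auto simp: minimal_backward_solution_def backward_solution_def)

lemma pmin_le: "t \<ge> 0 \<Longrightarrow> pmin t i j \<le> preal t i j"
  using pmin backward_preal by (auto simp: minimal_backward_solution_def)

lemma continuous_on_pmin: "continuous_on {0..} (\<lambda>t. pmin t i j)"
  unfolding continuous_on_eq_continuous_within
proof
  fix t :: real assume "t \<in> {0..}"
  then have "((\<lambda>s. pmin s i j) has_real_derivative (\<Sum>k. bd_matrix a b i k * pmin t k j)) (at t within {0..})"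
    using pmin by (auto simp: minimal_backward_solution_def backward_solution_def)
  then show "continuous (at t within {0..}) (\<lambda>t. pmin t i j)"
    by (rule DERIV_continuous)
qed

lemma measurable_laplace_pmin [measurable]:
  "(\<lambda>t. indicator {0..} t *\<^sub>R (exp (- t) * pmin t i j)) \<in> borel_measurable borel"
  by (intro borel_measurable_continuous_on_indicator continuous_intros continuous_on_pmin) auto

text \<open>The resolvent at 1 with values in \<open>ennreal\<close>, meaningful before
  integrability is known; \<open>rmin_fin\<close> then links it to \<open>resolvent\<close>.\<close>

definition rmin :: "nat \<Rightarrow> nat \<Rightarrow> ennreal" where
  "rmin i j = (\<integral>\<^sup>+t. ennreal (indicator {0..} t *\<^sub>R (exp (- t) * pmin t i j)) \<partial>lborel)"

lemma resolvent_pmin_eq: "resolvent pmin 1 i j = enn2real (rmin i j)"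
  unfolding resolvent_def set_lebesgue_integral_def rmin_def
  by (subst integral_eq_nn_integral)
     (use measurable_laplace_pmin in \<open>auto split: split_indicator simp: pmin_nonneg intro!: AE_I2\<close>)

lemma suminf_rmin: "(\<Sum>j. rmin i j) \<le> ennreal (gbound i)"
proof -
  have "rmin i j \<le> (\<integral>\<^sup>+t. indicator {0..} t * (ennreal (exp (- t)) * pic_lim i j t) \<partial>lborel)" for j
    unfolding rmin_def
    by (intro nn_integral_mono)
       (auto split: split_indicator simp: ennreal_preal[symmetric] ennreal_mult'[symmetric]
         intro!: ennreal_leI pmin_le)
  then have "(\<Sum>j. rmin i j) \<le> (\<Sum>j. \<integral>\<^sup>+t. indicator {0..} t * (ennreal (exp (- t)) * pic_lim i j t) \<partial>lborel)"
    by (intro suminf_le) auto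
  then show ?thesis using laplace_pic_lim[of i] by (rule order_trans)
qed

lemma rmin_fin: "rmin i j < \<infinity>"
proof -
  have "rmin i j \<le> (\<Sum>j. rmin i j)"
    using sum_le_suminf[of "rmin i" "{j}"] by simp
  then show ?thesis using suminf_rmin[of i] by (auto simp: order_le_less_trans)
qed

abbreviation "res \<equiv> resolvent pmin 1"
abbreviation "uu \<equiv> u_fun pmin 1"

lemma res_nonneg: "res i j \<ge> 0" by (simp add: resolvent_pmin_eq)

lemma ennreal_res: "ennreal (res i j) = rmin i j"
  using rmin_fin[of i j] by (simp add: resolvent_pmin_eq ennreal_enn2real_if)

lemma summable_res: "summable (res i)"
  by (rule summable_suminf_not_top)
    (use suminf_rmin[of i] in \<open>auto simp: ennreal_res res_nonneg top_unique\<close>)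

lemma suminf_res_le: "(\<Sum>j. res i j) \<le> gbound i"
proof -
  have "ennreal (\<Sum>j. res i j) = (\<Sum>j. rmin i j)"
    using summable_res by (subst suminf_ennreal2[symmetric]) (auto simp: res_nonneg ennreal_res)
  then have "ennreal (\<Sum>j. res i j) \<le> ennreal (gbound i)" using suminf_rmin[of i] by simp
  then show ?thesis using gbound_nonneg[of i] by (rule ennreal_le_iff[THEN iffD1, rotated])
qed

text \<open>Explosion from 0 has the largest mean time, which makes the bound uniform in the
  starting state.\<close>

lemma u_lower: "uu i \<ge> exp (- ftime 0)"
proof -
  have "exp (- ftime 0) \<le> exp (- ftime i)" using ftime_le_0[of i] by simp
  then show ?thesis using suminf_res_le[of i] unfolding u_fun_def gbound_def by linarith
qed

lemma u_pos: "uu i > 0"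
  using u_lower[of i] exp_gt_zero[of "- ftime 0"] by linarith

lemma u_le_1: "uu i \<le> 1"
  unfolding u_fun_def using suminf_nonneg[OF summable_res] res_nonneg by simp

lemma one_minus_u_le: "1 - uu i \<le> ftime i"
  unfolding u_fun_def using suminf_res_le[of i] gbound_le[of i] by simp

lemma res_le: "res i j \<le> 1 - uu i"
  unfolding u_fun_def using sum_le_suminf[OF summable_res, of "{j}" i] res_nonneg by simp

text \<open>By continuity at 0 the diagonal entry of \<open>pmin\<close> stays above 1/2 for a
  while.\<close>

lemma res_diag_pos: "res i i > 0"
proof -
  have "continuous (at 0 within {0..}) (\<lambda>t. pmin t i i)"
    using continuous_on_pmin[of i i] by (auto simp: continuous_on_eq_continuous_within)
  then obtain e where e: "e > 0" "\<And>t. t \<in> {0..} \<Longrightarrow> dist t 0 < e \<Longrightarrow> dist (pmin t i i) 1 < 1/2"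
    unfolding continuous_within_eps_delta
    by (metis (no_types, lifting) half_gt_zero_iff pmin_0 zero_less_one)
  define d where "d = e / 2"
  have d: "d > 0" "d < e" using e(1) by (auto simp: d_def)
  have "0 < ennreal (exp (- d) / 2 * d)" using d by (simp add: ennreal_zero_less_mult_iff)
  also have "ennreal (exp (- d) / 2 * d) = ennreal (exp (- d) / 2) * emeasure lborel {0..d}"
    using d by (simp add: ennreal_mult'[symmetric])
  also have "\<dots> = (\<integral>\<^sup>+t. ennreal (exp (- d) / 2) * indicator {0..d} t \<partial>lborel)"
    by (rule nn_integral_cmult_indicator[symmetric]) simp
  also have "\<dots> \<le> rmin i i" unfolding rmin_def
  proof (intro nn_integral_mono)
    fix t :: real
    show "ennreal (exp (- d) / 2) * indicator {0..d} t \<le> ennreal (indicator {0..} t *\<^sub>R (exp (- t) * pmin t i i))"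
    proof (cases "t \<in> {0..d}")
      case True
      then have "pmin t i i \<ge> 1/2" using e(2)[of t] d by (auto simp: dist_real_def abs_if split: if_splits)
      then have "exp (- d) * (1/2) \<le> exp (- t) * pmin t i i"
        using True by (intro mult_mono) auto
      then show ?thesis using True by (auto intro!: ennreal_leI)
    qed auto
  qed
  finally show ?thesis by (simp flip: ennreal_res)
qed

text \<open>The correction term is \<open>uu i\<close> times a factor \<open>\<psi> j\<close> that
  does not depend on \<open>i\<close>, and \<open>uu\<close> is bounded below, so one column with
  \<open>\<psi> j > 0\<close> is enough: column 0 if \<beta> > 0, and otherwise a column charged by
  \<nu>. The comparison \<open>\<nu> k * res k j \<le> \<nu> k * (1 - uu k) \<le> \<nu> k * ftime
  k\<close> reduces convergence of the series in \<nu> to the integrability condition on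
  \<nu>.\<close>

lemma resolvent_lower_bound:
  assumes rx: "infinity_regular a b \<or> infinity_exit a b"
    and par: "(\<gamma>, \<beta>, \<nu>) \<in> Q_params a b"
    and det: "determined_by a b pmin \<gamma> \<beta> \<nu> p"
  obtains j \<delta> where "\<delta> > 0" "\<And>i. resolvent p 1 i j \<ge> \<delta>"
proof -
  have par': "\<gamma> \<ge> 0" "\<beta> \<ge> 0" "\<And>k. \<nu> k \<ge> 0" "(\<Sum>k. ennreal (\<nu> k) * R_tail a b k) < \<infinity>"
     "total_mass \<nu> + ennreal \<beta> \<noteq> 0" "infinity_exit a b \<Longrightarrow> \<beta> = 0"
    using par by (auto simp: Q_params_def)
  have "(\<Sum>k. ennreal (\<nu> k * ftime k)) = 2 * (\<Sum>k. ennreal (\<nu> k) * R_tail a b k)"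
    by (subst ennreal_suminf_cmult[symmetric])
       (auto simp: ennreal_mult' par'(3) R_tail_eq mult_ac intro!: suminf_cong)
  also have "\<dots> \<noteq> top"
    using par'(4) by (auto simp: ennreal_mult_eq_top_iff)
  finally have sf: "summable (\<lambda>k. \<nu> k * ftime k)"
    by (intro summable_suminf_not_top) (auto simp: par'(3) ftime_nonneg)
  have su: "summable (\<lambda>k. \<nu> k * (1 - uu k))"
    by (rule summable_comparison_test'[OF sf, of 0])
       (auto simp: abs_mult par'(3) u_le_1 one_minus_u_le intro!: mult_left_mono)
  have sr: "summable (\<lambda>k. \<nu> k * res k j)" for j
    by (rule summable_comparison_test'[OF su, of 0])
       (auto simp: abs_mult par'(3) u_le_1 res_nonneg res_le intro!: mult_left_mono)
  let ?U = "\<Sum>k. speed a b k * uu k"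
  have smu: "?U > 0" if "\<beta> > 0"
  proof -
    have "S_sum a b < \<infinity>" using that rx par'(6) by (auto simp: infinity_regular_def)
    then have "(\<Sum>k. ennreal (scale a b k * speed a b k)) \<noteq> top"
      unfolding S_sum_def by auto
    moreover have sc: "scale a b k \<ge> 1 / (2 * b 0)" if "k \<ge> 1" for k
    proof -
      have "(\<Sum>i=2..k. (\<Prod>l=1..<i. a l) / (2 * (\<Prod>l<i. b l))) \<ge> 0"
        by (intro sum_nonneg divide_nonneg_nonneg prod_nonneg) (auto intro!: prod_nonneg)
      then show ?thesis using that by (simp add: scale_def)
    qed
    moreover have "scale a b k \<ge> 0" for k
    proof (cases "k = 0")
      case False
      have "0 \<le> 1 / (2 * b 0)" by simp
      also have "\<dots> \<le> scale a b k" using False by (intro sc) simp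
      finally show ?thesis .
    qed (simp add: scale_def)
    ultimately have ss: "summable (\<lambda>k. scale a b k * speed a b k)"
      by (intro summable_suminf_not_top) (auto intro!: mult_nonneg_nonneg less_imp_le[OF speed_pos])
    \<comment> \<open>From 1 on \<open>scale\<close> is at least \<open>1 / (2 * b 0)\<close>, so
      convergence of S forces the total speed measure to be finite.\<close>
    have "summable (\<lambda>k. speed a b k)"
    proof (rule summable_comparison_test'[OF summable_mult[OF ss, of "2 * b 0"], of 1])
      fix k :: nat assume "1 \<le> k"
      have "1 \<le> 2 * b 0 * scale a b k"
        using sc[OF \<open>1 \<le> k\<close>] b_pos[of 0] by (simp add: divide_le_eq mult_ac del: b_pos)
      then have "1 * speed a b k \<le> (2 * b 0 * scale a b k) * speed a b k"
        using less_imp_le[OF speed_pos] by (intro mult_right_mono) auto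
      then show "norm (speed a b k) \<le> 2 * b 0 * (scale a b k * speed a b k)"
        using less_imp_le[OF speed_pos[of k]] by (simp add: mult_ac)
    qed
    then have "summable (\<lambda>k. speed a b k * uu k)"
      by (rule summable_comparison_test'[of _ 0])
         (use less_imp_le[OF speed_pos] less_imp_le[OF u_pos] u_le_1 in
           \<open>auto simp: abs_mult mult_left_le\<close>)
    from suminf_pos[OF this] show ?thesis by (auto simp: u_pos)
  qed
  have bU: "\<beta> * ?U \<ge> 0"
    using smu par'(2) by (cases "\<beta> = 0") auto
  have nn1: "(\<Sum>k. \<nu> k * (1 - uu k)) \<ge> 0"
    by (intro suminf_nonneg su) (auto simp: par'(3) u_le_1)
  have nn2: "(\<Sum>k. \<nu> k * res k j) \<ge> 0" for j
    by (intro suminf_nonneg sr) (auto simp: par'(3) res_nonneg)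
  define \<psi> where "\<psi> j = ((\<Sum>k. \<nu> k * res k j) + \<beta> * speed a b j * uu j) /
        (\<gamma> + (\<Sum>k. \<nu> k * (1 - uu k)) + \<beta> * ?U)" for j
  have "\<exists>j. \<psi> j > 0"
  proof (cases "\<beta> > 0")
    case True
    then have "\<psi> 0 > 0"
      unfolding \<psi>_def using smu nn1 nn2[of 0] par'(1) u_pos[of 0]
      by (intro divide_pos_pos add_nonneg_pos) auto
    then show ?thesis ..
  next
    case False
    with par'(2,5) have b0: "\<beta> = 0" and tm: "total_mass \<nu> \<noteq> 0" by auto
    obtain k where "\<nu> k \<noteq> 0"
    proof (rule ccontr)
      assume "\<not> thesis"
      then have "\<nu> k = 0" for k using that by blast
      then show False using tm by (simp add: total_mass_def)
    qed
    then have k: "\<nu> k > 0" using par'(3)[of k] by simp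
    have "0 < \<nu> k * res k k" using k res_diag_pos by simp
    also have "\<dots> \<le> (\<Sum>i. \<nu> i * res i k)"
      using sum_le_suminf[OF sr, of "{k}"] by (auto simp: par'(3) res_nonneg)
    finally have 1: "0 < (\<Sum>i. \<nu> i * res i k)" .
    \<comment> \<open>The denominator has to be positive too, as division by 0 gives 0. It is,
      because \<open>1 - uu k\<close> is at least the diagonal entry \<open>res k k\<close>.\<close>
    have "0 < \<nu> k * (1 - uu k)" using k res_diag_pos[of k] res_le[of k k] by simp
    also have "\<dots> \<le> (\<Sum>i. \<nu> i * (1 - uu i))"
      using sum_le_suminf[OF su, of "{k}"] by (auto simp: par'(3) u_le_1)
    finally have "\<psi> k > 0"
      unfolding \<psi>_def using 1 par'(1) b0 by (intro divide_pos_pos) auto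
    then show ?thesis ..
  qed
  then obtain j where j: "\<psi> j > 0" ..
  show ?thesis
  proof (rule that[of "exp (- ftime 0) * \<psi> j" j])
    fix i
    have "resolvent p 1 i j = res i j + uu i * \<psi> j"
      using det unfolding determined_by_def \<psi>_def by simp
    moreover have "exp (- ftime 0) * \<psi> j \<le> uu i * \<psi> j"
      using j u_lower[of i] by (intro mult_right_mono) auto
    ultimately show "exp (- ftime 0) * \<psi> j \<le> resolvent p 1 i j"
      using res_nonneg[of i j] by simp
  qed (use j in auto)
qed

end

subsection \<open>The path space\<close>

lemma countable_bstate [simp]: "countable (A :: bstate set)"
proof (rule countable_subset)
  show "A \<subseteq> range St \<union> {Infty, Cem}"
  proof
    fix x show "x \<in> range St \<union> {Infty, Cem}" by (cases x) auto
  qed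
qed simp

lemma sets_borel_bstate [measurable, simp]: "(A :: bstate set) \<in> sets borel"
  by (rule sets.countable) auto

lemma space_path_space: "space path_space = cadlag_paths"
  by (auto simp: path_space_def space_restrict_space space_PiM cadlag_paths_def PiE_def)

lemma eval_measurable: "t \<ge> 0 \<Longrightarrow> (\<lambda>w. w t) \<in> borel_measurable path_space"
  unfolding path_space_def by (rule measurable_restrict_space1) simp

lemma eval_measurable_max [measurable]: "(\<lambda>w. w (max 0 t)) \<in> borel_measurable path_space"
  by (rule eval_measurable) simp

section \<open>Cylinder sets as a generating pi-system\<close>

definition cyl :: "(real \<times> bstate) set \<Rightarrow> (real \<Rightarrow> bstate) set" where
  "cyl Z = {w \<in> cadlag_paths. \<forall>z\<in>Z. w (fst z) = snd z}"

definition cyls :: "real set \<Rightarrow> (real \<Rightarrow> bstate) set set" where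
  "cyls I = cyl ` {Z. finite Z \<and> fst ` Z \<subseteq> I}"

lemma cyl_Int: "cyl Z \<inter> cyl Z' = cyl (Z \<union> Z')"
  by (auto simp: cyl_def)

lemma cyl_empty: "cyl {} = cadlag_paths"
  by (simp add: cyl_def)

lemma Int_stable_cyls: "Int_stable (cyls I)"
proof (rule Int_stableI)
  fix A B assume "A \<in> cyls I" "B \<in> cyls I"
  then obtain Z Z' where "A = cyl Z" "B = cyl Z'" "finite Z" "finite Z'" "fst ` Z \<subseteq> I" "fst ` Z' \<subseteq> I"
    by (auto simp: cyls_def)
  then show "A \<inter> B \<in> cyls I"
    by (auto simp: cyls_def cyl_Int intro!: imageI)
qed

lemma cyls_subset_Pow: "cyls I \<subseteq> Pow cadlag_paths"
  by (auto simp: cyls_def cyl_def)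

lemma cyl_sets: "finite Z \<Longrightarrow> fst ` Z \<subseteq> {0..} \<Longrightarrow> cyl Z \<in> sets path_space"
proof -
  assume Z: "finite Z" "fst ` Z \<subseteq> {0..}"
  have "{w \<in> space path_space. \<forall>z\<in>Z. w (fst z) \<in> {snd z}} \<in> sets path_space"
  proof (rule sets.sets_Collect_finite_All)
    fix z assume "z \<in> Z"
    then have "fst z \<ge> 0" using Z(2) by auto
    from measurable_sets[OF eval_measurable[OF this], of "{snd z}"]
    show "{w \<in> space path_space. w (fst z) \<in> {snd z}} \<in> sets path_space"
      by (simp add: vimage_def Int_def conj_commute)
  qed (rule Z(1))
  then show ?thesis by (simp add: cyl_def space_path_space)
qed

text \<open>The state space is countable, so any condition on the value at one time is a countable
  union of cylinders prescribing single values.\<close>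

lemma sets_path_space: "sets path_space = sigma_sets cadlag_paths (cyls {0..})"
proof
  let ?M = "sigma cadlag_paths (cyls {0..})"
  have sM: "space ?M = cadlag_paths" "sets ?M = sigma_sets cadlag_paths (cyls {0..})"
    using cyls_subset_Pow by auto
  have comp: "(\<lambda>w. w t) \<in> borel_measurable ?M" if "t \<ge> 0" for t
  proof (rule measurableI)
    fix A :: "bstate set"
    have "(\<lambda>w. w t) -` A \<inter> space ?M = (\<Union>x\<in>A. cyl {(t, x)})"
      unfolding sM by (auto simp: cyl_def)
    also have "\<dots> \<in> sets ?M"
    proof (rule sets.countable_UN')
      show "(\<lambda>x. cyl {(t, x)}) ` A \<subseteq> sets ?M"
        unfolding sM(2) using that by (auto simp: cyls_def intro!: sigma_sets.Basic)
    qed simp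
    finally show "(\<lambda>w. w t) -` A \<inter> space ?M \<in> sets ?M" .
  qed simp
  have "(\<lambda>w. w) \<in> measurable ?M path_space"
    unfolding path_space_def
  proof (rule measurable_restrict_space2)
    show "(\<lambda>w. w) \<in> measurable ?M (\<Pi>\<^sub>M t\<in>{0..}. borel)"
      by (rule measurable_PiM_single') (use comp sM in \<open>auto simp: cadlag_paths_def PiE_def\<close>)
  qed (use sM in auto)
  then have "A \<in> sets ?M" if "A \<in> sets path_space" for A
  proof -
    have "(\<lambda>w. w) -` A \<inter> space ?M \<in> sets ?M"
      using \<open>(\<lambda>w. w) \<in> measurable ?M path_space\<close> that by (rule measurable_sets)
    moreover have "A \<subseteq> cadlag_paths"
      using sets.sets_into_space[OF that] by (simp add: space_path_space)
    ultimately show ?thesis using sM(1) by (simp add: Int_absorb2)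
  qed
  then show "sets path_space \<subseteq> sigma_sets cadlag_paths (cyls {0..})" using sM(2) by auto
  show "sigma_sets cadlag_paths (cyls {0..}) \<subseteq> sets path_space"
    by (metis (no_types, lifting) cyls_def image_subsetI cyl_sets mem_Collect_eq sets.sigma_sets_subset space_path_space)
qed

lemma path_measure_eqI:
  assumes "finite_measure M" "sets M = sets path_space" "sets N = sets path_space"
    and eq: "\<And>Z. finite Z \<Longrightarrow> fst ` Z \<subseteq> {0..} \<Longrightarrow> emeasure M (cyl Z) = emeasure N (cyl Z)"
  shows "M = N"
proof (rule measure_eqI_generator_eq[where E = "cyls {0..}" and \<Omega> = cadlag_paths and A = "\<lambda>_. cadlag_paths"])
  show "range (\<lambda>_::nat. cadlag_paths) \<subseteq> cyls {0..}"
    by (auto simp: cyls_def cyl_empty[symmetric])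
  show "emeasure M cadlag_paths \<noteq> \<infinity>" for i :: nat
    using finite_measure.emeasure_finite[OF assms(1)] by auto
  show "Int_stable (cyls {0..})" by (rule Int_stable_cyls)
  show "cyls {0..} \<subseteq> Pow cadlag_paths" by (rule cyls_subset_Pow)
  show "emeasure M X = emeasure N X" if "X \<in> cyls {0..}" for X
    using that eq by (auto simp: cyls_def)
qed (use assms(2,3) sets_path_space in auto)

lemma cadlag_right: "w \<in> cadlag_paths \<Longrightarrow> t \<ge> 0 \<Longrightarrow> (w \<longlongrightarrow> w t) (at_right t)"
  and cadlag_left: "w \<in> cadlag_paths \<Longrightarrow> t > 0 \<Longrightarrow> \<exists>l. (w \<longlongrightarrow> l) (at_left t)"
  by (auto simp: cadlag_paths_def)

lemma continuous_coord: "continuous_on UNIV coord"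
  unfolding continuous_on_iff by (auto simp: dist_bstate_def dist_real_def)

lemma open_coord_vimage: "open S \<Longrightarrow> open (coord -` S)"
  using continuous_on_open_vimage[OF open_UNIV, of coord] continuous_coord by simp

lemma open_cofinite: "finite (- U) \<Longrightarrow> open (U :: bstate set)"
  using finite_imp_closed[of "- U"] by (simp add: closed_open)

text \<open>\<open>Infty\<close> is the only accumulation point of the state space.\<close>

lemma open_isolated: "Infty \<notin> U \<Longrightarrow> open U"
proof -
  assume U: "Infty \<notin> U"
  have "open {x}" if "x \<in> U" for x
  proof (cases x)
    case (St k)
    \<comment> \<open>\<open>1 / (k + 2)\<close> is the coordinate of \<open>St (Suc k)\<close>;
      above it lie only the states \<open>St 0, ..., St k\<close>.\<close>
    have "{x} = coord -` {1 / (real k + 2)<..} - St ` {..<k}"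
    proof (intro set_eqI iffI)
      fix y assume "y \<in> coord -` {1 / (real k + 2)<..} - St ` {..<k}"
      then show "y \<in> {x}"
      proof (cases y)
        case (St l)
        with \<open>y \<in> _\<close> have "1 / (real k + 2) < 1 / (real l + 1)" "\<not> l < k" by auto
        then have "real l + 1 < real k + 2" by (simp add: field_simps)
        then show ?thesis using St \<open>x = St k\<close> \<open>\<not> l < k\<close> by simp
      qed (auto simp: field_simps)
    qed (auto simp: St field_simps)
    moreover have "open (coord -` {1 / (real k + 2)<..} - St ` {..<k})"
      by (intro open_Diff open_coord_vimage finite_imp_closed) auto
    ultimately show ?thesis by simp
  next
    case Cem
    have "{x} = coord -` {..<-1/2}"
    proof (intro set_eqI iffI)
      fix y assume "y \<in> coord -` {..<-1/2}"
      then have "coord y < 0" by simp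
      then show "y \<in> {x}" using coord_pos less_asym by (cases y) (auto simp: Cem simp del: coord.simps(1))
    qed (auto simp: Cem)
    then show ?thesis using open_coord_vimage[of "{..<-1/2}"] by simp
  qed (use U that in auto)
  then have "open (\<Union>x\<in>U. {x})" by (intro open_UN) auto
  then show "open U" by simp
qed

lemma cadlag_right_nbhd:
  assumes "w \<in> cadlag_paths" "t \<ge> 0" "open U" "w t \<in> U"
  shows "\<exists>d>0. \<forall>s. t \<le> s \<longrightarrow> s < t + d \<longrightarrow> w s \<in> U"
proof -
  have "eventually (\<lambda>s. w s \<in> U) (at_right t)"
    using topological_tendstoD[OF cadlag_right[OF assms(1,2)] assms(3,4)] .
  then obtain b where b: "b > t" "\<And>s. t < s \<Longrightarrow> s < b \<Longrightarrow> w s \<in> U"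
    by (auto simp: eventually_at_right_field)
  then show ?thesis using assms(4) by (intro exI[of _ "b - t"]) (auto simp: le_less)
qed

lemma left_nbhd:
  fixes w :: "real \<Rightarrow> bstate"
  assumes "(w \<longlongrightarrow> l) (at_left t)" "open U" "l \<in> U"
  shows "\<exists>d>0. \<forall>s. t - d < s \<longrightarrow> s < t \<longrightarrow> w s \<in> U"
proof -
  have "eventually (\<lambda>s. w s \<in> U) (at_left t)"
    using topological_tendstoD[OF assms] .
  then obtain b where b: "b < t" "\<And>s. b < s \<Longrightarrow> s < t \<Longrightarrow> w s \<in> U"
    by (auto simp: eventually_at_left_field)
  then show ?thesis by (intro exI[of _ "t - b"]) auto
qed

text \<open>The grid points lie strictly to the right of \<open>t\<close>, also if \<open>t\<close>
  is itself on the grid: \<open>at_right t\<close> excludes \<open>t\<close>.\<close>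

lemma grid_tendsto_right: "filterlim (\<lambda>k. (of_int \<lfloor>real (Suc k) * t\<rfloor> + 1) / real (Suc k)) (at_right t) sequentially"
proof -
  have gt: "t < (of_int \<lfloor>real (Suc k) * t\<rfloor> + 1) / real (Suc k)" for k
    using floor_correct[of "real (Suc k) * t"] by (simp add: field_simps)
  have le: "(of_int \<lfloor>real (Suc k) * t\<rfloor> + 1) / real (Suc k) \<le> t + 1 / real (Suc k)" for k
  proof -
    have "(of_int \<lfloor>real (Suc k) * t\<rfloor> + 1) / real (Suc k) \<le> (real (Suc k) * t + 1) / real (Suc k)"
      by (intro divide_right_mono add_mono of_int_floor_le) auto
    also have "\<dots> = t + 1 / real (Suc k)" by (simp add: add_divide_distrib del: of_nat_Suc)
    finally show ?thesis .
  qed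
  have "(\<lambda>k. t + 1 / real (Suc k)) \<longlonglongrightarrow> t + 0"
    by (intro tendsto_intros LIMSEQ_Suc[OF lim_1_over_n])
  then have "(\<lambda>k. (of_int \<lfloor>real (Suc k) * t\<rfloor> + 1) / real (Suc k)) \<longlonglongrightarrow> t"
    by (intro tendsto_sandwich[OF always_eventually[OF allI[OF less_imp_le[OF gt]]] always_eventually[OF allI[OF le]] tendsto_const]) simp
  then show ?thesis
    using gt by (auto simp: filterlim_at intro!: always_eventually less_imp_neq[symmetric])
qed

text \<open>A right-continuous path is the limit of its values at grid points, and each
  approximation is measurable by splitting over the countably many values of the floor. The
  \<open>max 0\<close> keeps the argument where paths are defined.\<close>

lemma eval_joint_measurable [measurable]:
  "(\<lambda>x. fst x (max 0 (snd x))) \<in> borel_measurable (path_space \<Otimes>\<^sub>M borel)"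
proof (rule borel_measurable_LIMSEQ_metric)
  fix k :: nat
  have "(\<lambda>x. (\<lambda>i x. fst x (max 0 ((of_int i + 1) / real (Suc k)))) \<lfloor>real (Suc k) * max 0 (snd x)\<rfloor> x)
      \<in> borel_measurable (path_space \<Otimes>\<^sub>M borel)"
    by (rule measurable_compose_countable) measurable
  then show "(\<lambda>x. fst x (max 0 ((of_int \<lfloor>real (Suc k) * max 0 (snd x)\<rfloor> + 1) / real (Suc k)))) \<in> borel_measurable (path_space \<Otimes>\<^sub>M borel)"
    by simp
next
  fix x :: "(real \<Rightarrow> bstate) \<times> real" assume "x \<in> space (path_space \<Otimes>\<^sub>M borel)"
  then have x: "fst x \<in> cadlag_paths" by (auto simp: space_pair_measure space_path_space)
  let ?t = "max 0 (snd x)"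
  have "(\<lambda>k. fst x ((of_int \<lfloor>real (Suc k) * ?t\<rfloor> + 1) / real (Suc k))) \<longlonglongrightarrow> fst x ?t"
    by (rule filterlim_compose[OF cadlag_right[OF x] grid_tendsto_right]) simp
  moreover have "max 0 ((of_int \<lfloor>real (Suc k) * ?t\<rfloor> + 1) / real (Suc k)) = (of_int \<lfloor>real (Suc k) * ?t\<rfloor> + 1) / real (Suc k)" for k
    by (simp add: max_def mult_nonneg_nonneg)
  ultimately show "(\<lambda>k. fst x (max 0 ((of_int \<lfloor>real (Suc k) * ?t\<rfloor> + 1) / real (Suc k)))) \<longlonglongrightarrow> fst x ?t"
    by simp
qed

lemma eval_random_time:
  assumes [measurable]: "T \<in> borel_measurable M" "f \<in> measurable M path_space"
  shows "(\<lambda>w. f w (max 0 (T w))) \<in> borel_measurable M"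
proof -
  have "(\<lambda>w. (f w, T w)) \<in> measurable M (path_space \<Otimes>\<^sub>M borel)" by measurable
  from measurable_compose[OF this eval_joint_measurable] show ?thesis by simp
qed

lemma path_occupation_sets [measurable]:
  assumes "w \<in> cadlag_paths" shows "{t. 0 \<le> t \<and> w t \<in> U} \<in> sets borel"
proof -
  have "(\<lambda>t. w (max 0 t)) \<in> borel_measurable borel"
    using eval_random_time[of "\<lambda>t. t" borel "\<lambda>_. w"] assms by (simp add: space_path_space)
  from measurable_sets[OF this, of U] have "{t. w (max 0 t) \<in> U} \<inter> {0..} \<in> sets borel"
    by (intro sets.Int) (auto simp: vimage_def)
  also have "{t. w (max 0 t) \<in> U} \<inter> {0..} = {t. 0 \<le> t \<and> w t \<in> U}" by auto
  finally show ?thesis .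
qed

subsection \<open>Finite-dimensional distributions\<close>

lemma chain_prob_append:
  "chain_prob k (zs @ [(s, x), (s + r, y)]) u x0 = chain_prob k (zs @ [(s, x)]) u x0 * k r x y"
  by (induction zs arbitrary: u x0) simp_all

text \<open>Translates a set of constraints into the sorted lists for which the law prescribes
  probabilities; \<open>Infty\<close> is not in the range of \<open>emb\<close>.\<close>

lemma sorted_cylinder:
  assumes fin: "finite Z" and no: "\<nexists>t. (t, Infty) \<in> Z"
  obtains zs where "sorted (map fst zs)" "set (map (\<lambda>z. (fst z, emb (snd z))) zs) = Z"
proof -
  obtain xs where xs: "set xs = Z" using finite_list[OF fin] by blast
  define zs where "zs = sort_key fst (map (\<lambda>z. (fst z, inv emb (snd z))) xs)"
  have inj: "inj emb"
  proof (rule injI)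
    fix x y assume "emb x = emb y" then show "x = y" by (cases x; cases y) auto
  qed
  have emb_inv: "emb (inv emb v) = v" if "v \<noteq> Infty" for v
  proof -
    have "v \<in> range emb" using that
      by (cases v) (auto intro: range_eqI[of _ _ "Some k" for k] range_eqI[of _ _ None])
    then show ?thesis by (rule f_inv_into_f)
  qed
  have Z: "set (map (\<lambda>z. (fst z, emb (snd z))) zs) = Z"
  proof -
    have "set (map (\<lambda>z. (fst z, emb (snd z))) zs) = (\<lambda>z. (fst z, emb (inv emb (snd z)))) ` Z"
      unfolding zs_def by (simp add: xs image_image)
    also have "\<dots> = (\<lambda>z. z) ` Z"
    proof (rule image_cong)
      fix z assume "z \<in> Z"
      then have "snd z \<noteq> Infty" using no by (metis prod.collapse)
      then show "(fst z, emb (inv emb (snd z))) = z" by (simp add: emb_inv)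
    qed simp
    finally show ?thesis by simp
  qed
  moreover have "sorted (map fst zs)" unfolding zs_def by simp
  ultimately show ?thesis using that by blast
qed

locale chain_law =
  fixes p :: "real \<Rightarrow> nat \<Rightarrow> nat \<Rightarrow> real" and q :: "nat \<Rightarrow> nat \<Rightarrow> real"
    and \<rho> :: "nat option pmf" and P :: "(real \<Rightarrow> bstate) measure"
  assumes Qp: "Q_process q p" and law: "process_law p \<rho> P"
begin

sublocale prob_space P using law by (simp add: process_law_def)

lemma sets_P [measurable_cong, simp]: "sets P = sets path_space"
  and AE_Omega: "AE w in P. w \<in> Omega"
  and fdd: "sorted (0 # map fst zs) \<Longrightarrow> measure P {w \<in> space P. \<forall>z\<in>set zs. w (fst z) = emb (snd z)}
          = measure_pmf.expectation \<rho> (chain_prob (extend_trans p) zs 0)"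
  using law by (auto simp: process_law_def)

lemma space_P [simp]: "space P = cadlag_paths"
  using sets_eq_imp_space_eq[OF sets_P] by (simp add: space_path_space)

lemma p_nonneg: "t \<ge> 0 \<Longrightarrow> p t i j \<ge> 0"
  and p_summable: "t \<ge> 0 \<Longrightarrow> summable (p t i)"
  and p_sum_le: "t \<ge> 0 \<Longrightarrow> (\<Sum>j. p t i j) \<le> 1"
  and p_0: "p 0 i j = (if i = j then 1 else 0)"
  and p_deriv: "((\<lambda>t. p t i j) has_real_derivative q i j) (at 0 within {0..})"
  using Qp by (auto simp: Q_process_def)

abbreviation "ext \<equiv> extend_trans p"

lemma p_le_1: "t \<ge> 0 \<Longrightarrow> p t i j \<le> 1"
  using sum_le_suminf[OF p_summable, of t "{j}" i] p_nonneg[of t i] p_sum_le[of t i] by simp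

lemma ext_nonneg: "t \<ge> 0 \<Longrightarrow> ext t x y \<ge> 0"
  using p_sum_le[of t] by (auto simp: extend_trans_def p_nonneg split: option.split)

lemma ext_le_1: "t \<ge> 0 \<Longrightarrow> ext t x y \<le> 1"
  using suminf_nonneg[OF p_summable[of t]] by (auto simp: extend_trans_def p_nonneg p_le_1 split: option.split)

lemma cyl_list: "cyl (set (map (\<lambda>z. (fst z, emb (snd z))) zs)) = {w \<in> space P. \<forall>z\<in>set zs. w (fst z) = emb (snd z)}"
  by (auto simp: cyl_def)

lemma ext_sum: "t \<ge> 0 \<Longrightarrow> ennreal (ext t x None) + (\<Sum>j. ennreal (ext t x (Some j))) = 1"
proof (cases x)
  case (Some i)
  assume t: "t \<ge> 0"
  have "(\<Sum>j. ennreal (ext t x (Some j))) = ennreal (\<Sum>j. p t i j)"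
    using Some t by (simp add: extend_trans_def suminf_ennreal2 p_nonneg p_summable)
  then show ?thesis
    using Some t p_sum_le[of t i] suminf_nonneg[OF p_summable[of t i]]
    by (simp add: extend_trans_def p_nonneg ennreal_plus[symmetric] del: ennreal_plus)
qed (simp add: extend_trans_def)

lemma emeasure_single:
  assumes "t \<ge> 0"
  shows "emeasure P (cyl {(t, emb y)}) = (\<integral>\<^sup>+x. ennreal (ext t x y) \<partial>measure_pmf \<rho>)"
proof -
  have "measure P (cyl {(t, emb y)}) = measure_pmf.expectation \<rho> (\<lambda>x. ext t x y)"
  proof -
    have "chain_prob ext [(t, y)] 0 = (\<lambda>x. ext t x y)" by (simp add: fun_eq_iff)
    then show ?thesis using fdd[of "[(t, y)]"] assms by (simp add: cyl_def)
  qed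
  moreover have "(\<integral>\<^sup>+x. ennreal (ext t x y) \<partial>measure_pmf \<rho>) = ennreal (measure_pmf.expectation \<rho> (\<lambda>x. ext t x y))"
    by (intro nn_integral_eq_integral measure_pmf.integrable_const_bound[where B = 1])
       (auto simp: ext_nonneg ext_le_1 assms)
  ultimately show ?thesis by (simp add: emeasure_eq_measure)
qed

text \<open>The extended matrix is honest, so at a fixed time the states \<open>St j\<close> and the
  cemetery already carry the total mass 1.\<close>

lemma null_Infty: "t \<ge> 0 \<Longrightarrow> cyl {(t, Infty)} \<in> null_sets P"
proof -
  assume t: "t \<ge> 0"
  have m: "cyl {(t, x)} \<in> sets P" for x using t by (auto intro: cyl_sets)
  have "emeasure P (\<Union>j. cyl {(t, St j)}) = (\<Sum>j. emeasure P (cyl {(t, St j)}))"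
    by (rule suminf_emeasure[symmetric]) (use m in \<open>auto simp: disjoint_family_on_def cyl_def\<close>)
  also have "\<dots> = (\<Sum>j. \<integral>\<^sup>+x. ennreal (ext t x (Some j)) \<partial>measure_pmf \<rho>)"
    using emeasure_single[OF t, of "Some j" for j] by simp
  also have "\<dots> = (\<integral>\<^sup>+x. (\<Sum>j. ennreal (ext t x (Some j))) \<partial>measure_pmf \<rho>)"
    by (rule nn_integral_suminf[symmetric]) simp
  finally have "emeasure P (cyl {(t, Cem)}) + emeasure P (\<Union>j. cyl {(t, St j)})
     = (\<integral>\<^sup>+x. ennreal (ext t x None) + (\<Sum>j. ennreal (ext t x (Some j))) \<partial>measure_pmf \<rho>)"
    using emeasure_single[OF t, of None] by (simp add: nn_integral_add)
  also have "\<dots> = 1" by (simp add: ext_sum[OF t])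
  finally have 1: "emeasure P (cyl {(t, Cem)} \<union> (\<Union>j. cyl {(t, St j)})) = 1"
    by (subst plus_emeasure[symmetric]) (use m in \<open>auto simp: cyl_def\<close>)
  have "emeasure P (cyl {(t, Infty)} \<union> (cyl {(t, Cem)} \<union> (\<Union>j. cyl {(t, St j)})))
     = emeasure P (cyl {(t, Infty)}) + 1"
    unfolding 1[symmetric] by (subst plus_emeasure) (use m in \<open>auto simp: cyl_def\<close>)
  moreover have "emeasure P (cyl {(t, Infty)} \<union> (cyl {(t, Cem)} \<union> (\<Union>j. cyl {(t, St j)}))) \<le> 1"
    by (rule emeasure_le_1)
  ultimately have "ennreal (measure P (cyl {(t, Infty)}) + 1) \<le> ennreal 1"
    by (simp add: emeasure_eq_measure)
  then have "measure P (cyl {(t, Infty)}) = 0"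
    by (simp add: measure_le_0_iff del: ennreal_plus)
  then show ?thesis using m by (intro null_setsI) (auto simp: emeasure_eq_measure)
qed

lemma AE_not_Infty: "t \<ge> 0 \<Longrightarrow> AE w in P. w t \<noteq> Infty"
  using null_Infty[of t] by (intro AE_I[where N = "cyl {(t, Infty)}"]) (auto simp: cyl_def)

text \<open>Fubini exchanges "at each fixed time, for almost every path" with "for almost every
  path, at almost every time".\<close>

lemma AE_occupation_Infty: "AE w in P. emeasure lborel {t. 0 \<le> t \<and> w t = Infty} = 0"
proof -
  let ?J = "\<lambda>w t. indicator {0..} t * indicator {Infty} (w (max 0 t)) :: ennreal"
  interpret pair_sigma_finite P lborel ..
  have meas [measurable]: "(\<lambda>x. indicator {0..} (snd x) * indicator {Infty} (fst x (max 0 (snd x))) :: ennreal)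
    \<in> borel_measurable (P \<Otimes>\<^sub>M lborel)"
    by measurable
  have "(\<integral>\<^sup>+w. \<integral>\<^sup>+t. ?J w t \<partial>lborel \<partial>P)
     = (\<integral>\<^sup>+t. \<integral>\<^sup>+w. ?J w t \<partial>P \<partial>lborel)"
    by (rule Fubini'[symmetric]) (use meas in \<open>simp add: case_prod_beta\<close>)
  also have "\<dots> = (\<integral>\<^sup>+t. 0 \<partial>(lborel :: real measure))"
  proof (rule nn_integral_cong)
    fix t :: real
    have "AE w in P. w (max 0 t) \<noteq> Infty" by (rule AE_not_Infty) simp
    then have "AE w in P. ?J w t = (0::ennreal)"
      by eventually_elim (auto split: split_indicator)
    then show "(\<integral>\<^sup>+w. ?J w t \<partial>P) = 0"
      by (subst nn_integral_0_iff_AE) auto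
  qed
  finally have z: "(\<integral>\<^sup>+w. \<integral>\<^sup>+t. ?J w t \<partial>lborel \<partial>P) = 0"
    by simp
  have "(\<lambda>w. \<integral>\<^sup>+t. ?J w t \<partial>lborel) \<in> borel_measurable P"
    using lborel.borel_measurable_nn_integral[of "\<lambda>w t. ?J w t" P] meas
    by (simp add: case_prod_beta)
  from nn_integral_0_iff_AE[OF this, THEN iffD1, OF z]
  have "AE w in P. (\<integral>\<^sup>+t. ?J w t \<partial>lborel) = 0" .
  then show ?thesis
  proof (rule AE_mp, intro AE_I2 impI)
    fix w assume w: "w \<in> space P" "(\<integral>\<^sup>+t. ?J w t \<partial>lborel) = 0"
    have "(\<integral>\<^sup>+t. ?J w t \<partial>lborel)
       = (\<integral>\<^sup>+t. indicator {t. 0 \<le> t \<and> w t \<in> {Infty}} t \<partial>lborel)"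
      by (intro nn_integral_cong) (auto split: split_indicator)
    also have "\<dots> = emeasure lborel {t. 0 \<le> t \<and> w t \<in> {Infty}}"
      using path_occupation_sets[of w "{Infty}"] w by (intro nn_integral_indicator) auto
    finally show "emeasure lborel {t. 0 \<le> t \<and> w t = Infty} = 0" using w by simp
  qed
qed

section \<open>The Markov property with respect to the natural filtration\<close>

definition past :: "real \<Rightarrow> (real \<Rightarrow> bstate) set set" where
  "past s = sigma_sets cadlag_paths (cyls {0..s})"

lemma past_sets: "C \<in> past s \<Longrightarrow> C \<in> sets path_space"
proof -
  have "cyls {0..s} \<subseteq> cyls {0..}" by (force simp: cyls_def)
  then have "past s \<subseteq> sets path_space"
    unfolding past_def sets_path_space by (rule sigma_sets_mono')
  then show "C \<in> past s \<Longrightarrow> C \<in> sets path_space" by auto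
qed

lemma past_mono: "s \<le> t \<Longrightarrow> past s \<subseteq> past t"
  unfolding past_def by (intro sigma_sets_mono') (force simp: cyls_def)

text \<open>Appending \<open>(s, x)\<close> and \<open>(s + r, y)\<close> to a sorted list of
  earlier constraints multiplies the chain probability by one more factor. A constraint at
  \<open>Infty\<close> makes both sides 0.\<close>

lemma markov_cyl:
  assumes "finite Z" "fst ` Z \<subseteq> {0..s}" "r \<ge> 0" "s \<ge> 0"
  shows "measure P (cyl Z \<inter> cyl {(s, emb x)} \<inter> cyl {(s + r, emb y)}) =
     measure P (cyl Z \<inter> cyl {(s, emb x)}) * ext r x y"
    (is "measure P (_ \<inter> ?X \<inter> ?Y) = _")
proof (cases "\<exists>t. (t, Infty) \<in> Z")
  case True
  then obtain t where t: "(t, Infty) \<in> Z" by blast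
  then have "t \<ge> 0" using assms(2) by force
  have sub: "cyl Z \<subseteq> cyl {(t, Infty)}" using t by (auto simp: cyl_def)
  have "measure P X = 0" if "X \<subseteq> cyl Z" "X \<in> sets P" for X
    using null_sets_subset[OF null_Infty[OF \<open>t \<ge> 0\<close>], of X] that sub
    by (auto simp: measure_eq_emeasure_eq_ennreal null_setsD1 measure_def)
  moreover have "cyl Z \<inter> ?X \<in> sets P" "cyl Z \<inter> ?X \<inter> ?Y \<in> sets P"
    unfolding cyl_Int using assms by (auto intro!: cyl_sets)
  ultimately show ?thesis by (simp add: le_infI1)
next
  case False
  obtain zs where so: "sorted (map fst zs)" and Z: "set (map (\<lambda>z. (fst z, emb (snd z))) zs) = Z"
    using sorted_cylinder[OF assms(1) False] by blast
  have t: "\<forall>z\<in>set zs. 0 \<le> fst z \<and> fst z \<le> s"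
    using assms(2) unfolding Z[symmetric] by force
  let ?l1 = "zs @ [(s, x)]" and ?l2 = "zs @ [(s, x), (s + r, y)]"
  have 1: "cyl Z \<inter> ?X = {w \<in> space P. \<forall>z\<in>set ?l1. w (fst z) = emb (snd z)}"
    unfolding Z[symmetric] cyl_Int by (subst cyl_list[symmetric]) (simp add: insert_commute)
  have 2: "cyl Z \<inter> ?X \<inter> ?Y = {w \<in> space P. \<forall>z\<in>set ?l2. w (fst z) = emb (snd z)}"
    unfolding Z[symmetric] cyl_Int by (subst cyl_list[symmetric]) (simp add: insert_commute)
  have so1: "sorted (0 # map fst ?l1)" and so2: "sorted (0 # map fst ?l2)"
    using so t assms(3,4) by (auto simp: sorted_append)
  have "chain_prob ext ?l2 0 = (\<lambda>x0. chain_prob ext ?l1 0 x0 * ext r x y)"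
    by (simp add: fun_eq_iff chain_prob_append)
  then show ?thesis
    by (subst 2, subst 1, subst fdd[OF so1], subst fdd[OF so2]) simp
qed

text \<open>Both sides are finite measures in \<open>C\<close> that agree on cylinders; Dynkin
  induction extends this to the whole past.\<close>

lemma markov:
  assumes C: "C \<in> past s" and r: "r \<ge> 0" and s: "s \<ge> 0"
  shows "measure P (C \<inter> cyl {(s, emb x)} \<inter> cyl {(s + r, emb y)}) =
     measure P (C \<inter> cyl {(s, emb x)}) * ext r x y"
    (is "measure P (_ \<inter> ?X \<inter> ?Y) = _")
  using Int_stable_cyls cyls_subset_Pow C[unfolded past_def]
proof (induction rule: sigma_sets_induct_disjoint)
  case (basic A)
  then show ?case using markov_cyl r s by (auto simp: cyls_def)
next
  case empty
  then show ?case by simp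
next
  case (compl A)
  have c: "A \<in> sets P" "?X \<in> sets P" "?Y \<in> sets P"
    using past_sets[of A s] compl r s by (auto simp: past_def intro!: cyl_sets)
  have D: "measure P ((cadlag_paths - A) \<inter> X) = measure P X - measure P (A \<inter> X)" if "X \<in> sets P" "X \<subseteq> cadlag_paths" for X
  proof -
    have "(cadlag_paths - A) \<inter> X = X - A \<inter> X" using that by auto
    moreover have "A \<inter> X \<in> sets P" using that c(1) by auto
    ultimately show ?thesis using that finite_measure_Diff[of X "A \<inter> X"] by simp
  qed
  have "measure P ((cadlag_paths - A) \<inter> ?X \<inter> ?Y) =
     measure P (?X \<inter> ?Y) - measure P (A \<inter> ?X \<inter> ?Y)"
  proof -
    have "?X \<inter> ?Y \<in> sets P" using c by blast
    moreover have "?X \<inter> ?Y \<subseteq> cadlag_paths" by (auto simp: cyl_def)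
    ultimately show ?thesis using D by (simp only: Int_assoc)
  qed
  also have "measure P (?X \<inter> ?Y) = measure P (?X) * ext r x y"
  proof -
    have "cadlag_paths \<inter> ?X = ?X" by (auto simp: cyl_def)
    then show ?thesis using markov_cyl[of "{}" s r x y] r s by (simp add: cyl_empty)
  qed
  also have "measure P (?X) * ext r x y - measure P (A \<inter> ?X \<inter> ?Y)
     = (measure P (?X) - measure P (A \<inter> ?X)) * ext r x y"
    using compl by (simp add: algebra_simps)
  also have "measure P (?X) - measure P (A \<inter> ?X) = measure P ((cadlag_paths - A) \<inter> ?X)"
    using D[OF c(2)] by (simp add: cyl_def)
  finally show ?case .
next
  case (union A)
  have A: "A i \<in> sets P" for i using past_sets[of "A i" s] union by (auto simp: past_def)
  have c: "?X \<in> sets P" "?Y \<in> sets P" using r s by (auto intro!: cyl_sets)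
  have 1: "(\<lambda>i. measure P (A i \<inter> X)) sums measure P ((\<Union>i. A i) \<inter> X)" if "X \<in> sets P" for X
  proof -
    have "(\<lambda>i. measure P (A i \<inter> X)) sums measure P (\<Union>i. A i \<inter> X)"
      using A that union by (intro finite_measure_UNION) (auto simp: disjoint_family_on_def)
    then show ?thesis by (simp add: Int_commute)
  qed
  have "(\<lambda>i. measure P (A i \<inter> (?X \<inter> ?Y))) sums measure P ((\<Union>i. A i) \<inter> (?X \<inter> ?Y))"
    by (rule 1) (use c in auto)
  moreover have "(\<lambda>i. measure P (A i \<inter> ?X) * ext r x y) sums (measure P ((\<Union>i. A i) \<inter> ?X) * ext r x y)"
    by (intro sums_mult2 1 c)
  ultimately show ?case using union by (simp add: Int_assoc sums_unique2)
qed

end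

subsection \<open>Recurrence\<close>

context chain_law
begin

text \<open>Up to the null event of being at \<open>Infty\<close>, the countably many states at time
  \<open>s\<close> partition \<open>C\<close>.\<close>

lemma emeasure_partition:
  assumes C: "C \<in> sets P" and s: "s \<ge> 0"
  shows "emeasure P C = (\<integral>\<^sup>+x. emeasure P (C \<inter> cyl {(s, emb x)}) \<partial>count_space UNIV)"
proof -
  have m: "C \<inter> cyl {(s, x)} \<in> sets P" for x using C s by (auto intro!: sets.Int cyl_sets)
  have inj: "x = y" if "emb x = emb y" for x y using that by (cases x; cases y) auto
  have "emeasure P C = emeasure P (\<Union>x. C \<inter> cyl {(s, emb x)})"
  proof (rule emeasure_eq_AE)
    have surj: "\<exists>x. v = emb x" if "v \<noteq> Infty" for v
      using that by (cases v) (auto intro: exI[of _ "Some k" for k] exI[of _ None])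
    have "AE w in P. w \<in> space P" by (rule AE_space)
    with AE_not_Infty[OF s] show "AE w in P. w \<in> C \<longleftrightarrow> w \<in> (\<Union>x. C \<inter> cyl {(s, emb x)})"
      by eventually_elim (use surj in \<open>auto simp: cyl_def\<close>)
    show "(\<Union>x. C \<inter> cyl {(s, emb x)}) \<in> sets P"
      by (rule sets.countable_UN') (use m in auto)
  qed (rule C)
  also have "\<dots> = (\<integral>\<^sup>+x. emeasure P (C \<inter> cyl {(s, emb x)}) \<partial>count_space UNIV)"
    by (rule emeasure_UN_countable) (use m inj in \<open>auto simp: disjoint_family_on_def cyl_def\<close>)
  finally show ?thesis .
qed

text \<open>A lower bound for the probability of being in \<open>{St j, Cem}\<close> a time
  \<open>r\<close> after \<open>x\<close>: from a state of \<nat> it leaves out the possibility of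
  being killed.\<close>

definition kap :: "nat \<Rightarrow> real \<Rightarrow> nat option \<Rightarrow> ennreal" where
  "kap j r x = (case x of None \<Rightarrow> 1 | Some i \<Rightarrow> ennreal (p r i j))"

lemma emeasure_revisit_ge:
  assumes C: "C \<in> past s" and r: "r \<ge> 0" and s: "s \<ge> 0"
  shows "(\<integral>\<^sup>+x. emeasure P (C \<inter> cyl {(s, emb x)}) * kap j r x \<partial>count_space UNIV)
    \<le> emeasure P {w \<in> C. w (s + r) \<in> {St j, Cem}}"
proof -
  have Cs: "C \<in> sets P" using past_sets[OF C] by simp
  have sr: "s + r \<ge> 0" using r s by simp
  have eq: "{w \<in> C. w (s + r) \<in> {St j, Cem}} = C \<inter> (cyl {(s + r, St j)} \<union> cyl {(s + r, Cem)})"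
    using sets.sets_into_space[OF Cs] by (auto simp: cyl_def)
  have m: "C \<inter> cyl {(s, y)} \<inter> cyl {(s + r, x)} \<in> sets P" "{w \<in> C. w (s + r) \<in> {St j, Cem}} \<in> sets P" for x y
    unfolding eq using Cs s sr by (auto intro!: sets.Int sets.Un cyl_sets)
  have "emeasure P (C \<inter> cyl {(s, emb x)}) * kap j r x \<le> emeasure P ({w \<in> C. w (s + r) \<in> {St j, Cem}} \<inter> cyl {(s, emb x)})" for x
  proof -
    define y where "y = (case x of None \<Rightarrow> None | Some i \<Rightarrow> Some j)"
    have "emeasure P (C \<inter> cyl {(s, emb x)}) * kap j r x = emeasure P (C \<inter> cyl {(s, emb x)} \<inter> cyl {(s + r, emb y)})"
    proof -
      have "kap j r x = ennreal (ext r x y)"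
        by (simp add: kap_def y_def extend_trans_def split: option.split)
      then show ?thesis using ext_nonneg[OF r, of x y]
        by (simp add: emeasure_eq_measure markov[OF C r s] ennreal_mult)
    qed
    also have "\<dots> \<le> emeasure P ({w \<in> C. w (s + r) \<in> {St j, Cem}} \<inter> cyl {(s, emb x)})"
    proof (rule emeasure_mono)
      show "C \<inter> cyl {(s, emb x)} \<inter> cyl {(s + r, emb y)} \<subseteq> {w \<in> C. w (s + r) \<in> {St j, Cem}} \<inter> cyl {(s, emb x)}"
        by (auto simp: cyl_def y_def split: option.splits)
    qed (use m(2) s in \<open>auto intro!: sets.Int cyl_sets\<close>)
    finally show ?thesis .
  qed
  then show ?thesis
    unfolding emeasure_partition[OF m(2) s] by (intro nn_integral_mono) auto
qed

text \<open>The weight \<open>exp (- r)\<close> relates its mean to the resolvent at 1. The cemetery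
  is counted along with \<open>j\<close>, so that killed paths do not spoil a lower bound over all
  states.\<close>

definition docc :: "nat \<Rightarrow> real \<Rightarrow> (real \<Rightarrow> bstate) \<Rightarrow> ennreal" where
  "docc j s w = (\<integral>\<^sup>+r. indicator {0..} r * (ennreal (exp (- r)) * indicator {St j, Cem} (w (max 0 (s + r)))) \<partial>lborel)"

lemma docc_joint [measurable]:
  "(\<lambda>x. indicator {0..} (snd x) * (ennreal (exp (- snd x)) * indicator {St j, Cem} (fst x (max 0 (s + snd x)))) :: ennreal)
    \<in> borel_measurable (P \<Otimes>\<^sub>M lborel)"
proof -
  have "(\<lambda>x. fst x (max 0 (s + snd x))) \<in> borel_measurable (P \<Otimes>\<^sub>M lborel)"
    by (rule eval_random_time) measurable
  then show ?thesis by measurable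
qed

lemma docc_measurable [measurable]: "docc j s \<in> borel_measurable P"
  unfolding docc_def
  using lborel.borel_measurable_nn_integral[of "\<lambda>w r. indicator {0..} r * (ennreal (exp (- r)) * indicator {St j, Cem} (w (max 0 (s + r))))" P]
    docc_joint[of j s] by (simp add: case_prod_beta)

text \<open>Conditioning on the state at time \<open>s\<close> and exchanging integrals reduces the
  claim to a single state: from \<open>i\<close> the mean discounted time is at least
  \<open>resolvent p 1 i j\<close>, from the cemetery it is 1, whence the minimum with 1.\<close>

lemma docc_lower:
  assumes lb: "\<And>i. resolvent p 1 i j \<ge> \<delta>" "\<delta> > 0" and C: "C \<in> past s" and s: "s \<ge> 0"
  shows "ennreal (min \<delta> 1) * emeasure P C \<le> (\<integral>\<^sup>+w. indicator C w * docc j s w \<partial>P)"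
proof -
  let ?J = "\<lambda>r w. indicator {0..} r * (ennreal (exp (- r)) * indicator {St j, Cem} (w (max 0 (s + r)))) :: ennreal"
  let ?R = "\<lambda>r. {w \<in> C. w (s + r) \<in> {St j, Cem}}"
  let ?m = "\<lambda>x. emeasure P (C \<inter> cyl {(s, emb x)})"
  interpret pair_sigma_finite P lborel ..
  have Cs: "C \<in> sets P" using past_sets[OF C] by simp
  note C_meas [measurable] = this
  \<comment> \<open>A non-integrable integrand would make the Bochner integral 0, contrary to the
    positive lower bound.\<close>
  have int: "integrable lborel (\<lambda>r. indicator {0..} r *\<^sub>R (exp (- r) * p r i j))" for i
  proof (rule ccontr)
    assume "\<not> ?thesis"
    then have "resolvent p 1 i j = 0"
      unfolding resolvent_def set_lebesgue_integral_def using not_integrable_integral_eq by auto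
    then show False using lb(1)[of i] lb(2) by simp
  qed
  let ?k = "\<lambda>r x. indicator {0..} r * (ennreal (exp (- r)) * kap j r x)"
  have k_eq: "?k r (Some i) = ennreal (indicator {0..} r *\<^sub>R (exp (- r) * p r i j))" for r i
    by (auto simp: kap_def ennreal_mult' split: split_indicator)
  have k_meas: "(\<lambda>r. ?k r x) \<in> borel_measurable lborel" for x
  proof (cases x)
    case (Some i)
    have "(\<lambda>r. ennreal (indicator {0..} r *\<^sub>R (exp (- r) * p r i j))) \<in> borel_measurable lborel"
      using int[of i] by measurable
    then show ?thesis unfolding Some k_eq .
  qed (simp add: kap_def)
  have k_int: "ennreal (min \<delta> 1) \<le> (\<integral>\<^sup>+r. ?k r x \<partial>lborel)" for x
  proof (cases x)
    case None
    have "(\<integral>\<^sup>+r. ?k r x \<partial>lborel) = (\<integral>\<^sup>+r. ennreal (exp (- 1 * (r - 0))) * indicator {0..} r \<partial>lborel)"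
      by (intro nn_integral_cong) (simp add: None kap_def mult.commute)
    then show ?thesis by (subst (asm) nn_integral_exp_tail) (auto simp: min_def intro: ennreal_leI)
  next
    case (Some i)
    have "(\<integral>\<^sup>+r. ?k r x \<partial>lborel) = ennreal (resolvent p 1 i j)"
      unfolding Some k_eq resolvent_def set_lebesgue_integral_def
      using int[of i] by (subst nn_integral_eq_integral) (auto intro!: AE_I2 simp: p_nonneg split: split_indicator)
    then show ?thesis using lb(1)[of i] by (auto intro!: ennreal_leI min.coboundedI1)
  qed
  have "ennreal (min \<delta> 1) * emeasure P C
     = (\<integral>\<^sup>+x. ?m x * ennreal (min \<delta> 1) \<partial>count_space UNIV)"
    unfolding emeasure_partition[OF Cs s]
    by (subst nn_integral_cmult[symmetric]) (auto simp: mult.commute)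
  also have "\<dots> \<le> (\<integral>\<^sup>+x. ?m x * (\<integral>\<^sup>+r. ?k r x \<partial>lborel) \<partial>count_space UNIV)"
    by (intro nn_integral_mono mult_left_mono k_int) auto
  also have "\<dots> = (\<integral>\<^sup>+x. \<integral>\<^sup>+r. ?m x * ?k r x \<partial>lborel \<partial>count_space UNIV)"
    using k_meas by (simp add: nn_integral_cmult)
  also have "\<dots> = (\<integral>\<^sup>+r. \<integral>\<^sup>+x. ?m x * ?k r x \<partial>count_space UNIV \<partial>lborel)"
    by (rule nn_integral_count_space_nn_integral[symmetric]) (use k_meas in auto)
  also have "\<dots> \<le> (\<integral>\<^sup>+r. \<integral>\<^sup>+w. indicator C w * (?J r w) \<partial>P \<partial>lborel)"
  proof (intro nn_integral_mono)
    fix r :: real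
    show "(\<integral>\<^sup>+x. ?m x * ?k r x \<partial>count_space UNIV) \<le>
       (\<integral>\<^sup>+w. indicator C w * (?J r w) \<partial>P)"
    proof (cases "r \<ge> 0")
      case True
      have "?R r = C \<inter> (cyl {(s + r, St j)} \<union> cyl {(s + r, Cem)})"
        using sets.sets_into_space[OF Cs] by (auto simp: cyl_def)
      also have "\<dots> \<in> sets P" using Cs s True by (auto intro!: sets.Int sets.Un cyl_sets)
      finally have R: "?R r \<in> sets P" .
      have "(\<integral>\<^sup>+x. ?m x * ?k r x \<partial>count_space UNIV)
         = ennreal (exp (- r)) * (\<integral>\<^sup>+x. ?m x * kap j r x \<partial>count_space UNIV)"
        using True by (subst nn_integral_cmult[symmetric]) (auto simp: mult_ac)
      also have "\<dots> \<le> ennreal (exp (- r)) * emeasure P (?R r)"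
        by (intro mult_left_mono emeasure_revisit_ge[OF C True s]) auto
      also have "\<dots> = ennreal (exp (- r)) * (\<integral>\<^sup>+w. indicator (?R r) w \<partial>P)"
        by (simp only: nn_integral_indicator[OF R])
      also have "\<dots> = (\<integral>\<^sup>+w. ennreal (exp (- r)) * indicator (?R r) w \<partial>P)"
        by (rule nn_integral_cmult[OF borel_measurable_indicator[OF R], symmetric])
      also have "\<dots> \<le> (\<integral>\<^sup>+w. indicator C w * (?J r w) \<partial>P)"
        using True s by (intro nn_integral_mono) (auto split: split_indicator)
      finally show ?thesis .
    qed auto
  qed
  also have "\<dots> = (\<integral>\<^sup>+w. \<integral>\<^sup>+r. indicator C w * (?J r w) \<partial>lborel \<partial>P)"
  proof (rule Fubini')
    have "(\<lambda>x. indicator C (fst x) * (indicator {0..} (snd x) * (ennreal (exp (- snd x)) * indicator {St j, Cem} (fst x (max 0 (s + snd x))))) :: ennreal)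
      \<in> borel_measurable (P \<Otimes>\<^sub>M lborel)"
      by (intro borel_measurable_times_ennreal docc_joint measurable_compose[OF measurable_fst borel_measurable_indicator] Cs)
    then show "(\<lambda>(w, r). indicator C w * (?J r w)) \<in> borel_measurable (P \<Otimes>\<^sub>M lborel)"
      by (simp add: case_prod_beta)
  qed
  also have "\<dots> = (\<integral>\<^sup>+w. indicator C w * docc j s w \<partial>P)"
  proof (rule nn_integral_cong)
    fix w assume "w \<in> space P"
    then have w: "w \<in> cadlag_paths" by simp
    have "(\<lambda>r. w (max 0 (s + r))) \<in> borel_measurable borel"
      using eval_random_time[of "\<lambda>r. s + r" borel "\<lambda>_. w"] w by (simp add: space_path_space)
    then have "(\<lambda>r. ?J r w) \<in> borel_measurable lborel"
      by measurable
    then show "(\<integral>\<^sup>+r. indicator C w * (?J r w) \<partial>lborel) = indicator C w * docc j s w"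
      unfolding docc_def by (rule nn_integral_cmult)
  qed
  finally show ?thesis .
qed

lemma docc_le_occupation:
  assumes w: "w \<in> cadlag_paths" and s: "s \<ge> 0"
  shows "docc j s w \<le> emeasure lborel {t. s \<le> t \<and> w t \<in> {St j, Cem}}"
proof -
  have "{t. s \<le> t \<and> w t \<in> {St j, Cem}} = {t. 0 \<le> t \<and> w t \<in> {St j, Cem}} \<inter> {s..}" using s by auto
  then have m: "{t. s \<le> t \<and> w t \<in> {St j, Cem}} \<in> sets borel"
    using path_occupation_sets[OF w, of "{St j, Cem}"] by simp
  have "docc j s w \<le> (\<integral>\<^sup>+r. indicator {t. s \<le> t \<and> w t \<in> {St j, Cem}} (s + r) \<partial>lborel)"
    unfolding docc_def using s
    by (intro nn_integral_mono) (auto split: split_indicator)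
  also have "\<dots> = (\<integral>\<^sup>+t. indicator {t. s \<le> t \<and> w t \<in> {St j, Cem}} t \<partial>lborel)"
    using m by (subst nn_integral_real_affine[where c = 1 and t = s]) auto
  also have "\<dots> = emeasure lborel {t. s \<le> t \<and> w t \<in> {St j, Cem}}"
    using m by (intro nn_integral_indicator) simp
  finally show ?thesis .
qed

lemma docc_le_1: "docc j s w \<le> 1"
proof -
  have "docc j s w \<le> (\<integral>\<^sup>+r. ennreal (exp (- 1 * (r - 0))) * indicator {0..} r \<partial>lborel)"
    unfolding docc_def by (intro nn_integral_mono) (auto split: split_indicator)
  also have "\<dots> = 1" by (subst nn_integral_exp_tail) auto
  finally show ?thesis .
qed

text \<open>Only occupation after time \<open>k\<close> enters, and the measure of this tail tends
  to 0 by continuity from above, the total being finite.\<close>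

lemma docc_tendsto_0:
  assumes w: "w \<in> cadlag_paths" and fin: "emeasure lborel {t. 0 \<le> t \<and> w t \<in> {St j, Cem}} < \<infinity>"
  shows "(\<lambda>k. docc j (real k) w) \<longlonglongrightarrow> 0"
proof -
  let ?A = "\<lambda>k::nat. {t. real k \<le> t \<and> w t \<in> {St j, Cem}}"
  have eq: "?A k = {t. 0 \<le> t \<and> w t \<in> {St j, Cem}} \<inter> {real k..}" for k by auto
  have m: "?A k \<in> sets lborel" for k
    unfolding eq using path_occupation_sets[OF w, of "{St j, Cem}"] by simp
  have "emeasure lborel (?A k) \<le> emeasure lborel {t. 0 \<le> t \<and> w t \<in> {St j, Cem}}" for k
    using path_occupation_sets[OF w, of "{St j, Cem}"] by (intro emeasure_mono) auto
  then have "emeasure lborel (?A k) < \<infinity>" for k using fin by (rule le_less_trans)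
  then have "emeasure lborel (?A k) \<noteq> \<infinity>" for k by (simp add: less_top)
  then have "(\<lambda>k. emeasure lborel (?A k)) \<longlonglongrightarrow> emeasure lborel (\<Inter>k. ?A k)"
    using m by (intro Lim_emeasure_decseq) (auto simp: decseq_def)
  moreover have "(\<Inter>k. ?A k) = {}"
  proof -
    have False if "x \<in> (\<Inter>k. ?A k)" for x
      using that reals_Archimedean2[of x] by (auto simp: not_le[symmetric])
    then show ?thesis by blast
  qed
  ultimately have "(\<lambda>k. emeasure lborel (?A k)) \<longlonglongrightarrow> 0" by simp
  then show ?thesis
    by (rule tendsto_sandwich[OF _ _ tendsto_const, rotated 2])
       (use docc_le_occupation[OF w] in \<open>auto intro!: always_eventually\<close>)
qed

text \<open>The events that can be approximated form a sigma-algebra, and a cylinder is itself an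
  event of the past of its latest time.\<close>

lemma past_approximation:
  assumes "B \<in> sets P" "\<epsilon> > 0"
  shows "\<exists>k::nat. \<exists>C\<in>past (real k). measure P (sym_diff B C) < \<epsilon>"
proof -
  have B: "B \<in> sigma_sets cadlag_paths (cyls {0..})" using assms(1) by (simp add: sets_path_space)
  then show ?thesis using assms(2)
  proof (induction arbitrary: \<epsilon> rule: sigma_sets.induct)
    case (Basic A)
    then obtain Z where Z: "A = cyl Z" "finite Z" "fst ` Z \<subseteq> {0..}" by (auto simp: cyls_def)
    obtain M where M: "\<And>t. t \<in> fst ` Z \<Longrightarrow> t \<le> M"
      using Z(2) by (metis Max_ge finite_imageI)
    obtain k where "M \<le> real k" using real_arch_simple by blast
    then have "cyl Z \<in> past (real k)"
      unfolding past_def using Z M by (intro sigma_sets.Basic) (force simp: cyls_def)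
    then show ?case using Z(1) Basic.prems by (auto intro!: exI[of _ k] bexI[of _ "cyl Z"])
  next
    case Empty
    then show ?case by (auto intro!: exI[of _ 0] bexI[of _ "{}"] sigma_sets.Empty simp: past_def)
  next
    case (Compl A)
    from Compl.IH[OF Compl.prems] obtain k C where C: "C \<in> past (real k)" "measure P (sym_diff A C) < \<epsilon>" by blast
    have "A \<subseteq> cadlag_paths" using sets.sets_into_space[of A P] Compl.hyps by (simp add: sets_path_space)
    moreover have "C \<subseteq> cadlag_paths" using sets.sets_into_space[of C P] past_sets[OF C(1)] by simp
    ultimately have "sym_diff (cadlag_paths - A) (cadlag_paths - C) = sym_diff A C" by auto
    moreover have "cadlag_paths - C \<in> past (real k)" using C(1) unfolding past_def by (rule sigma_sets.Compl)
    ultimately show ?case using C(2) by metis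
  next
    case (Union A)
    let ?U = "\<Union>i. A i" and ?A = "\<lambda>n. \<Union>i<n. A i"
    have A: "A i \<in> sets P" for i using Union.hyps by (simp add: sets_path_space)
    have "(\<lambda>n. measure P (?A n)) \<longlonglongrightarrow> measure P (\<Union>n. \<Union>i<n. A i)"
      using A by (intro finite_Lim_measure_incseq) (auto simp: incseq_def intro!: sets.finite_UN intro: less_le_trans)
    also have "(\<Union>n. ?A n) = ?U" by auto
    finally have "eventually (\<lambda>n. dist (measure P (?A n)) (measure P ?U) < \<epsilon> / 2) sequentially"
      using Union.prems by (intro tendstoD) auto
    then obtain n where n: "dist (measure P (?A n)) (measure P ?U) < \<epsilon> / 2"
      by (auto simp: eventually_sequentially)
    have n': "measure P (?U - ?A n) < \<epsilon> / 2"
    proof -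
      have "measure P (?U - ?A n) = measure P ?U - measure P (?A n)"
        using A by (intro finite_measure_Diff) (auto intro!: sets.finite_UN sets.countable_UN)
      then show ?thesis using n by (simp add: dist_real_def abs_if split: if_splits)
    qed
    \<comment> \<open>Half of \<epsilon> pays for truncating the union, the other half is shared by
      \<open>n\<close> sets; \<open>real n + 1\<close> avoids division by 0.\<close>
    have "\<forall>i. \<exists>k::nat. \<exists>C\<in>past (real k). measure P (sym_diff (A i) C) < \<epsilon> / (2 * (real n + 1))"
      using Union.IH Union.prems by auto
    then obtain k C where kC: "\<And>i. C i \<in> past (real (k i))" "\<And>i. measure P (sym_diff (A i) (C i)) < \<epsilon> / (2 * (real n + 1))"
      by metis
    define K where "K = Max (insert 0 (k ` {..<n}))"
    have kK: "k i \<le> K" if "i < n" for i using that by (auto simp: K_def intro!: Max_ge)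
    have CK: "C i \<in> past (real K)" if "i < n" for i
      using kC(1)[of i] past_mono[of "real (k i)" "real K"] kK[OF that] by auto
    have CP: "C i \<in> sets P" for i using past_sets[OF kC(1)] by simp
    have U: "(\<Union>i<n. C i) \<in> past (real K)"
    proof -
      interpret sigma_algebra cadlag_paths "past (real K)"
        unfolding past_def using cyls_subset_Pow by (rule sigma_algebra_sigma_sets)
      show ?thesis using CK by (intro finite_UN) auto
    qed
    have "sym_diff ?U (\<Union>i<n. C i) \<subseteq> (?U - ?A n) \<union> (\<Union>i<n. sym_diff (A i) (C i))"
      by auto
    then have "measure P (sym_diff ?U (\<Union>i<n. C i)) \<le> measure P ((?U - ?A n) \<union> (\<Union>i<n. sym_diff (A i) (C i)))"
      using A CP by (intro finite_measure_mono) (auto intro!: sets.Un sets.Diff sets.finite_UN sets.countable_UN simp del: sets_P)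
    also have "\<dots> \<le> measure P (?U - ?A n) + measure P (\<Union>i<n. sym_diff (A i) (C i))"
      using A CP by (intro measure_Un_le) (auto intro!: sets.Un sets.Diff sets.finite_UN sets.countable_UN simp del: sets_P)
    also have "measure P (\<Union>i<n. sym_diff (A i) (C i)) \<le> (\<Sum>i<n. measure P (sym_diff (A i) (C i)))"
      using A CP by (intro measure_UNION_le) (auto intro!: sets.Un sets.Diff simp del: sets_P)
    also have "\<dots> \<le> (\<Sum>i<n. \<epsilon> / (2 * (real n + 1)))"
      using kC(2) by (intro sum_mono less_imp_le)
    also have "\<dots> = real n * (\<epsilon> / (2 * (real n + 1)))" by simp
    also have "\<dots> \<le> \<epsilon> / 2" using Union.prems by (simp add: field_simps)
    finally have "measure P (sym_diff ?U (\<Union>i<n. C i)) < \<epsilon>" using n' by simp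
    then show ?case using U by blast
  qed
qed

lemma occupation_measurable [measurable]:
  "(\<lambda>w. emeasure lborel {t. 0 \<le> t \<and> w t \<in> U}) \<in> borel_measurable P"
proof -
  let ?J = "\<lambda>w t. indicator {0..} t * indicator U (w (max 0 t)) :: ennreal"
  have "(\<lambda>x. indicator {0..} (snd x) * indicator U (fst x (max 0 (snd x))) :: ennreal) \<in> borel_measurable (P \<Otimes>\<^sub>M lborel)"
    by measurable
  then have "(\<lambda>w. \<integral>\<^sup>+t. ?J w t \<partial>lborel) \<in> borel_measurable P"
    using lborel.borel_measurable_nn_integral[of "\<lambda>w t. ?J w t" P]
    by (simp add: case_prod_beta)
  also have "?this \<longleftrightarrow> ?thesis"
  proof (rule measurable_cong)
    fix w assume "w \<in> space P"
    have "(\<integral>\<^sup>+t. ?J w t \<partial>lborel) = (\<integral>\<^sup>+t. indicator {t. 0 \<le> t \<and> w t \<in> U} t \<partial>lborel)"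
      by (intro nn_integral_cong) (auto split: split_indicator)
    also have "\<dots> = emeasure lborel {t. 0 \<le> t \<and> w t \<in> U}"
      using path_occupation_sets[of w U] \<open>w \<in> space P\<close> by (intro nn_integral_indicator) auto
    finally show "(\<integral>\<^sup>+t. ?J w t \<partial>lborel) = emeasure lborel {t. 0 \<le> t \<and> w t \<in> U}" .
  qed
  finally show ?thesis .
qed

text \<open>From every state and at every time the discounted occupation time of \<open>{j, \<partial>}\<close> is at least
  \<open>min \<delta> 1\<close> in the mean, given the past. On the event that the total occupation time is finite it
  tends to 0; as this event is approximated by events of the past, it is negligible.\<close>

lemma AE_occupation_infinite:
  assumes lb: "\<And>i. resolvent p 1 i j \<ge> \<delta>" "\<delta> > 0"
  shows "AE w in P. emeasure lborel {t. 0 \<le> t \<and> w t \<in> {St j, Cem}} = \<infinity>"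
proof -
  define B where "B = {w \<in> space P. emeasure lborel {t. 0 \<le> t \<and> w t \<in> {St j, Cem}} < \<infinity>}"
  have B: "B \<in> sets P"
    unfolding B_def by measurable
  define d where "d = min \<delta> 1"
  have d: "d > 0" using lb(2) by (simp add: d_def)
  have lim: "(\<lambda>k. \<integral>\<^sup>+w. indicator B w * docc j (real k) w \<partial>P) \<longlonglongrightarrow> (\<integral>\<^sup>+w. 0 \<partial>P)"
  proof (rule nn_integral_dominated_convergence[where w = "\<lambda>_. 1"])
    show "AE w in P. (\<lambda>k. indicator B w * docc j (real k) w) \<longlonglongrightarrow> 0"
    proof (rule AE_I2)
      fix w assume w: "w \<in> space P"
      show "(\<lambda>k. indicator B w * docc j (real k) w) \<longlonglongrightarrow> 0"
      proof (cases "w \<in> B")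
        case True
        then show ?thesis using docc_tendsto_0[of w j] w by (auto simp: B_def)
      qed auto
    qed
    show "(\<integral>\<^sup>+w. 1 \<partial>P) < \<infinity>" using emeasure_space_1 by simp
  qed (use B in \<open>auto simp: docc_le_1 split: split_indicator\<close>)
  have "measure P B \<le> \<epsilon> / d + \<epsilon>" if \<epsilon>: "\<epsilon> > 0" for \<epsilon>
  proof -
    obtain k C where C: "C \<in> past (real k)" "measure P (sym_diff B C) < \<epsilon>"
      using past_approximation[OF B \<epsilon>] by blast
    have CP: "C \<in> sets P" using past_sets[OF C(1)] by simp
    have le: "measure P (C - B) \<le> \<epsilon>" "measure P (B - C) \<le> \<epsilon>"
      using C(2) finite_measure_mono[of "C - B" "sym_diff B C"] finite_measure_mono[of "B - C" "sym_diff B C"] B CP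
      by (auto simp: sets.Un sets.Diff simp del: sets_P)
    \<comment> \<open>Trading \<open>C\<close> for \<open>B\<close> costs at most the probability of
      \<open>C - B\<close>, because \<open>docc\<close> is at most 1.\<close>
    have "ennreal d * emeasure P C \<le> (\<integral>\<^sup>+w. indicator B w * docc j (real k') w \<partial>P) + ennreal \<epsilon>" if "k' \<ge> k" for k'
    proof -
      have "ennreal d * emeasure P C \<le> (\<integral>\<^sup>+w. indicator C w * docc j (real k') w \<partial>P)"
        unfolding d_def using C(1) past_mono[of "real k" "real k'"] that
        by (intro docc_lower lb) auto
      also have "\<dots> \<le> (\<integral>\<^sup>+w. indicator B w * docc j (real k') w + indicator (C - B) w \<partial>P)"
        using docc_le_1 by (intro nn_integral_mono) (auto split: split_indicator)
      also have "\<dots> = (\<integral>\<^sup>+w. indicator B w * docc j (real k') w \<partial>P) + (\<integral>\<^sup>+w. indicator (C - B) w \<partial>P)"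
        by (rule nn_integral_add) (use B CP in \<open>auto intro!: borel_measurable_times_ennreal borel_measurable_indicator docc_measurable simp del: sets_P\<close>)
      also have "(\<integral>\<^sup>+w. indicator (C - B) w \<partial>P) = emeasure P (C - B)"
        using B CP by (intro nn_integral_indicator sets.Diff)
      also have "\<dots> \<le> ennreal \<epsilon>" using le(1) by (simp add: emeasure_eq_measure ennreal_leI)
      finally show ?thesis by (auto intro: add_left_mono)
    qed
    \<comment> \<open>As \<open>k'\<close> tends to infinity the contribution of \<open>B\<close>
      disappears, so \<open>C\<close>, and with it \<open>B\<close>, has small probability.\<close>
    then have "ennreal d * emeasure P C \<le> (\<integral>\<^sup>+w. 0 \<partial>P) + ennreal \<epsilon>"
      by (intro tendsto_lowerbound[OF tendsto_add[OF lim tendsto_const]])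
         (auto simp: eventually_sequentially)
    then have "d * measure P C \<le> \<epsilon>"
      using d \<epsilon> by (simp add: emeasure_eq_measure ennreal_mult'[symmetric])
    then have "measure P C \<le> \<epsilon> / d" using d by (simp add: field_simps)
    moreover have "measure P B \<le> measure P C + measure P (B - C)"
    proof -
      have "measure P B \<le> measure P (C \<union> (B - C))"
        using B CP by (intro finite_measure_mono) (auto simp del: sets_P)
      also have "\<dots> \<le> measure P C + measure P (B - C)"
        using B CP by (intro measure_Un_le) (auto simp del: sets_P)
      finally show ?thesis .
    qed
    ultimately show ?thesis using le by simp
  qed
  note * = this
  have "measure P B \<le> 0"
  proof (rule field_le_epsilon)
    fix e :: real assume e: "e > 0"
    define c where "c = 1 / d + 1"
    have c: "c > 0" using d by (simp add: c_def add_pos_pos)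
    have "measure P B \<le> (e / c) / d + e / c"
      using e c by (intro *) simp
    also have "\<dots> = e / c * (1 / d + 1)" by (simp only: distrib_left) simp
    also have "\<dots> = e / c * c" by (simp only: c_def)
    also have "\<dots> = e" using c by simp
    finally show "measure P B \<le> 0 + e" by simp
  qed
  then have "emeasure P B = 0" by (simp add: emeasure_eq_measure measure_le_0_iff)
  then show ?thesis
    by (intro AE_I[where N = B]) (use B in \<open>auto simp: B_def less_top\<close>)
qed


subsection \<open>Jumps out of \<open>\<nat>\<close>\<close>

lemma step_out_le:
  assumes "s \<ge> 0" "h \<ge> 0"
  shows "measure P (cyl {(s, St k)} - (\<Union>j\<le>m. cyl {(s + h, St j)})) \<le> 1 - (\<Sum>j\<le>m. p h k j)"
proof -
  let ?X = "cyl {(s, St k)}" and ?Y = "\<lambda>j. cyl {(s + h, St j)}"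
  have c: "?X \<in> sets P" "?Y j \<in> sets P" for j using assms by (auto intro!: cyl_sets)
  have XY: "measure P (?X \<inter> ?Y j) = measure P ?X * p h k j" for j
  proof -
    have "cadlag_paths \<in> past s" unfolding past_def by (rule sigma_sets_top)
    from markov[OF this assms(2,1), of "Some k" "Some j"] show ?thesis
      by (simp add: cyl_empty[symmetric] cyl_Int extend_trans_def)
  qed
  have eq: "?X - (\<Union>j\<le>m. ?Y j) = ?X - (\<Union>j\<le>m. ?X \<inter> ?Y j)" by auto
  have "measure P (?X - (\<Union>j\<le>m. ?X \<inter> ?Y j)) = measure P ?X - measure P (\<Union>j\<le>m. ?X \<inter> ?Y j)"
    using c by (intro finite_measure_Diff) (auto intro!: sets.finite_UN sets.Int simp del: sets_P)
  also have "measure P (\<Union>j\<le>m. ?X \<inter> ?Y j) = (\<Sum>j\<le>m. measure P (?X \<inter> ?Y j))"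
    using c by (intro finite_measure_finite_Union) (auto simp: disjoint_family_on_def cyl_def simp del: sets_P)
  also have "measure P ?X - (\<Sum>j\<le>m. measure P (?X \<inter> ?Y j)) = measure P ?X * (1 - (\<Sum>j\<le>m. p h k j))"
    by (simp only: XY sum_distrib_left right_diff_distrib mult_1_right)
  also have "\<dots> \<le> 1 * (1 - (\<Sum>j\<le>m. p h k j))"
  proof (rule mult_right_mono)
    have "(\<Sum>j\<le>m. p h k j) \<le> (\<Sum>j. p h k j)"
      using assms by (intro sum_le_suminf p_summable) (auto simp: p_nonneg)
    then show "0 \<le> 1 - (\<Sum>j\<le>m. p h k j)" using p_sum_le[OF assms(2), of k] by simp
  qed simp
  finally show ?thesis unfolding eq by simp
qed

text \<open>The partial row sum of \<open>p\<close> is 1 at time 0 and has derivative 0 there, so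
  the mass outside \<open>{0..m}\<close> after time \<open>h\<close> is \<open>o(h)\<close>. The
  factor \<open>Suc N\<close> is the number of grid steps per unit of time.\<close>

lemma row_sum_rate:
  assumes "(\<Sum>j\<le>m. q k j) = 0" "k \<le> m"
  shows "(\<lambda>N. real (Suc N) * (1 - (\<Sum>j\<le>m. p (1 / real (Suc N)) k j))) \<longlonglongrightarrow> 0"
proof -
  let ?f = "\<lambda>h. \<Sum>j\<le>m. p h k j"
  have "(?f has_real_derivative (\<Sum>j\<le>m. q k j)) (at 0 within {0..})"
    by (intro DERIV_sum p_deriv)
  then have "((\<lambda>h. (?f h - ?f 0) / (h - 0)) \<longlongrightarrow> 0) (at 0 within {0..})"
    using assms(1) by (simp add: has_field_derivative_iff)
  moreover have "?f 0 = 1" using assms(2) by (simp add: p_0)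
  ultimately have "((\<lambda>h. (?f h - 1) / h) \<longlongrightarrow> 0) (at 0 within {0..})" by simp
  moreover have "filterlim (\<lambda>N. 1 / real (Suc N)) (at 0 within {0..}) sequentially"
    unfolding filterlim_at using LIMSEQ_Suc[OF lim_1_over_n] by auto
  ultimately have "(\<lambda>N. (?f (1 / real (Suc N)) - 1) / (1 / real (Suc N))) \<longlonglongrightarrow> 0"
    by (rule filterlim_compose)
  from tendsto_minus[OF this] show ?thesis by (simp add: algebra_simps del: of_nat_Suc)
qed

text \<open>A jump from \<open>k\<close> beyond \<open>k + 1\<close> (in particular to \<open>\<infinity>\<close> or \<open>\<partial>\<close>) is visible on all fine enough
  grids as a single step, and such a step has probability \<open>o(h)\<close> on a grid of width \<open>h\<close>.\<close>

lemma AE_no_exit_jump: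
  assumes q: "\<And>k. (\<Sum>j\<le>Suc k. q k j) = 0"
  shows "AE w in P. \<forall>t>0. \<forall>k. (w \<longlongrightarrow> St k) (at_left t) \<longrightarrow> w t \<in> range St"
proof -
  let ?h = "\<lambda>N::nat. 1 / real (Suc N)"
  let ?C = "\<lambda>k N i. cyl {(real i * ?h N, St k)} - (\<Union>j\<le>Suc k. cyl {(real i * ?h N + ?h N, St j)})"
  let ?S = "\<lambda>k N. \<Sum>j\<le>Suc k. p (?h N) k j"
  \<comment> \<open>At some grid time up to \<open>T\<close> the path is in \<open>k\<close>, and at
    the next grid time it is outside \<open>{0, ..., k + 1}\<close>.\<close>
  define E where "E k T N = (\<Union>i\<le>T * Suc N. ?C k N i)" for k T N
  have E1: "?C k N i \<in> sets P" for i k N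
    by (intro sets.Diff sets.finite_UN) (auto intro!: cyl_sets)
  have E_sets: "E k T N \<in> sets P" for k T N
    unfolding E_def by (intro sets.finite_UN E1) simp
  have E_le: "measure P (E k T N) \<le> (real T + 1) * (real (Suc N) * (1 - ?S k N))" for k T N
  proof -
    have "measure P (E k T N) \<le> (\<Sum>i\<le>T * Suc N. 1 - ?S k N)"
      unfolding E_def by (intro order_trans[OF measure_UNION_le] sum_mono step_out_le E1) auto
    also have "\<dots> = (real T * real (Suc N) + 1) * (1 - ?S k N)"
    proof -
      have "real (Suc (T * Suc N)) = real T * real (Suc N) + 1" by (simp add: algebra_simps)
      then show ?thesis by (simp only: sum_constant card_atMost)
    qed
    also have "\<dots> \<le> (real T * real (Suc N) + real (Suc N)) * (1 - ?S k N)"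
    proof (rule mult_right_mono)
      have "?S k N \<le> (\<Sum>j. p (?h N) k j)"
        by (intro sum_le_suminf p_summable) (auto simp: p_nonneg)
      then show "0 \<le> 1 - ?S k N" using p_sum_le[of "?h N" k] by simp
    qed simp
    finally show ?thesis by (simp add: algebra_simps)
  qed
  have "(\<lambda>N. (real T + 1) * (real (Suc N) * (1 - ?S k N))) \<longlonglongrightarrow> (real T + 1) * 0" for k T
    by (intro tendsto_mult tendsto_const row_sum_rate q) simp
  then have up: "(\<lambda>N. (real T + 1) * (real (Suc N) * (1 - ?S k N))) \<longlonglongrightarrow> 0" for k T
    by simp
  have E_lim: "(\<lambda>N. measure P (E k T N)) \<longlonglongrightarrow> 0" for k T
    by (rule tendsto_sandwich[OF _ _ tendsto_const up[of T k]])
       (intro always_eventually allI E_le measure_nonneg)+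
  \<comment> \<open>The grid events have probabilities tending to 0, so the event that all of them
    from \<open>N0\<close> on occur is null.\<close>
  have null: "(\<Inter>N\<in>{N0..}. E k T N) \<in> null_sets P" for k T N0
  proof -
    have s: "(\<Inter>N\<in>{N0..}. E k T N) \<in> sets P"
      by (intro sets.countable_INT') (auto simp: E_sets simp del: sets_P)
    have "measure P (\<Inter>N\<in>{N0..}. E k T N) \<le> measure P (E k T N)" if "N \<ge> N0" for N
      using that by (intro finite_measure_mono E_sets) auto
    then have "measure P (\<Inter>N\<in>{N0..}. E k T N) \<le> 0"
      by (intro tendsto_lowerbound[OF E_lim[of k T]]) (auto simp: eventually_sequentially)
    then show ?thesis using s by (intro null_setsI) (auto simp: emeasure_eq_measure measure_le_0_iff)
  qed
  have "AE w in P. \<forall>k T N0. w \<notin> (\<Inter>N\<in>{N0..}. E k T N)"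
    unfolding AE_all_countable using AE_not_in[OF null] by blast
  moreover have "AE w in P. w \<in> Omega" by (rule AE_Omega)
  ultimately show ?thesis
  proof eventually_elim
    case (elim w)
    have w: "w \<in> cadlag_paths" using elim(2) by (auto simp: Omega_def)
    show ?case
    proof (intro allI impI)
      fix t :: real and k assume t: "t > 0" and lim: "(w \<longlongrightarrow> St k) (at_left t)"
      show "w t \<in> range St"
      proof (rule ccontr)
        assume nr: "w t \<notin> range St"
        obtain T where T: "t \<le> real T" using real_arch_simple by blast
        \<comment> \<open>The index of the last grid point strictly before \<open>t\<close>. The
          ceiling is used because \<open>t\<close> may be a grid point and must then be the right
          end of its step.\<close>
        define i where "i N = nat (\<lceil>real (Suc N) * t\<rceil> - 1)" for N
        let ?u = "\<lambda>N. real (i N) * ?h N"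
        have pos: "real (Suc N) * t > 0" for N using t by simp
        have ri: "real (i N) = of_int \<lceil>real (Suc N) * t\<rceil> - 1" for N
        proof -
          have "\<lceil>real (Suc N) * t\<rceil> \<ge> 1" using pos[of N] by (simp add: le_ceiling_iff)
          then show ?thesis unfolding i_def by simp
        qed
        have lo: "?u N < t" "t - ?h N \<le> ?u N" "t \<le> ?u N + ?h N" "?u N + ?h N < t + ?h N" for N
        proof -
          have 1: "real (i N) < real (Suc N) * t" "real (Suc N) * t \<le> real (i N) + 1"
            using ceiling_correct[of "real (Suc N) * t"] unfolding ri by linarith+
          show "?u N < t" using 1(1) by (simp add: divide_less_eq mult.commute del: of_nat_Suc)
          moreover show "t \<le> ?u N + ?h N"
            using 1(2) by (simp add: add_divide_distrib[symmetric] pos_le_divide_eq mult.commute del: of_nat_Suc)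
          ultimately show "t - ?h N \<le> ?u N" "?u N + ?h N < t + ?h N" by linarith+
        qed
        have "open {St k}" "open (- St ` {..Suc k})" by (simp_all add: open_isolated open_cofinite)
        with left_nbhd[OF lim, of "{St k}"] cadlag_right_nbhd[OF w, of t "- St ` {..Suc k}"] t nr
        obtain d d' where d: "d > 0" "\<And>s. t - d < s \<Longrightarrow> s < t \<Longrightarrow> w s = St k"
          and d': "d' > 0" "\<And>s. t \<le> s \<Longrightarrow> s < t + d' \<Longrightarrow> w s \<in> - St ` {..Suc k}"
          by (auto simp: image_iff)
        have hlim: "?h \<longlonglongrightarrow> 0" by (rule LIMSEQ_Suc[OF lim_1_over_n])
        have "eventually (\<lambda>N. ?h N < min d d') sequentially"
          using hlim d(1) d'(1) by (intro order_tendstoD(2)) auto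
        then obtain N0 where N0: "\<And>N. N \<ge> N0 \<Longrightarrow> ?h N < min d d'"
          by (auto simp: eventually_sequentially)
        have "w \<in> E k T N" if "N \<ge> N0" for N
        proof -
          have "w (?u N) = St k"
            using lo(1,2)[of N] N0[OF that] by (intro d(2)) linarith+
          moreover have "w (?u N + ?h N) \<in> - St ` {..Suc k}"
            using lo(3,4)[of N] N0[OF that] by (intro d'(2)) linarith+
          moreover have "i N \<le> T * Suc N"
          proof -
            have "real (i N) < real (Suc N) * t" using ceiling_correct[of "real (Suc N) * t"] unfolding ri by linarith
            also have "\<dots> \<le> real (Suc N) * real T" using T by (intro mult_left_mono) auto
            finally have "real (i N) < real (T * Suc N)" by (simp add: algebra_simps)
            then show ?thesis by (simp only: of_nat_less_iff)
          qed
          ultimately show ?thesis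
            unfolding E_def using w by (intro UN_I[of "i N"]) (auto simp: cyl_def image_iff simp del: of_nat_Suc)
        qed
        then have "w \<in> (\<Inter>N\<in>{N0..}. E k T N)" by auto
        then show False using elim(1) by blast
      qed
    qed
  qed
qed

end

subsection \<open>Cutting and gluing\<close>

locale cut_times =
  fixes \<alpha> \<beta> :: "nat \<Rightarrow> ereal"
  assumes \<beta>0: "\<beta> 0 = 0" and \<beta>\<alpha>: "\<beta> m \<le> \<alpha> (Suc m)" and \<alpha>\<beta>: "\<alpha> (Suc m) \<le> \<beta> (Suc m)"
begin

lemma \<beta>_mono: "m \<le> m' \<Longrightarrow> \<beta> m \<le> \<beta> m'"
  by (rule lift_Suc_mono_le) (auto intro: order_trans[OF \<beta>\<alpha> \<alpha>\<beta>])

lemma \<beta>_nonneg: "0 \<le> \<beta> m"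
  using \<beta>_mono[of 0 m] \<beta>0 by simp

lemma gap_nonneg: "0 \<le> \<alpha> (Suc m) - \<beta> m"
  using \<beta>\<alpha>[of m] \<beta>_nonneg[of m] by (cases "\<alpha> (Suc m)"; cases "\<beta> m") auto

lemma glue_mono: "m \<le> m' \<Longrightarrow> glue_time \<alpha> \<beta> m \<le> glue_time \<alpha> \<beta> m'"
proof (rule lift_Suc_mono_le)
  fix m show "glue_time \<alpha> \<beta> m \<le> glue_time \<alpha> \<beta> (Suc m)"
    using add_left_mono[OF gap_nonneg, of "glue_time \<alpha> \<beta> m" m] by simp
qed

lemma glue_nonneg: "0 \<le> glue_time \<alpha> \<beta> m"
  using glue_mono[of 0 m] by simp

lemma in_piece_unique: "in_piece \<alpha> \<beta> t m \<Longrightarrow> in_piece \<alpha> \<beta> t m' \<Longrightarrow> m = m'"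
proof (rule ccontr)
  assume a: "in_piece \<alpha> \<beta> t m" "in_piece \<alpha> \<beta> t m'" "m \<noteq> m'"
  have False if "i < j" "in_piece \<alpha> \<beta> t i" "in_piece \<alpha> \<beta> t j" for i j
    using glue_mono[of "Suc i" j] that by (auto simp: in_piece_def)
  then show False using a by (metis linorder_neqE_nat)
qed

lemma in_piece_cases:
  assumes "in_piece \<alpha> \<beta> t m"
  obtains b d where "\<beta> m = ereal b" "glue_time \<alpha> \<beta> m = ereal d" "0 \<le> b" "0 \<le> d" "d \<le> t"
proof -
  have "\<beta> m < \<infinity>" "glue_time \<alpha> \<beta> m \<le> ereal t" using assms by (auto simp: in_piece_def)
  then show ?thesis using that \<beta>_nonneg[of m] glue_nonneg[of m]
    by (cases "\<beta> m"; cases "glue_time \<alpha> \<beta> m") auto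
qed

lemma C_transform_piece:
  assumes "in_piece \<alpha> \<beta> t m" "t \<ge> 0" "\<beta> m = ereal b" "glue_time \<alpha> \<beta> m = ereal d"
  shows "C_transform \<alpha> \<beta> x t = x (b + (t - d))"
proof -
  have "(LEAST m. in_piece \<alpha> \<beta> t m) = m"
    using assms(1) in_piece_unique by (metis LeastI)
  then show ?thesis using assms by (simp add: C_transform_def)
qed

lemma C_transform_cadlag:
  assumes x: "x \<in> cadlag_paths" and cov: "\<forall>t\<ge>0. \<exists>m. in_piece \<alpha> \<beta> t m"
  shows "C_transform \<alpha> \<beta> x \<in> cadlag_paths"
proof -
  let ?y = "C_transform \<alpha> \<beta> x"
  have "(?y \<longlongrightarrow> ?y t) (at_right t)" if t: "t \<ge> 0" for t
  proof -
    obtain m where m: "in_piece \<alpha> \<beta> t m" using cov t by blast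
    then obtain b d where bd: "\<beta> m = ereal b" "glue_time \<alpha> \<beta> m = ereal d" "0 \<le> b" "0 \<le> d" "d \<le> t"
      by (rule in_piece_cases)
    obtain u where u: "ereal t < ereal u" "ereal u < glue_time \<alpha> \<beta> (Suc m)"
      using m ereal_dense2[of "ereal t" "glue_time \<alpha> \<beta> (Suc m)"] by (auto simp: in_piece_def)
    have "eventually (\<lambda>s. x (b + (s - d)) = ?y s) (at_right t)"
      unfolding eventually_at_right_field
    proof (intro exI[of _ u] conjI allI impI)
      fix s assume s: "t < s" "s < u"
      have "ereal s < glue_time \<alpha> \<beta> (Suc m)" using s(2) u(2) by (meson less_ereal.simps(1) less_trans)
      then have "in_piece \<alpha> \<beta> s m" using m s bd by (auto simp: in_piece_def)
      then show "x (b + (s - d)) = ?y s" using C_transform_piece[of s m b d x] s t bd by simp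
    qed (use u in simp)
    moreover have "((\<lambda>s. x (b + (s - d))) \<longlongrightarrow> x (b + (t - d))) (at_right t)"
    proof (rule filterlim_compose[OF cadlag_right[OF x]])
      show "filterlim (\<lambda>s. b + (s - d)) (at_right (b + (t - d))) (at_right t)"
        unfolding filterlim_at by (auto intro!: tendsto_eq_intros eventually_at_rightI[of t "t + 1"])
    qed (use bd in auto)
    ultimately have "(?y \<longlongrightarrow> x (b + (t - d))) (at_right t)" by (rule Lim_transform_eventually[rotated])
    then show ?thesis using C_transform_piece[OF m t bd(1,2)] by simp
  qed
  moreover have "\<exists>l. (?y \<longlongrightarrow> l) (at_left t)" if t: "t > 0" for t
  proof -
    \<comment> \<open>For the left limit the pieces are taken closed on the right: at a glueing time
      the left limit comes from the piece that ends there.\<close>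
    have "\<exists>m. \<beta> m < \<infinity> \<and> glue_time \<alpha> \<beta> m < ereal t \<and> ereal t \<le> glue_time \<alpha> \<beta> (Suc m)"
    proof -
      obtain m where m: "in_piece \<alpha> \<beta> t m" using cov t by (meson less_imp_le)
      define k where "k = (LEAST k. ereal t \<le> glue_time \<alpha> \<beta> (Suc k))"
      have k: "ereal t \<le> glue_time \<alpha> \<beta> (Suc k)"
        unfolding k_def by (rule LeastI[of _ m]) (use m in \<open>auto simp: in_piece_def\<close>)
      have k2: "glue_time \<alpha> \<beta> k < ereal t"
      proof (cases k)
        case (Suc i)
        then have "\<not> ereal t \<le> glue_time \<alpha> \<beta> (Suc i)" using not_less_Least[of i "\<lambda>k. ereal t \<le> glue_time \<alpha> \<beta> (Suc k)"]
          unfolding k_def by (simp del: glue_time.simps)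
        then show ?thesis using Suc by simp
      qed (use t in simp)
      have "\<beta> k < \<infinity>"
      proof (cases "k = m")
        case True
        then show ?thesis using m by (simp add: in_piece_def)
      next
        case False
        then have "k < m" using m unfolding k_def
          by (metis (no_types, lifting) Least_le in_piece_def less_imp_le order_le_less)
        then have "\<beta> k \<le> \<beta> m" by (intro \<beta>_mono) simp
        then show ?thesis using m by (auto simp: in_piece_def)
      qed
      then show ?thesis using k k2 by blast
    qed
    then obtain m where m: "\<beta> m < \<infinity>" "glue_time \<alpha> \<beta> m < ereal t" "ereal t \<le> glue_time \<alpha> \<beta> (Suc m)" by blast
    obtain b d where bd: "\<beta> m = ereal b" "glue_time \<alpha> \<beta> m = ereal d" "0 \<le> b" "0 \<le> d" "d < t"
      using m \<beta>_nonneg[of m] glue_nonneg[of m] by (cases "\<beta> m"; cases "glue_time \<alpha> \<beta> m") auto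
    obtain l where l: "(x \<longlongrightarrow> l) (at_left (b + (t - d)))" using cadlag_left[OF x, of "b + (t - d)"] bd by auto
    have "eventually (\<lambda>s. x (b + (s - d)) = ?y s) (at_left t)"
      unfolding eventually_at_left_field
    proof (intro exI[of _ d] conjI allI impI)
      fix s assume s: "d < s" "s < t"
      have "ereal s < glue_time \<alpha> \<beta> (Suc m)" using s(2) m(3) by (metis less_ereal.simps(1) order_less_le_trans)
      then have "in_piece \<alpha> \<beta> s m" using m s bd by (auto simp: in_piece_def)
      then show "x (b + (s - d)) = ?y s" using C_transform_piece[of s m b d x] s t bd by simp
    qed (use bd in simp)
    moreover have "((\<lambda>s. x (b + (s - d))) \<longlongrightarrow> l) (at_left t)"
    proof (rule filterlim_compose[OF l])
      show "filterlim (\<lambda>s. b + (s - d)) (at_left (b + (t - d))) (at_left t)"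
        unfolding filterlim_at by (auto intro!: tendsto_eq_intros eventually_at_leftI[of "t - 1" t])
    qed
    ultimately have "(?y \<longlongrightarrow> l) (at_left t)" by (rule Lim_transform_eventually[rotated])
    then show ?thesis ..
  qed
  ultimately show ?thesis by (auto simp: cadlag_paths_def C_transform_def)
qed

end

text \<open>The time change on one piece: a shift, except that the last bit of length \<open>\<delta>\<close> is stretched so as
  to absorb the discarded interval \<open>[e, s')\<close>.\<close>

lemma piece_map:
  fixes s e s' d \<delta> :: real
  assumes "e \<le> s'" "0 < \<delta>" "\<delta> < e - s"
  defines "d' \<equiv> d + (e - s)"
  obtains \<phi> where "strict_mono_on {d..<d'} \<phi>" "\<phi> ` {d..<d'} = {s..<s'}"
    "\<And>t. d \<le> t \<Longrightarrow> t \<le> d' - \<delta> \<Longrightarrow> \<phi> t = s + (t - d)"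
    "\<And>t. d' - \<delta> < t \<Longrightarrow> t < d' \<Longrightarrow> \<phi> t \<in> {e - \<delta><..<s'}"
    "\<And>t. d \<le> t \<Longrightarrow> t < d' \<Longrightarrow> s + (t - d) \<le> \<phi> t \<and> \<phi> t \<le> s' + (t - d')"
proof
  \<comment> \<open>The slope of the stretched bit, which has length \<open>\<delta>\<close> and
    must cover a length \<open>\<delta> + (s' - e)\<close>.\<close>
  define k where "k = (s' - e + \<delta>) / \<delta>"
  have k1: "k \<ge> 1" using assms by (simp add: k_def)
  have k\<delta>: "k * \<delta> = s' - e + \<delta>" using assms by (simp add: k_def)
  define \<phi> where "\<phi> t = (if t \<le> d' - \<delta> then s + (t - d) else e - \<delta> + k * (t - (d' - \<delta>)))" for t
  \<comment> \<open>The same line anchored at its right end \<open>(d', s')\<close>, from which the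
    upper bounds are read off.\<close>
  have up: "e - \<delta> + k * (t - (d' - \<delta>)) = s' + k * (t - d')" for t
    using k\<delta> by (simp add: algebra_simps)
  have kk: "t - c \<le> k * (t - c)" if "t \<ge> c" for t c
    using mult_right_mono[OF k1, of "t - c"] that by simp
  have kk': "k * (t - c) \<le> t - c" if "t \<le> c" for t c
    using mult_right_mono[OF k1, of "c - t"] that by (simp add: algebra_simps)
  show "\<And>t. d \<le> t \<Longrightarrow> t \<le> d' - \<delta> \<Longrightarrow> \<phi> t = s + (t - d)" by (simp add: \<phi>_def)
  show hi: "\<phi> t \<in> {e - \<delta><..<s'}" if "d' - \<delta> < t" "t < d'" for t
  proof -
    have "k * (t - (d' - \<delta>)) > 0" "k * (t - d') < 0"
      using that k1 by (auto simp: mult_pos_neg)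
    then show ?thesis using that up[of t] by (auto simp: \<phi>_def)
  qed
  show "s + (t - d) \<le> \<phi> t \<and> \<phi> t \<le> s' + (t - d')" if "d \<le> t" "t < d'" for t
  proof (cases "t \<le> d' - \<delta>")
    case True
    then show ?thesis using assms by (simp add: \<phi>_def d'_def)
  next
    case False
    then have "\<phi> t = e - \<delta> + k * (t - (d' - \<delta>))" by (simp add: \<phi>_def)
    moreover have "t - (d' - \<delta>) \<le> k * (t - (d' - \<delta>))" "k * (t - d') \<le> t - d'"
      using kk[of "d' - \<delta>" t] kk'[of t d'] False that by simp_all
    ultimately show ?thesis using up[of t] d'_def by linarith
  qed
  show sm: "strict_mono_on {d..<d'} \<phi>"
  proof (rule strict_mono_onI)
    fix t u assume tu: "t \<in> {d..<d'}" "u \<in> {d..<d'}" "t < u"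
    show "\<phi> t < \<phi> u"
    proof (cases "u \<le> d' - \<delta>")
      case True
      then show ?thesis using tu by (simp add: \<phi>_def)
    next
      case False
      show ?thesis
      proof (cases "t \<le> d' - \<delta>")
        case True
        then have "\<phi> t \<le> e - \<delta>" by (simp add: \<phi>_def d'_def)
        then show ?thesis using hi[of u] False tu by simp
      next
        case False2: False
        have "k * t < k * u" using tu k1 by simp
        then show ?thesis using False False2 by (simp add: \<phi>_def algebra_simps)
      qed
    qed
  qed
  show "\<phi> ` {d..<d'} = {s..<s'}"
  proof (intro equalityI subsetI)
    fix y assume "y \<in> \<phi> ` {d..<d'}"
    then obtain t where t: "d \<le> t" "t < d'" "y = \<phi> t" by auto
    then show "y \<in> {s..<s'}" using hi[of t] assms by (cases "t \<le> d' - \<delta>") (auto simp: \<phi>_def d'_def)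
  next
    fix y assume y: "y \<in> {s..<s'}"
    show "y \<in> \<phi> ` {d..<d'}"
    proof (cases "y \<le> e - \<delta>")
      case True
      then show ?thesis using y assms by (intro image_eqI[of _ _ "d + (y - s)"]) (auto simp: \<phi>_def d'_def)
    next
      case False
      define t where "t = d' - \<delta> + (y - (e - \<delta>)) / k"
      have "(y - (e - \<delta>)) / k > 0" using False k1 by simp
      moreover have "(y - (e - \<delta>)) / k < \<delta>" using y k1 k\<delta> by (simp add: divide_less_eq mult.commute)
      ultimately have "d' - \<delta> < t" "t < d'" by (auto simp: t_def)
      moreover have "\<phi> t = y" using calculation k1 by (simp add: \<phi>_def) (simp add: t_def)
      moreover have "d \<le> t" using calculation(1) assms by (simp add: d'_def)
      ultimately show ?thesis by auto
    qed
  qed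
qed

subsection \<open>Hitting times\<close>

text \<open>The common form of \<open>return_after\<close> and \<open>lifetime\<close>. Time
  \<open>s\<close> itself is admissible, in contrast to \<open>explosion_after\<close>.\<close>

definition hit :: "bstate set \<Rightarrow> (real \<Rightarrow> bstate) \<Rightarrow> ereal \<Rightarrow> ereal" where
  "hit U w s = Inf (ereal ` {t. 0 \<le> t \<and> s \<le> ereal t \<and> w t \<in> U})"

lemma hit_le: "0 \<le> t \<Longrightarrow> s \<le> ereal t \<Longrightarrow> w t \<in> U \<Longrightarrow> hit U w s \<le> ereal t"
  unfolding hit_def by (intro Inf_lower) auto

lemma hit_ge: "s \<le> hit U w s"
  unfolding hit_def by (intro Inf_greatest) auto

lemma hit_before: "0 \<le> t \<Longrightarrow> s \<le> ereal t \<Longrightarrow> ereal t < hit U w s \<Longrightarrow> w t \<notin> U"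
  using hit_le[of t s w U] by auto

lemma hit_antimono: "U \<subseteq> V \<Longrightarrow> hit V w s \<le> hit U w s"
  unfolding hit_def by (intro Inf_superset_mono) auto

text \<open>By \<open>right\<close>, a lower bound of \<open>S\<close> outside \<open>S\<close> has
  a gap to its right, so the infimum must belong to \<open>S\<close>. Right-continuous paths provide
  such gaps.\<close>

lemma Inf_attained:
  assumes lower: "\<And>t. t \<in> S \<Longrightarrow> 0 \<le> (t::real)"
    and right: "\<And>t. t \<ge> 0 \<Longrightarrow> t \<notin> S \<Longrightarrow> (\<And>u. u \<in> S \<Longrightarrow> t \<le> u) \<Longrightarrow> \<exists>d>0. \<forall>u. t < u \<longrightarrow> u < t + d \<longrightarrow> u \<notin> S"
    and fin: "Inf (ereal ` S) \<noteq> \<infinity>"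
  shows "\<exists>t\<in>S. Inf (ereal ` S) = ereal t \<and> (\<forall>u\<in>S. t \<le> u)"
proof -
  have ne: "S \<noteq> {}" using fin by (auto simp: top_ereal_def)
  define t where "t = Inf S"
  have bdd: "bdd_below S" using lower by (rule bdd_belowI)
  have le: "t \<le> u" if "u \<in> S" for u unfolding t_def using that bdd by (intro cInf_lower)
  have t0: "t \<ge> 0" unfolding t_def using ne lower by (intro cInf_greatest)
  have "t \<in> S"
  proof (rule ccontr)
    assume "t \<notin> S"
    from right[OF t0 this le] obtain d where d: "d > 0" "\<And>u. t < u \<Longrightarrow> u < t + d \<Longrightarrow> u \<notin> S" by blast
    obtain u where u: "u \<in> S" "u < t + d"
      using cInf_lessD[OF ne, of "t + d"] d(1) by (auto simp: t_def)
    then have "u = t" using d(2)[of u] le[OF u(1)] by force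
    then show False using u \<open>t \<notin> S\<close> by simp
  qed
  moreover have "Inf (ereal ` S) = ereal t"
    using \<open>t \<in> S\<close> le by (intro antisym Inf_lower Inf_greatest) auto
  ultimately show ?thesis using le by blast
qed

lemma hit_attained:
  assumes w: "w \<in> cadlag_paths" and U: "closed U" and fin: "hit U w s \<noteq> \<infinity>"
  obtains t where "hit U w s = ereal t" "0 \<le> t" "s \<le> ereal t" "w t \<in> U"
proof -
  let ?S = "{t. 0 \<le> t \<and> s \<le> ereal t \<and> w t \<in> U}"
  have "\<exists>t\<in>?S. Inf (ereal ` ?S) = ereal t \<and> (\<forall>u\<in>?S. t \<le> u)"
  proof (rule Inf_attained)
    fix t assume t: "t \<ge> 0" "t \<notin> ?S" "\<And>u. u \<in> ?S \<Longrightarrow> t \<le> u"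
    show "\<exists>d>0. \<forall>u. t < u \<longrightarrow> u < t + d \<longrightarrow> u \<notin> ?S"
    proof (cases "s \<le> ereal t")
      case True
      then have "w t \<in> - U" using t by auto
      from cadlag_right_nbhd[OF w t(1) open_Compl[OF U] this] show ?thesis by (auto intro: less_imp_le)
    next
      case False
      then obtain u where "ereal t < ereal u" "ereal u < s" using ereal_dense2[of "ereal t" s] by (meson not_le)
      then show ?thesis by (intro exI[of _ "u - t"]) (auto simp: not_le intro: less_trans[of _ "ereal u"])
    qed
  qed (use fin in \<open>auto simp: hit_def\<close>)
  then show ?thesis using that by (auto simp: hit_def)
qed

lemma return_after_hit: "return_after n w s = hit (insert Cem (St ` {0..n})) w s"
  by (simp add: return_after_def hit_def)

lemma lifetime_hit: "lifetime w = hit {Cem} w 0"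
  by (simp add: lifetime_def hit_def)

abbreviation "An n \<equiv> insert Cem (St ` {0..n})"

lemma open_An: "open (An n)" by (rule open_isolated) auto

lemma closed_An: "closed (An n)" by (intro finite_imp_closed) auto

lemma An_mono: "n \<le> m \<Longrightarrow> An n \<subseteq> An m" by auto

lemma Omega_absorb: "w \<in> Omega \<Longrightarrow> 0 \<le> t \<Longrightarrow> w t = Cem \<Longrightarrow> t \<le> u \<Longrightarrow> w u = Cem"
proof -
  assume w: "w \<in> Omega" and t: "0 \<le> t" "w t = Cem" "t \<le> u"
  have "lifetime w \<le> ereal t" unfolding lifetime_hit by (rule hit_le) (use t in \<open>auto simp: zero_ereal_def\<close>)
  then have "lifetime w \<le> ereal u" using t(3) by (meson ereal_less_eq(3) order_trans)
  then show ?thesis using w t by (auto simp: Omega_def)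
qed

lemma Omega_cadlag: "w \<in> Omega \<Longrightarrow> w \<in> cadlag_paths"
  by (simp add: Omega_def)

lemma wang_cut_times:
  assumes "w \<in> Omega" shows "cut_times (wang_eta n w) (wang_sigma n w)"
proof
  show "wang_sigma n w 0 = 0" by (simp add: wang_sigma_def)
  show "wang_eta n w (Suc m) \<le> wang_sigma n w (Suc m)" for m
    unfolding wang_sigma_def return_after_hit by (auto intro: hit_ge simp del: wang_eta.simps)
  have ex: "s \<le> explosion_after w s" for s
    unfolding explosion_after_def by (intro Inf_greatest) auto
  show "wang_sigma n w m \<le> wang_eta n w (Suc m)" for m
  proof (cases "m = 0")
    case True
    then show ?thesis using ex[of 0] by (simp add: wang_sigma_def)
  next
    case False
    define s where "s = return_after n w (wang_eta n w m)"
    have sig: "wang_sigma n w m = s" using False by (simp add: wang_sigma_def s_def)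
    \<comment> \<open>The next cut is a minimum with the lifetime, so a path alive at the return
      time \<open>s\<close> must be shown to have a lifetime no smaller than
      \<open>s\<close>.\<close>
    have "s \<le> lifetime w" if "s \<noteq> \<infinity>" "w (real_of_ereal s) \<noteq> Cem"
    proof (rule ccontr)
      assume "\<not> s \<le> lifetime w"
      have h: "hit (An n) w (wang_eta n w m) \<noteq> \<infinity>" using that(1) by (simp add: s_def return_after_hit)
      from hit_attained[OF Omega_cadlag[OF assms] closed_An h] obtain t where t: "s = ereal t" "0 \<le> t"
        unfolding s_def return_after_hit by blast
      with \<open>\<not> s \<le> lifetime w\<close> have "w t = Cem" using assms by (auto simp: Omega_def)
      then show False using that(2) t by simp
    qed
    then show ?thesis unfolding sig using False ex[of s] by (auto simp: s_def[symmetric] Let_def)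
  qed
qed

lemma wang_path_cadlag: "wang_path n w \<in> cadlag_paths"
proof (cases "w \<in> Omega \<and> (\<forall>t\<ge>0. \<exists>m. in_piece (wang_eta n w) (wang_sigma n w) t m)")
  case True
  then interpret cut_times "wang_eta n w" "wang_sigma n w" by (intro wang_cut_times) auto
  show ?thesis using True C_transform_cadlag[of w] by (auto simp: wang_path_def Omega_cadlag)
next
  case False
  have "(\<lambda>t\<in>{0..}. Cem) \<in> cadlag_paths"
    unfolding cadlag_paths_def
  proof (intro CollectI conjI allI impI)
    fix t :: real assume "0 \<le> t"
    have "eventually (\<lambda>s. Cem = (\<lambda>t\<in>{0..}. Cem) s) (at_right t)"
      using \<open>0 \<le> t\<close> by (intro eventually_at_rightI[of t "t + 1"]) auto
    then show "((\<lambda>t\<in>{0..}. Cem) \<longlongrightarrow> (\<lambda>t\<in>{0..}. Cem) t) (at_right t)"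
      using \<open>0 \<le> t\<close> by (intro Lim_transform_eventually[OF tendsto_const]) auto
  next
    fix t :: real assume "0 < t"
    have "eventually (\<lambda>s. Cem = (\<lambda>t\<in>{0..}. Cem) s) (at_left t)"
      using \<open>0 < t\<close> by (intro eventually_at_leftI[of 0 t]) auto
    then show "\<exists>l. ((\<lambda>t\<in>{0..}. Cem) \<longlongrightarrow> l) (at_left t)"
      by (intro exI[of _ Cem] Lim_transform_eventually[OF tendsto_const])
  qed auto
  then show ?thesis unfolding wang_path_def if_not_P[OF False] .
qed

subsection \<open>Paths that leave \<open>\<nat>\<close> only by explosion\<close>

text \<open>The explosion time as the supremum of the exit times from the finite sets
  \<open>An N\<close>. In place of left limits it involves only hitting times of open sets, which
  rational times determine.\<close>

definition explosion_hit :: "(real \<Rightarrow> bstate) \<Rightarrow> ereal \<Rightarrow> ereal" where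
  "explosion_hit w s = (SUP N. hit (- An N) w s)"

lemma not_in_An: "(\<And>N. N \<ge> N0 \<Longrightarrow> x \<notin> An N) \<Longrightarrow> x = Infty"
proof (cases x)
  case (St k)
  assume "\<And>N. N \<ge> N0 \<Longrightarrow> x \<notin> An N"
  from this[of "max N0 k"] show ?thesis by (auto simp: St)
qed auto

lemma left_limit_const:
  fixes w :: "real \<Rightarrow> bstate"
  assumes "(w \<longlongrightarrow> l) (at_left u)" "a < u" "\<And>v. a < v \<Longrightarrow> v < u \<Longrightarrow> w v = x"
  shows "x = l"
proof (rule ccontr)
  assume "x \<noteq> l"
  moreover have "open (- {x})" by (rule open_cofinite) simp
  ultimately obtain d where d: "d > 0" "\<And>v. u - d < v \<Longrightarrow> v < u \<Longrightarrow> w v \<in> - {x}"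
    using left_nbhd[OF assms(1), of "- {x}"] by auto
  have "max a (u - d) < u" using assms(2) d(1) by simp
  then obtain v where "max a (u - d) < v" "v < u" using dense by blast
  then show False using d(2)[of v] assms(3)[of v] by simp
qed

text \<open>Properties that almost every path has; what is derived from them is
  deterministic.\<close>

locale good_path =
  fixes w :: "real \<Rightarrow> bstate"
  assumes Om: "w \<in> Omega" and start: "w 0 \<noteq> Infty"
    and nojump: "\<And>t k. t > 0 \<Longrightarrow> (w \<longlongrightarrow> St k) (at_left t) \<Longrightarrow> w t \<in> range St"
begin

lemma cad: "w \<in> cadlag_paths" by (rule Omega_cadlag[OF Om])

text \<open>The left limit cannot be a state of \<nat> by \<open>nojump\<close>, nor the cemetery,
  as the path would then have been dead just before \<open>t\<close>. The statement covers arrival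
  at \<infinity> as well as the moment of death.\<close>

lemma left_limit_Infty:
  assumes t: "t > 0" and wt: "w t = Infty \<or> w t = Cem \<and> (\<forall>u. 0 \<le> u \<longrightarrow> u < t \<longrightarrow> w u \<noteq> Cem)"
  shows "(w \<longlongrightarrow> Infty) (at_left t)"
proof -
  obtain l where l: "(w \<longlongrightarrow> l) (at_left t)" using cadlag_left[OF cad t] by blast
  have "l = Infty"
  proof (cases l)
    case (St k)
    then show ?thesis using nojump[OF t, of k] l wt by auto
  next
    case Cem
    obtain d where d: "d > 0" "\<And>v. t - d < v \<Longrightarrow> v < t \<Longrightarrow> w v \<in> {Cem}"
      using left_nbhd[OF l, of "{Cem}"] Cem by (auto simp: open_isolated)
    have "max 0 (t - d) < t" using t d(1) by simp
    then obtain v where v: "max 0 (t - d) < v" "v < t" using dense by blast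
    then have "w v = Cem" "0 \<le> v" using d(2)[of v] by auto
    then show ?thesis using Omega_absorb[OF Om, of v t] wt v by auto
  qed
  then show ?thesis using l by simp
qed

text \<open>A time \<open>t\<close> with \<open>w t = Infty\<close> is an explosion time by
  \<open>left_limit_Infty\<close>; at any other time the path sits in an isolated state and stays
  there for a while, so explosions do not accumulate from the right.\<close>

lemma explosion_attained:
  assumes s: "s \<ge> 0" "w s \<noteq> Infty" and fin: "explosion_after w (ereal s) \<noteq> \<infinity>"
  obtains t where "explosion_after w (ereal s) = ereal t" "s < t" "(w \<longlongrightarrow> Infty) (at_left t)"
proof -
  let ?S = "{t. ereal s < ereal t \<and> (w \<longlongrightarrow> Infty) (at_left t)}"
  have "\<exists>t\<in>?S. Inf (ereal ` ?S) = ereal t \<and> (\<forall>u\<in>?S. t \<le> u)"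
  proof (rule Inf_attained)
    fix t assume t: "t \<ge> 0" "t \<notin> ?S"
    show "\<exists>d>0. \<forall>u. t < u \<longrightarrow> u < t + d \<longrightarrow> u \<notin> ?S"
    proof (cases "t < s")
      case True
      then show ?thesis by (intro exI[of _ "s - t"]) auto
    next
      case False
      have wt: "w t \<noteq> Infty"
      proof
        assume i: "w t = Infty"
        then have "s < t" using False s(2) by (cases "s = t") auto
        then show False using left_limit_Infty[of t] i t s(1) by auto
      qed
      then have "open {w t}" by (intro open_isolated) auto
      then obtain d where d: "d > 0" "\<And>v. t \<le> v \<Longrightarrow> v < t + d \<Longrightarrow> w v \<in> {w t}"
        using cadlag_right_nbhd[OF cad t(1), of "{w t}"] by blast
      have "u \<notin> ?S" if u: "t < u" "u < t + d" for u
      proof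
        assume "u \<in> ?S"
        then have "(w \<longlongrightarrow> Infty) (at_left u)" by simp
        then have "w t = Infty"
        proof (rule left_limit_const[OF _ u(1)])
          fix v assume "t < v" "v < u"
          then have "w v \<in> {w t}" using u(2) by (intro d(2)) auto
          then show "w v = w t" by blast
        qed
        then show False using wt by blast
      qed
      then show ?thesis using d(1) by blast
    qed
  qed (use fin s in \<open>auto simp: explosion_after_def\<close>)
  then show ?thesis using that by (auto simp: explosion_after_def)
qed

lemma explosion_le: "s < t \<Longrightarrow> (w \<longlongrightarrow> Infty) (at_left t) \<Longrightarrow> explosion_after w (ereal s) \<le> ereal t"
  unfolding explosion_after_def by (intro Inf_lower) auto

text \<open>Just before an explosion the path is outside every given \<open>An N\<close>, which
  bounds the exit times; conversely, at the supremum of the exit times the left limit can only be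
  \<infinity>.\<close>

lemma explosion_eq:
  assumes s: "s \<ge> 0" "w s \<noteq> Infty"
  shows "explosion_after w (ereal s) = explosion_hit w (ereal s)"
proof (rule antisym)
  show "explosion_hit w (ereal s) \<le> explosion_after w (ereal s)"
    unfolding explosion_hit_def
  proof (rule SUP_least)
    fix N
    show "hit (- An N) w (ereal s) \<le> explosion_after w (ereal s)"
      unfolding explosion_after_def
    proof (rule Inf_greatest)
      fix x assume "x \<in> ereal ` {t. ereal s < ereal t \<and> (w \<longlongrightarrow> Infty) (at_left t)}"
      then obtain t where t: "x = ereal t" "s < t" "(w \<longlongrightarrow> Infty) (at_left t)" by auto
      obtain d where d: "d > 0" "\<And>v. t - d < v \<Longrightarrow> v < t \<Longrightarrow> w v \<in> - An N"
        using left_nbhd[OF t(3), of "- An N"] closed_An[of N] by (auto simp: open_Compl)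
      have "max s (t - d) < t" using t d(1) by simp
      then obtain v where v: "max s (t - d) < v" "v < t" using dense by blast
      have "hit (- An N) w (ereal s) \<le> ereal v" by (rule hit_le) (use v d(2)[of v] s in auto)
      then show "hit (- An N) w (ereal s) \<le> x" using v t by (auto intro: order_trans)
    qed
  qed
next
  let ?h = "\<lambda>N. hit (- An N) w (ereal s)"
  show "explosion_after w (ereal s) \<le> explosion_hit w (ereal s)"
  proof (cases "explosion_hit w (ereal s) = \<infinity>")
    case False
    have le: "?h N \<le> explosion_hit w (ereal s)" for N unfolding explosion_hit_def by (rule SUP_upper) simp
    have "\<exists>t. ?h N = ereal t \<and> s \<le> t \<and> w t \<in> - An N" for N
    proof -
      have "closed (- An N)" using open_An[of N] by (simp add: closed_Compl)
      moreover have "?h N \<noteq> \<infinity>" using le[of N] False by auto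
      ultimately obtain t where "?h N = ereal t" "ereal s \<le> ereal t" "w t \<in> - An N"
        using hit_attained[OF cad] by metis
      then show ?thesis by auto
    qed
    then obtain \<tau> where \<tau>: "\<And>N. ?h N = ereal (\<tau> N)" "\<And>N. s \<le> \<tau> N" "\<And>N. w (\<tau> N) \<in> - An N" by metis
    have mono: "\<tau> N \<le> \<tau> M" if "N \<le> M" for N M
      using hit_antimono[of "- An M" "- An N" w "ereal s"] An_mono[OF that] \<tau>(1)[of N] \<tau>(1)[of M] by auto
    obtain t where t: "explosion_hit w (ereal s) = ereal t" "s \<le> t"
      using False le[of 0] \<tau>(1,2)[of 0] by (cases "explosion_hit w (ereal s)") auto
    have \<tau>t: "\<tau> N \<le> t" for N using le[of N] \<tau>(1)[of N] t by simp
    have "s < t \<and> (w \<longlongrightarrow> Infty) (at_left t)"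
    \<comment> \<open>If some \<open>\<tau> N\<close> equals \<open>t\<close>, so do all later ones,
      and \<open>w t\<close> is in none of the later \<open>An N\<close>, hence is \<infinity>.
      Otherwise the \<open>\<tau> N\<close> approach \<open>t\<close> strictly from the left at
      values escaping every \<open>An N\<close>.\<close>
    proof (cases "\<exists>N. \<tau> N = t")
      case True
      then obtain N0 where N0: "\<tau> N0 = t" by blast
      have "\<tau> N = t" if "N \<ge> N0" for N using mono[OF that] \<tau>t[of N] N0 by simp
      then have "w t = Infty" using \<tau>(3) by (intro not_in_An[of N0]) auto
      moreover from this have "s < t" using s t(2) by (cases "s = t") auto
      ultimately show ?thesis using left_limit_Infty[of t] s by auto
    next
      case False
      then have lt: "\<tau> N < t" for N using \<tau>t[of N] by (simp add: less_le)
      have st: "s < t" using \<tau>(2)[of 0] lt[of 0] by simp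
      then obtain l where l: "(w \<longlongrightarrow> l) (at_left t)" using cadlag_left[OF cad, of t] s by auto
      have "l = Infty"
      proof (rule ccontr)
        assume "l \<noteq> Infty"
        then obtain d where d: "d > 0" "\<And>v. t - d < v \<Longrightarrow> v < t \<Longrightarrow> w v = l"
          using left_nbhd[OF l, of "{l}"] by (auto simp: open_isolated)
        have "ereal (t - d) < (SUP N. ?h N)" using t(1) d(1) by (simp add: explosion_hit_def)
        then obtain N1 where "ereal (t - d) < ?h N1" by (auto simp: less_SUP_iff)
        then have "t - d < \<tau> N" if "N \<ge> N1" for N using \<tau>(1)[of N1] mono[OF that] by simp
        then have "w (\<tau> N) = l" if "N \<ge> N1" for N using d(2) lt that by blast
        then have "l \<notin> An N" if "N \<ge> N1" for N using \<tau>(3)[of N] that by auto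
        from not_in_An[OF this] \<open>l \<noteq> Infty\<close> show False by simp
      qed
      then show ?thesis using st l by simp
    qed
    then show ?thesis using explosion_le[of s t] t by simp
  qed simp
qed

lemma hit_infinity: "hit U w' \<infinity> = \<infinity>"
  using hit_ge[of \<infinity> U w'] by simp

lemma explosion_hit_dead:
  assumes "0 \<le> t" "w t = Cem" shows "explosion_hit w (ereal t) = \<infinity>"
proof -
  have "{u. 0 \<le> u \<and> ereal t \<le> ereal u \<and> w u \<in> - An N} = {}" for N
    using Omega_absorb[OF Om assms] by auto
  then have "hit (- An N) w (ereal t) = \<infinity>" for N
    unfolding hit_def by (simp only: image_empty Inf_empty) (simp add: top_ereal_def)
  then show ?thesis by (simp add: explosion_hit_def)
qed

lemma sigma_cases:
  assumes "wang_sigma n w m \<noteq> \<infinity>"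
  obtains s where "wang_sigma n w m = ereal s" "0 \<le> s" "w s \<noteq> Infty" "m > 0 \<Longrightarrow> w s \<in> An n"
proof (cases "m = 0")
  case True
  then show ?thesis using that[of 0] start by (simp add: wang_sigma_def zero_ereal_def)
next
  case False
  then have eq: "wang_sigma n w m = hit (An n) w (wang_eta n w m)"
    by (simp add: wang_sigma_def return_after_hit)
  from hit_attained[OF cad closed_An assms[unfolded eq]]
  obtain s where "hit (An n) w (wang_eta n w m) = ereal s" "0 \<le> s" "w s \<in> An n" by blast
  then show ?thesis using that[of s] eq by auto
qed

text \<open>A live path dies only out of \<infinity>, so the next explosion comes no later than the
  lifetime; a dead path never explodes. Both clauses of the recursion thus collapse into one
  formula, free of case distinctions, which the rational version can follow.\<close>

lemma wang_eta_eq: "wang_eta n w (Suc m) = explosion_hit w (wang_sigma n w m)"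
proof (cases "m = 0")
  case True
  then show ?thesis using explosion_eq[of 0] start by (simp add: wang_sigma_def zero_ereal_def)
next
  case False
  define s where "s = return_after n w (wang_eta n w m)"
  have sig: "wang_sigma n w m = s" using False by (simp add: wang_sigma_def s_def)
  have eta: "wang_eta n w (Suc m) = (if s = \<infinity> \<or> w (real_of_ereal s) = Cem then \<infinity>
              else min (explosion_after w s) (lifetime w))"
    using False by (simp add: s_def Let_def)
  show ?thesis
  proof (cases "s = \<infinity>")
    case True
    then show ?thesis unfolding eta sig by (simp add: explosion_hit_def hit_infinity)
  next
    case fin: False
    then obtain t where t: "s = ereal t" "0 \<le> t" "w t \<noteq> Infty" using sigma_cases[of n m] sig by metis
    show ?thesis
    proof (cases "w t = Cem")
      case True
      then show ?thesis unfolding eta sig using t explosion_hit_dead by simp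
    next
      case False
      have "explosion_after w s \<le> lifetime w"
      proof (cases "lifetime w = \<infinity>")
        case False
        have "closed {Cem}" by simp
        from hit_attained[OF cad this False[unfolded lifetime_hit]]
        obtain z where z: "lifetime w = ereal z" "0 \<le> z" "w z = Cem" unfolding lifetime_hit by blast
        have "t < z" using Omega_absorb[OF Om z(2,3), of t] \<open>w t \<noteq> Cem\<close> by fastforce
        have "w u \<noteq> Cem" if "0 \<le> u" "u < z" for u
          using hit_before[of u 0 "{Cem}" w] that z(1) unfolding lifetime_hit by auto
        then have "(w \<longlongrightarrow> Infty) (at_left z)" using \<open>t < z\<close> t(2) z by (intro left_limit_Infty) auto
        then show ?thesis using explosion_le[of t z] \<open>t < z\<close> t z by simp
      qed simp
      then show ?thesis unfolding eta sig using t False explosion_eq[of t] by (simp add: min_def)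
    qed
  qed
qed

lemma eta_cases:
  assumes "wang_eta n w (Suc m) \<noteq> \<infinity>"
  obtains s e where "wang_sigma n w m = ereal s" "wang_eta n w (Suc m) = ereal e" "0 \<le> s" "s < e"
    "(w \<longlongrightarrow> Infty) (at_left e)"
proof -
  have "wang_sigma n w m \<noteq> \<infinity>"
    using assms unfolding wang_eta_eq by (auto simp: explosion_hit_def hit_infinity)
  then obtain s where s: "wang_sigma n w m = ereal s" "0 \<le> s" "w s \<noteq> Infty" using sigma_cases by metis
  have "explosion_after w (ereal s) \<noteq> \<infinity>" using assms explosion_eq[OF s(2,3)] s(1)
    by (simp add: wang_eta_eq del: wang_eta.simps)
  from explosion_attained[OF s(2,3) this] obtain t where
    "explosion_after w (ereal s) = ereal t" "s < t" "(w \<longlongrightarrow> Infty) (at_left t)" .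
  then show ?thesis using that[of s t] s explosion_eq[OF s(2,3)]
    by (simp add: wang_eta_eq del: wang_eta.simps)
qed

lemma cut_avoids:
  assumes "0 \<le> u" "wang_eta n w (Suc m) \<le> ereal u" "ereal u < wang_sigma n w (Suc m)"
  shows "w u \<notin> An n"
  using hit_before[OF assms(1,2), of "An n" w] assms(3)
  by (simp add: wang_sigma_def return_after_hit del: wang_eta.simps)

text \<open>Suppose the return times increase to \<open>L\<close>. A left limit \<infinity> at
  \<open>L\<close> contradicts the returns to \<open>An n\<close>; any other left limit is isolated,
  so the path is constant just before \<open>L\<close>, which contradicts the explosions between the
  returns.\<close>

lemma sigma_unbounded:
  assumes fin: "\<And>m. wang_eta n w (Suc m) \<noteq> \<infinity>" and bd: "\<And>m. wang_sigma n w m \<le> ereal u"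
  shows False
proof -
  have "\<exists>s e. wang_sigma n w m = ereal s \<and> wang_eta n w (Suc m) = ereal e \<and> 0 \<le> s \<and> s < e \<and> (w \<longlongrightarrow> Infty) (at_left e)" for m
    using eta_cases[OF fin[of m]] by metis
  then obtain s e where se: "\<And>m. wang_sigma n w m = ereal (s m)" "\<And>m. wang_eta n w (Suc m) = ereal (e m)"
    "\<And>m. 0 \<le> s m" "\<And>m. s m < e m" "\<And>m. (w \<longlongrightarrow> Infty) (at_left (e m))" by metis
  interpret cut_times "wang_eta n w" "wang_sigma n w" by (rule wang_cut_times[OF Om])
  have es: "e m \<le> s (Suc m)" for m using \<alpha>\<beta>[of m] se(1,2) by (simp del: wang_eta.simps)
  have inc: "s m < s (Suc m)" for m using se(4)[of m] es[of m] by simp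
  then have smono: "strict_mono s" by (rule strict_mono_Suc_iff[THEN iffD2, rule_format])
  have su: "s m \<le> u" for m using bd[of m] se(1) by simp
  define L where "L = (SUP m. s m)"
  have bdd: "bdd_above (range s)" by (rule bdd_aboveI[of _ u]) (use su in auto)
  have sL: "s m < L" for m
    using inc[of m] cSUP_upper[OF _ bdd, of "Suc m"] by (simp add: L_def)
  have L0: "L > 0" using se(3)[of 0] sL[of 0] by simp
  have conv: "\<exists>M. \<forall>m\<ge>M. L - d < s m" if d: "d > 0" for d
  proof -
    obtain M where "L - d < s M" using less_cSUP_iff[OF _ bdd, of "L - d"] d by (auto simp: L_def)
    then show ?thesis using strict_mono_less_eq[OF smono] by (meson order_less_le_trans)
  qed
  obtain l where l: "(w \<longlongrightarrow> l) (at_left L)" using cadlag_left[OF cad L0] by blast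
  show False
  proof (cases "l = Infty")
    case True
    have "open (- An n)" using closed_An[of n] by (simp add: open_Compl)
    then obtain d where d: "d > 0" "\<And>v. L - d < v \<Longrightarrow> v < L \<Longrightarrow> w v \<in> - An n"
      using left_nbhd[OF l, of "- An n"] True by auto
    obtain M where "L - d < s (Suc M)" using conv[OF d(1)] by (meson le_Suc_eq order_refl)
    then have "w (s (Suc M)) \<notin> An n" using d(2) sL by blast
    moreover have "w (s (Suc M)) \<in> An n"
      using sigma_cases[of n "Suc M"] se(1)[of "Suc M"] by (metis ereal.inject PInfty_neq_ereal(1) zero_less_Suc)
    ultimately show False by simp
  next
    case False
    then obtain d where d: "d > 0" "\<And>v. L - d < v \<Longrightarrow> v < L \<Longrightarrow> w v = l"
      using left_nbhd[OF l, of "{l}"] by (auto simp: open_isolated)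
    obtain M where M: "L - d < s M" using conv[OF d(1)] by blast
    have "e M < L" using es[of M] sL[of "Suc M"] by simp
    have "l = Infty"
      by (rule left_limit_const[OF se(5)[of M] se(4)]) (use d(2) M \<open>e M < L\<close> in auto)
    then show False using False by simp
  qed
qed

end

section \<open>The occupation clock of a finite set of states\<close>

context good_path
begin

definition occ :: "nat \<Rightarrow> real \<Rightarrow> real" where
  "occ n u = measure lborel {t. 0 \<le> t \<and> t < u \<and> w t \<in> An n}"

lemma occ_sets: "{t. a \<le> t \<and> t < u \<and> 0 \<le> t \<and> w t \<in> U} \<in> sets lborel" (is "?S \<in> _")
proof -
  have "?S = {t. 0 \<le> t \<and> w t \<in> U} \<inter> {a..<u}" by auto
  then show ?thesis using path_occupation_sets[OF cad, of U] by simp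
qed

lemma occ_diff:
  assumes "0 \<le> u" "u \<le> v"
  shows "occ n v = occ n u + measure lborel {t. u \<le> t \<and> t < v \<and> 0 \<le> t \<and> w t \<in> An n}"
proof -
  have eq: "{t. 0 \<le> t \<and> t < c \<and> w t \<in> An n} = {t. 0 \<le> t \<and> t < c \<and> 0 \<le> t \<and> w t \<in> An n}" for c by auto
  have fin: "emeasure lborel {t. a \<le> t \<and> t < c \<and> 0 \<le> t \<and> w t \<in> An n} \<noteq> \<infinity>" for a c
  proof -
    have "emeasure lborel {t. a \<le> t \<and> t < c \<and> 0 \<le> t \<and> w t \<in> An n} \<le> emeasure lborel {a..c}"
      by (intro emeasure_mono) auto
    also have "\<dots> < \<infinity>" by (simp add: emeasure_lborel_Icc_eq)
    finally show ?thesis by simp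
  qed
  let ?A = "{t. 0 \<le> t \<and> t < u \<and> 0 \<le> t \<and> w t \<in> An n}"
  let ?B = "{t. u \<le> t \<and> t < v \<and> 0 \<le> t \<and> w t \<in> An n}"
  have U: "{t. 0 \<le> t \<and> t < v \<and> 0 \<le> t \<and> w t \<in> An n} = ?A \<union> ?B"
    using assms by force
  have D: "?A \<inter> ?B = {}" by force
  show ?thesis unfolding occ_def eq U
    by (rule measure_Union[OF fin fin occ_sets occ_sets D])
qed

lemma occ_mono: "0 \<le> u \<Longrightarrow> u \<le> v \<Longrightarrow> occ n u \<le> occ n v"
  using occ_diff[of u v n] by simp

lemma occ_lipschitz:
  assumes "0 \<le> u" "u \<le> v" shows "occ n v \<le> occ n u + (v - u)"
proof -
  have "measure lborel {t. u \<le> t \<and> t < v \<and> 0 \<le> t \<and> w t \<in> An n} \<le> measure lborel {u..<v}"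
  proof (rule measure_mono_fmeasurable[OF _ occ_sets])
    show "{u..<v} \<in> fmeasurable lborel" using assms by (intro fmeasurableI) auto
  qed auto
  then show ?thesis using occ_diff[OF assms, of n] assms by simp
qed

lemma occ_const:
  assumes "0 \<le> u" "u \<le> v" "\<And>t. u \<le> t \<Longrightarrow> t < v \<Longrightarrow> w t \<notin> An n" shows "occ n v = occ n u"
proof -
  have "{t. u \<le> t \<and> t < v \<and> 0 \<le> t \<and> w t \<in> An n} = {}" using assms(3) by blast
  then show ?thesis unfolding occ_diff[OF assms(1,2), of n] by (simp only: measure_empty add_0_right)
qed

lemma occ_0: "occ n 0 = 0"
proof -
  have "{t. 0 \<le> t \<and> t < 0 \<and> w t \<in> An n} = {}" by auto
  then show ?thesis unfolding occ_def by (simp only: measure_empty)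
qed

lemma occ_complement:
  assumes "0 \<le> u" "emeasure lborel {t. 0 \<le> t \<and> t < u \<and> w t \<notin> An n} < ennreal e" "e > 0"
  shows "u - occ n u < e"
proof -
  let ?A = "\<lambda>U. {t. 0 \<le> t \<and> t < u \<and> w t \<in> U}"
  have eq: "?A U = {t. 0 \<le> t \<and> t < u \<and> 0 \<le> t \<and> w t \<in> U}" for U by auto
  have m: "?A U \<in> sets lborel" for U using occ_sets[of 0 u U] unfolding eq .
  have fin: "emeasure lborel (?A U) \<noteq> \<infinity>" for U
  proof -
    have "emeasure lborel (?A U) \<le> emeasure lborel {0..u}"
      by (intro emeasure_mono) auto
    also have "\<dots> < \<infinity>" by (simp add: emeasure_lborel_Icc_eq)
    finally show ?thesis by simp
  qed
  have U: "{0..<u} = ?A (An n) \<union> ?A (- An n)" by force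
  have D: "?A (An n) \<inter> ?A (- An n) = {}" by force
  have "measure lborel {0..<u} = occ n u + measure lborel (?A (- An n))"
    unfolding occ_def U by (rule measure_Union[OF fin fin m m D])
  moreover have "measure lborel (?A (- An n)) < e"
    using assms(2,3) fin[of "- An n"] by (simp add: emeasure_eq_ennreal_measure ennreal_less_iff)
  ultimately show ?thesis using assms(1) by simp
qed

end

section \<open>Glued pieces and the time change\<close>

locale good_cut = good_path +
  fixes n :: nat
  assumes inf_occ: "emeasure lborel {t. 0 \<le> t \<and> w t \<in> An n} = \<infinity>"
begin

abbreviation "\<eta> \<equiv> wang_eta n w"
abbreviation "\<sigma> \<equiv> wang_sigma n w"
abbreviation "gl \<equiv> glue_time \<eta> \<sigma>"

sublocale cut_times \<eta> \<sigma> by (rule wang_cut_times[OF Om])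

declare wang_eta.simps(2) [simp del] glue_time.simps(2) [simp del]

lemma occ_unbounded: "\<exists>u\<ge>0. occ n u > c"
proof (rule ccontr)
  assume "\<not> ?thesis"
  then have le: "occ n u \<le> c" if "u \<ge> 0" for u using that by (meson not_le)
  let ?A = "\<lambda>k::nat. {t. 0 \<le> t \<and> t < real k \<and> w t \<in> An n}"
  have m: "?A k \<in> sets lborel" for k
  proof -
    have eq: "?A k = {t. 0 \<le> t \<and> t < real k \<and> 0 \<le> t \<and> w t \<in> An n}" by blast
    show ?thesis unfolding eq by (rule occ_sets)
  qed
  have "emeasure lborel (?A k) \<le> ennreal c" for k
  proof -
    have "emeasure lborel (?A k) \<le> emeasure lborel {0..real k}" by (intro emeasure_mono) auto
    also have "\<dots> < \<infinity>" by simp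
    finally have "emeasure lborel (?A k) = ennreal (occ n (real k))"
      unfolding occ_def by (intro emeasure_eq_ennreal_measure) auto
    then show ?thesis using le[of "real k"] by (simp add: ennreal_leI)
  qed
  then have "(SUP k. emeasure lborel (?A k)) \<le> ennreal c" by (rule SUP_least)
  moreover have "(SUP k. emeasure lborel (?A k)) = emeasure lborel (\<Union>k. ?A k)"
  proof (rule SUP_emeasure_incseq)
    show "incseq ?A"
    proof (rule incseq_SucI)
      show "?A k \<subseteq> ?A (Suc k)" for k by force
    qed
  qed (use m in blast)
  moreover have "(\<Union>k. ?A k) = {t. 0 \<le> t \<and> w t \<in> An n}" using reals_Archimedean2 by blast
  ultimately show False using inf_occ by (simp add: top_unique)
qed

text \<open>A path that never returned to \<open>An n\<close> after an explosion would have finite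
  total occupation time.\<close>

lemma sigma_finite: "\<eta> (Suc m) \<noteq> \<infinity> \<Longrightarrow> \<sigma> (Suc m) \<noteq> \<infinity>"
proof
  assume fin: "\<eta> (Suc m) \<noteq> \<infinity>" and inf: "\<sigma> (Suc m) = \<infinity>"
  obtain s e where se: "\<eta> (Suc m) = ereal e" "0 \<le> s" "s < e" using eta_cases[OF fin] by metis
  obtain u where u: "u \<ge> 0" "occ n u > occ n e" using occ_unbounded by blast
  have "occ n (max u e) = occ n e"
    by (rule occ_const) (use se cut_avoids[where m = m and n = n] inf in auto)
  moreover have "occ n u \<le> occ n (max u e)" by (rule occ_mono[OF u(1)]) simp
  ultimately show False using u(2) by linarith
qed

text \<open>A discarded piece avoids \<open>An n\<close> and leaves the occupation clock unchanged;
  on a kept piece the glued clock runs at full speed, hence at least as fast as the occupation clock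
  and as fast as real time.\<close>

lemma piece_reals:
  assumes "\<sigma> m \<noteq> \<infinity>"
  obtains s d where "\<sigma> m = ereal s" "gl m = ereal d" "0 \<le> d" "d \<le> s" "occ n s \<le> d"
proof -
  have "\<exists>s d. \<sigma> m = ereal s \<and> gl m = ereal d \<and> 0 \<le> d \<and> d \<le> s \<and> occ n s \<le> d"
    using assms
  proof (induction m)
    case 0
    then show ?case by (auto simp: wang_sigma_def zero_ereal_def occ_0 intro!: exI[of _ 0])
  next
    case (Suc m)
    then have "\<eta> (Suc m) \<noteq> \<infinity>" using \<alpha>\<beta>[of m] by auto
    from eta_cases[OF this] obtain s e where se: "\<sigma> m = ereal s" "\<eta> (Suc m) = ereal e" "0 \<le> s" "s < e" by metis
    then obtain d where d: "gl m = ereal d" "0 \<le> d" "d \<le> s" "occ n s \<le> d" using Suc.IH by auto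
    obtain s' where s': "\<sigma> (Suc m) = ereal s'" "e \<le> s'"
      using Suc.prems \<alpha>\<beta>[of m] se(2) by (cases "\<sigma> (Suc m)") auto
    have "gl (Suc m) = ereal (d + (e - s))" using d se by (simp add: glue_time.simps(2))
    moreover have "occ n s' \<le> d + (e - s)"
    proof -
      have "occ n s' = occ n e"
        by (rule occ_const) (use se s' cut_avoids[where m = m and n = n] in auto)
      also have "\<dots> \<le> occ n s + (e - s)" using se by (intro occ_lipschitz) auto
      finally show ?thesis using d(4) by simp
    qed
    ultimately show ?case using s' d se by (intro exI[of _ s'] exI[of _ "d + (e - s)"]) auto
  qed
  then show ?thesis using that by blast
qed

lemma glue_infinite: "\<eta> (Suc m) = \<infinity> \<Longrightarrow> gl (Suc m) = \<infinity>"
proof -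
  assume "\<eta> (Suc m) = \<infinity>"
  moreover have "gl m \<noteq> -\<infinity>" "\<sigma> m \<noteq> -\<infinity>" using glue_nonneg[of m] \<beta>_nonneg[of m] by auto
  ultimately show ?thesis by (cases "\<sigma> m"; cases "gl m") (auto simp: glue_time.simps(2))
qed

lemma glue_le_sigma: "gl m \<le> \<sigma> m"
proof (cases "\<sigma> m = \<infinity>")
  case False
  then show ?thesis using piece_reals[OF False] by (metis ereal_less_eq(3))
qed simp

text \<open>Bounded glueing times would bound the occupation clock at the return times, hence the
  return times themselves, since the clock is unbounded; this is excluded by
  \<open>sigma_unbounded\<close>.\<close>

lemma glue_unbounded: "\<exists>m. ereal t < gl (Suc m)"
proof (rule ccontr)
  assume "\<not> ?thesis"
  then have le: "gl (Suc m) \<le> ereal t" for m by (meson not_le)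
  have fin: "\<eta> (Suc m) \<noteq> \<infinity>" for m using glue_infinite[of m] le[of m] by auto
  obtain u where u: "u \<ge> 0" "occ n u > t" using occ_unbounded by blast
  have "\<sigma> (Suc m) \<le> ereal u" for m
  proof -
    obtain s d where sd: "\<sigma> (Suc m) = ereal s" "gl (Suc m) = ereal d" "0 \<le> d" "d \<le> s" "occ n s \<le> d"
      using piece_reals[OF sigma_finite[OF fin]] by metis
    then have "occ n s < occ n u" using le[of m] u by simp
    then have "s \<le> u" using occ_mono[OF u(1), of s n] by (meson not_le less_imp_le)
    then show ?thesis using sd by simp
  qed
  then have "\<sigma> m \<le> ereal u" for m
    using \<beta>_mono[of m "Suc m"] by (meson le_SucI order_refl order_trans)
  then show False using sigma_unbounded[OF fin] by blast
qed

lemma level_cover: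
  fixes f :: "nat \<Rightarrow> ereal"
  assumes "f 0 \<le> t" "\<exists>m. t < f (Suc m)"
  shows "\<exists>m. f m \<le> t \<and> t < f (Suc m)"
proof -
  define k where "k = (LEAST m. t < f (Suc m))"
  have k: "t < f (Suc k)" unfolding k_def using assms(2) by (rule LeastI_ex)
  have "f k \<le> t"
  proof (cases k)
    case (Suc i)
    then have "\<not> t < f (Suc i)" using not_less_Least[of i "\<lambda>m. t < f (Suc m)"] by (simp add: k_def)
    then show ?thesis using Suc by simp
  qed (use assms in simp)
  then show ?thesis using k by blast
qed

lemma sigma_finite_glue: "gl m \<le> ereal t \<Longrightarrow> \<sigma> m \<noteq> \<infinity>"
proof (cases m)
  case 0
  then show ?thesis by (simp add: wang_sigma_def)
next
  case (Suc k)
  assume "gl m \<le> ereal t"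
  then have "gl (Suc k) \<noteq> \<infinity>" using Suc by auto
  then have "\<eta> (Suc k) \<noteq> \<infinity>" using glue_infinite by blast
  then show ?thesis unfolding Suc by (rule sigma_finite)
qed

lemma covered: "t \<ge> 0 \<Longrightarrow> \<exists>m. in_piece \<eta> \<sigma> t m"
  using level_cover[of gl "ereal t"] glue_unbounded[of t] sigma_finite_glue
  by (auto simp: in_piece_def less_top[symmetric] top_ereal_def)

text \<open>The intervals between successive returns are to be the images of the glued pieces; that
  they cover the half-line makes the time change onto.\<close>

lemma sigma_cover: "y \<ge> 0 \<Longrightarrow> \<exists>m. \<sigma> m \<le> ereal y \<and> ereal y < \<sigma> (Suc m)"
proof -
  assume "y \<ge> 0"
  obtain m where "ereal y < gl (Suc m)" using glue_unbounded by blast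
  then have "ereal y < \<sigma> (Suc m)" using glue_le_sigma by (rule less_le_trans)
  then show ?thesis using \<open>y \<ge> 0\<close> by (intro level_cover) (auto simp: wang_sigma_def)
qed

lemma wang_path_eq: "wang_path n w = C_transform \<eta> \<sigma> w"
  using covered Om by (auto simp: wang_path_def)

text \<open>On a piece the shift is the time \<open>s - d\<close> discarded so far, which is small.
  Only the last bit of the piece is stretched, and there both paths are compared with \<infinity>:
  one is just before an explosion, the other either also just before it or in the discarded part,
  outside \<open>An n\<close>.\<close>

lemma piece_change:
  assumes T: "T \<ge> 0" and e: "0 < e" "e \<le> 1" and n: "1 / (real n + 1) < e / 2"
    and small: "emeasure lborel {t. 0 \<le> t \<and> t < T + 1 \<and> w t \<notin> An n} < ennreal e"
    and fin: "\<sigma> m \<noteq> \<infinity>"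
  shows "\<exists>\<phi>. strict_mono_on {t. gl m \<le> ereal t \<and> ereal t < gl (Suc m)} \<phi> \<and>
     \<phi> ` {t. gl m \<le> ereal t \<and> ereal t < gl (Suc m)} = {y. \<sigma> m \<le> ereal y \<and> ereal y < \<sigma> (Suc m)} \<and>
     (\<forall>t. gl m \<le> ereal t \<and> ereal t < gl (Suc m) \<and> t \<le> T \<longrightarrow>
        \<bar>\<phi> t - t\<bar> < e \<and> dist (wang_path n w t) (w (\<phi> t)) < e)"
proof -
  \<comment> \<open>\<open>s - d \<le> s - occ n s\<close> is at most the time outside
    \<open>An n\<close> before \<open>s\<close>. As \<open>s\<close> may exceed \<open>T\<close>,
    that time is controlled up to \<open>T + 1\<close>; since \<open>e \<le> 1\<close>, a return
    time \<open>s\<close> beyond \<open>T + 1\<close> is impossible.\<close>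
  have cut_small: "s - d < e" if "\<sigma> k = ereal s" "gl k = ereal d" "d \<le> T" "0 \<le> d" "d \<le> s" "occ n s \<le> d" for k s d
  proof -
    have N: "T + 1 - occ n (T + 1) < e" using T small e by (intro occ_complement) auto
    show ?thesis
    proof (cases "s \<le> T + 1")
      case True
      then show ?thesis using N occ_lipschitz[of s "T + 1" n] that by linarith
    next
      case False
      then have "occ n (T + 1) \<le> occ n s" using T by (intro occ_mono) auto
      then show ?thesis using N that e by linarith
    qed
  qed
  obtain s d where sd: "\<sigma> m = ereal s" "gl m = ereal d" "0 \<le> d" "d \<le> s" "occ n s \<le> d"
    using piece_reals[OF fin] by metis
  have wp: "wang_path n w t = w (s + (t - d))" if "d \<le> t" "ereal t < gl (Suc m)" for t
    unfolding wang_path_eq using that sd by (intro C_transform_piece) (auto simp: in_piece_def)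
  show ?thesis
  proof (cases "\<eta> (Suc m) = \<infinity>")
    case True
    then have inf: "gl (Suc m) = \<infinity>" "\<sigma> (Suc m) = \<infinity>" using glue_infinite \<alpha>\<beta>[of m] by auto
    have "(\<lambda>t. s + (t - d)) ` {d..} = {s..}"
      by (auto intro!: image_eqI[of _ _ "d + (y - s)" for y])
    moreover have "\<bar>s + (t - d) - t\<bar> < e" if "d \<le> t" "t \<le> T" for t
      using cut_small[OF sd(1,2)] sd that by simp
    ultimately show ?thesis unfolding sd inf
      using wp inf e by (intro exI[of _ "\<lambda>t. s + (t - d)"]) (auto simp: strict_mono_on_def atLeast_def)
  next
    case False
    from eta_cases[OF False] obtain x where x: "\<eta> (Suc m) = ereal x" "s < x" "(w \<longlongrightarrow> Infty) (at_left x)"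
      using sd(1) by (metis ereal.inject)
    obtain s' where s': "\<sigma> (Suc m) = ereal s'" "x \<le> s'"
      using sigma_finite[OF False] \<alpha>\<beta>[of m] x(1) by (cases "\<sigma> (Suc m)") auto
    define d' where "d' = d + (x - s)"
    have d': "gl (Suc m) = ereal d'" using sd x by (simp add: glue_time.simps(2) d'_def)
    have "open {z. dist z Infty < e / 2}" using open_ball[of Infty "e / 2"] by (simp add: ball_def dist_commute)
    then obtain r where r: "r > 0" "\<And>v. x - r < v \<Longrightarrow> v < x \<Longrightarrow> dist (w v) Infty < e / 2"
      using left_nbhd[OF x(3), of "{z. dist z Infty < e / 2}"] e by auto
    have far: "dist z Infty < e / 2" if "z \<notin> An n" for z
    proof (cases z)
      case (St k)
      then have "k > n" using that by auto
      then have "1 / (real k + 1) \<le> 1 / (real n + 1)" by (intro divide_left_mono) auto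
      then show ?thesis using n by (simp add: St dist_bstate_def)
    qed (use that e in auto)
    \<comment> \<open>Three demands: the stretched bit lies where the path is already near
      \<infinity>, it is shorter than the piece, and if the piece ends after \<open>T\<close> it
      begins after \<open>T\<close>, where nothing has to be controlled.\<close>
    define \<delta> where "\<delta> = min (min (r / 2) ((x - s) / 2)) (if T < d' then (d' - T) / 2 else 1)"
    have \<delta>: "0 < \<delta>" "\<delta> < x - s" "\<delta> < r" "T < d' \<Longrightarrow> T < d' - \<delta>"
    proof -
      have "\<delta> \<le> r / 2" unfolding \<delta>_def by (rule order_trans[OF min.cobounded1 min.cobounded1])
      moreover have "\<delta> \<le> (x - s) / 2" unfolding \<delta>_def by (rule order_trans[OF min.cobounded1 min.cobounded2])
      moreover have "\<delta> \<le> (d' - T) / 2" if "T < d'" using that unfolding \<delta>_def by (simp only: if_True min.cobounded2)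
      ultimately show "\<delta> < x - s" "\<delta> < r" "T < d' \<Longrightarrow> T < d' - \<delta>" using r(1) x(2) by (auto simp: field_simps)
    qed (use r(1) x(2) in \<open>auto simp: \<delta>_def\<close>)
    obtain \<phi> where \<phi>: "strict_mono_on {d..<d'} \<phi>" "\<phi> ` {d..<d'} = {s..<s'}"
      "\<And>t. d \<le> t \<Longrightarrow> t \<le> d' - \<delta> \<Longrightarrow> \<phi> t = s + (t - d)"
      "\<And>t. d' - \<delta> < t \<Longrightarrow> t < d' \<Longrightarrow> \<phi> t \<in> {x - \<delta><..<s'}"
      "\<And>t. d \<le> t \<Longrightarrow> t < d' \<Longrightarrow> s + (t - d) \<le> \<phi> t \<and> \<phi> t \<le> s' + (t - d')"
      using piece_map[OF s'(2) \<delta>(1,2), of d] unfolding d'_def by metis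
    have "\<bar>\<phi> t - t\<bar> < e \<and> dist (wang_path n w t) (w (\<phi> t)) < e" if t: "d \<le> t" "t < d'" "t \<le> T" for t
    proof (cases "t \<le> d' - \<delta>")
      case True
      then show ?thesis using \<phi>(3)[of t] cut_small[OF sd(1,2)] sd wp[of t] d' t e by simp
    next
      case False
      \<comment> \<open>A stretched time up to \<open>T\<close> occurs only in a piece ending by
        \<open>T\<close>, so the estimate of the discarded time also applies at its end and bounds
        \<open>s' - d'\<close>.\<close>
      then have "d' \<le> T" using \<delta>(4) t by linarith
      obtain d2 where "gl (Suc m) = ereal d2" "0 \<le> d2" "d2 \<le> s'" "occ n s' \<le> d2"
        using piece_reals[of "Suc m"] s' by (metis PInfty_neq_ereal(1) ereal.inject)
      then have "s' - d' < e" using cut_small[OF s'(1) d'] \<open>d' \<le> T\<close> d' by simp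
      then have 1: "\<bar>\<phi> t - t\<bar> < e" using \<phi>(5)[of t] t sd by linarith
      have "dist (w (s + (t - d))) Infty < e / 2"
        using False t \<delta> by (intro r(2)) (auto simp: d'_def)
      moreover have "dist (w (\<phi> t)) Infty < e / 2"
      proof (cases "\<phi> t < x")
        case True
        then show ?thesis using \<phi>(4)[of t] False t \<delta>(3) by (intro r(2)) auto
      next
        case False2: False
        have "\<phi> t < s'" using \<phi>(4)[of t] False t by auto
        then show ?thesis using False2 s' x sd by (intro far cut_avoids[where m = m]) auto
      qed
      ultimately have "dist (w (s + (t - d))) (w (\<phi> t)) < e"
        using dist_triangle2[of "w (s + (t - d))" "w (\<phi> t)" Infty] by linarith
      then show ?thesis using 1 wp[of t] t d' by simp
    qed
    then show ?thesis unfolding sd s' d' using \<phi>(1,2)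
      by (intro exI[of _ \<phi>]) (auto simp: atLeastLessThan_def atLeast_def lessThan_def Int_def)
  qed
qed

text \<open>The pieces of the glued clock and the intervals between returns both partition the
  half-line, in the same order, so the maps on the pieces combine to an increasing map onto; this is
  all that \<open>time_change\<close> demands.\<close>

lemma wang_path_in_nbhd:
  assumes T: "T \<ge> 0" and e: "0 < e" "e \<le> 1" and n: "1 / (real n + 1) < e / 2"
    and small: "emeasure lborel {t. 0 \<le> t \<and> t < T + 1 \<and> w t \<notin> An n} < ennreal e"
  shows "wang_path n w \<in> skorohod_nbhd w T e"
proof -
  let ?D = "\<lambda>m. {t. gl m \<le> ereal t \<and> ereal t < gl (Suc m)}"
  let ?Q = "\<lambda>m \<phi>. strict_mono_on (?D m) \<phi> \<and> \<phi> ` ?D m = {y. \<sigma> m \<le> ereal y \<and> ereal y < \<sigma> (Suc m)} \<and>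
     (\<forall>t. gl m \<le> ereal t \<and> ereal t < gl (Suc m) \<and> t \<le> T \<longrightarrow>
        \<bar>\<phi> t - t\<bar> < e \<and> dist (wang_path n w t) (w (\<phi> t)) < e)"
  define \<phi> where "\<phi> m = (SOME \<phi>. ?Q m \<phi>)" for m
  have Q: "?Q m (\<phi> m)" if "\<sigma> m \<noteq> \<infinity>" for m
    unfolding \<phi>_def using piece_change[OF assms that] by (rule someI_ex)
  have \<phi>: "\<And>m. \<sigma> m \<noteq> \<infinity> \<Longrightarrow> strict_mono_on (?D m) (\<phi> m)"
     "\<And>m. \<sigma> m \<noteq> \<infinity> \<Longrightarrow> \<phi> m ` ?D m = {y. \<sigma> m \<le> ereal y \<and> ereal y < \<sigma> (Suc m)}"
     "\<And>m t. \<sigma> m \<noteq> \<infinity> \<Longrightarrow> t \<in> ?D m \<Longrightarrow> t \<le> T \<Longrightarrow> \<bar>\<phi> m t - t\<bar> < e \<and> dist (wang_path n w t) (w (\<phi> m t)) < e"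
    using Q by blast+
  define pc where "pc t = (SOME m. in_piece \<eta> \<sigma> t m)" for t
  have pc: "in_piece \<eta> \<sigma> t (pc t)" if "t \<ge> 0" for t
    unfolding pc_def using covered[OF that] by (rule someI_ex)
  have pcD: "\<sigma> (pc t) \<noteq> \<infinity>" "t \<in> ?D (pc t)" if "t \<ge> 0" for t
    using pc[OF that] by (auto simp: in_piece_def)
  define l where "l t = \<phi> (pc t) t" for t
  have l_range: "\<sigma> (pc t) \<le> ereal (l t)" "ereal (l t) < \<sigma> (Suc (pc t))" if "t \<ge> 0" for t
    using \<phi>(2)[OF pcD(1)[OF that]] pcD(2)[OF that] unfolding l_def by blast+
  have "strict_mono_on {0..} l"
  proof (rule strict_mono_onI)
    fix t u :: real assume tu: "t \<in> {0..}" "u \<in> {0..}" "t < u"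
    show "l t < l u"
    proof (cases "pc t = pc u")
      case True
      then show ?thesis using \<phi>(1)[OF pcD(1)[of t]] pcD(2)[of t] pcD(2)[of u] tu
        unfolding l_def strict_mono_on_def by auto
    next
      case False
      have "pc t < pc u"
      proof (rule ccontr)
        assume "\<not> pc t < pc u"
        then have "gl (Suc (pc u)) \<le> gl (pc t)" using False by (intro glue_mono) linarith
        moreover have "gl (pc t) \<le> ereal t" "ereal u < gl (Suc (pc u))"
          using pcD(2)[of t] pcD(2)[of u] tu by simp_all
        ultimately have "ereal u < ereal t" by (meson less_le_trans)
        then show False using tu by simp
      qed
      then have "\<sigma> (Suc (pc t)) \<le> \<sigma> (pc u)" by (intro \<beta>_mono) simp
      then have "ereal (l t) < ereal (l u)"
        using l_range(2)[of t] l_range(1)[of u] tu by (meson atLeast_iff less_le_trans)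
      then show ?thesis by simp
    qed
  qed
  moreover have "l ` {0..} = {0..}"
  proof (intro equalityI subsetI)
    fix y assume "y \<in> l ` {0..}"
    then obtain t where "t \<ge> 0" "y = l t" by auto
    then have "0 \<le> ereal y" using order_trans[OF \<beta>_nonneg l_range(1)[of t]] by simp
    then show "y \<in> {0..}" by simp
  next
    fix y :: real assume "y \<in> {0..}"
    then obtain m where m: "\<sigma> m \<le> ereal y" "ereal y < \<sigma> (Suc m)" using sigma_cover by auto
    then have f: "\<sigma> m \<noteq> \<infinity>" by auto
    from \<phi>(2)[OF f] m obtain t where t: "t \<in> ?D m" "y = \<phi> m t" by blast
    have "0 \<le> ereal t" using t(1) order_trans[OF glue_nonneg[of m]] by blast
    then have t0: "0 \<le> t" by simp
    have "in_piece \<eta> \<sigma> t m" using t(1) f by (auto simp: in_piece_def less_top[symmetric] top_ereal_def)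
    then have "pc t = m" using in_piece_unique pc[OF t0] by blast
    then show "y \<in> l ` {0..}" using t0 t(2) unfolding l_def by auto
  qed
  ultimately have "time_change l" by (simp add: time_change_def)
  moreover have "\<bar>l t - t\<bar> < e \<and> dist (wang_path n w t) (w (l t)) < e" if "t \<in> {0..T}" for t
    unfolding l_def using that by (intro \<phi>(3) pcD) auto
  ultimately show ?thesis
    unfolding skorohod_nbhd_def using wang_path_cadlag by blast
qed

end

subsection \<open>Measurability of the transformation\<close>

text \<open>The infima and left limits over uncountably many times in the definition of the cutting times
  are replaced by rational ones; on the paths of interest this makes no difference.\<close>

definition rhit :: "bstate set \<Rightarrow> (real \<Rightarrow> bstate) \<Rightarrow> ereal \<Rightarrow> ereal" where
  "rhit U w s = (INF r\<in>\<rat> \<inter> {0..}. if s \<le> ereal r \<and> w (max 0 r) \<in> U then ereal r else \<infinity>)"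

text \<open>A right-continuous path that is in an open set at \<open>t\<close> stays there up to
  some \<open>t + d\<close>, and rational times in between approximate \<open>t\<close>.\<close>

lemma hit_eq_rhit:
  assumes w: "w \<in> cadlag_paths" and U: "open U"
  shows "hit U w s = rhit U w s"
proof (rule antisym)
  show "hit U w s \<le> rhit U w s"
    unfolding rhit_def by (rule INF_greatest) (auto intro!: hit_le)
  show "rhit U w s \<le> hit U w s"
    unfolding hit_def
  proof (rule Inf_greatest)
    fix x assume "x \<in> ereal ` {t. 0 \<le> t \<and> s \<le> ereal t \<and> w t \<in> U}"
    then obtain t where t: "x = ereal t" "0 \<le> t" "s \<le> ereal t" "w t \<in> U" by auto
    obtain d where d: "d > 0" "\<And>v. t \<le> v \<Longrightarrow> v < t + d \<Longrightarrow> w v \<in> U"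
      using cadlag_right_nbhd[OF w t(2) U t(4)] by blast
    show "rhit U w s \<le> x"
    proof (rule ereal_le_epsilon2)
      fix e :: real assume "0 < e"
      then have "t < t + min d e" using d(1) by simp
      then obtain r where r: "r \<in> \<rat>" "t < r" "r < t + min d e" using Rats_dense_in_real by blast
      have "s \<le> ereal r" using t(3) r(2) by (meson ereal_less_eq(3) less_imp_le order_trans)
      moreover have "w (max 0 r) \<in> U" using d(2)[of r] r t(2) by (simp add: max_def)
      ultimately have "rhit U w s \<le> ereal r"
        unfolding rhit_def by (intro INF_lower2[of r]) (use r t in auto)
      also have "\<dots> \<le> x + ereal e" using r(3) t(1) by simp
      finally show "rhit U w s \<le> x + ereal e" .
    qed
  qed
qed

primrec rsigma :: "nat \<Rightarrow> (real \<Rightarrow> bstate) \<Rightarrow> nat \<Rightarrow> ereal" where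
  "rsigma n w 0 = 0"
| "rsigma n w (Suc m) = rhit (An n) w (SUP N. rhit (- An N) w (rsigma n w m))"

definition reta :: "nat \<Rightarrow> (real \<Rightarrow> bstate) \<Rightarrow> nat \<Rightarrow> ereal" where
  "reta n w m = (if m = 0 then 0 else SUP N. rhit (- An N) w (rsigma n w (m - 1)))"

text \<open>Agrees with the glued path where the path is good, and is defined for all paths, with
  \<open>max 0\<close> guarding the evaluation time, so as to be measurable without any exceptional
  set.\<close>

definition rpath :: "nat \<Rightarrow> real \<Rightarrow> (real \<Rightarrow> bstate) \<Rightarrow> bstate" where
  "rpath n t w = (let m = (LEAST m. in_piece (reta n w) (rsigma n w) t m)
     in w (max 0 (real_of_ereal (rsigma n w m) + (t - real_of_ereal (glue_time (reta n w) (rsigma n w) m)))))"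

lemma rhit_measurable [measurable]:
  assumes [measurable]: "s \<in> borel_measurable path_space"
  shows "(\<lambda>w. rhit U w (s w)) \<in> borel_measurable path_space"
  unfolding rhit_def
proof (rule borel_measurable_INF)
  show "countable (\<rat> \<inter> {0..} :: real set)" using countable_rat by blast
  show "(\<lambda>w. if s w \<le> ereal r \<and> w (max 0 r) \<in> U then ereal r else \<infinity>) \<in> borel_measurable path_space" for r
    by measurable
qed

lemma rsigma_measurable [measurable]: "(\<lambda>w. rsigma n w m) \<in> borel_measurable path_space"
  by (induction m) simp_all

lemma reta_measurable [measurable]: "(\<lambda>w. reta n w m) \<in> borel_measurable path_space"
  unfolding reta_def by (cases "m = 0") simp_all

lemma rglue_measurable [measurable]:
  "(\<lambda>w. glue_time (reta n w) (rsigma n w) m) \<in> borel_measurable path_space"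
  by (induction m) (simp_all del: rsigma.simps)

text \<open>The index of the piece takes countably many values, and for a fixed index the path is
  evaluated at a measurable random time.\<close>

lemma rpath_measurable: "rpath n t \<in> borel_measurable path_space"
proof -
  have [measurable]: "Measurable.pred path_space (\<lambda>w. in_piece (reta n w) (rsigma n w) t m)" for m
    unfolding in_piece_def by measurable
  have [measurable]: "(\<lambda>w. LEAST m. in_piece (reta n w) (rsigma n w) t m) \<in> measurable path_space (count_space UNIV)"
    by measurable
  have "(\<lambda>w. (\<lambda>m w. w (max 0 (real_of_ereal (rsigma n w m) + (t - real_of_ereal (glue_time (reta n w) (rsigma n w) m)))))
      (LEAST m. in_piece (reta n w) (rsigma n w) t m) w) \<in> borel_measurable path_space"
  proof (rule measurable_compose_countable)
    fix m
    show "(\<lambda>w. w (max 0 (real_of_ereal (rsigma n w m) + (t - real_of_ereal (glue_time (reta n w) (rsigma n w) m))))) \<in> borel_measurable path_space"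
      by (rule eval_random_time) measurable
  qed measurable
  then show ?thesis by (simp add: rpath_def[abs_def] Let_def)
qed

context good_path
begin

lemma rsigma_eq: "wang_sigma n w m = rsigma n w m"
proof (induction m)
  case (Suc m)
  have "wang_sigma n w (Suc m) = hit (An n) w (wang_eta n w (Suc m))"
    by (simp add: wang_sigma_def return_after_hit del: wang_eta.simps)
  also have "\<dots> = rhit (An n) w (explosion_hit w (rsigma n w m))"
    unfolding wang_eta_eq Suc.IH by (rule hit_eq_rhit[OF cad open_An])
  also have "explosion_hit w (rsigma n w m) = (SUP N. rhit (- An N) w (rsigma n w m))"
    unfolding explosion_hit_def using hit_eq_rhit[OF cad] closed_An by (simp add: open_Compl)
  finally show ?case by simp
qed (simp add: wang_sigma_def)

lemma reta_eq: "wang_eta n w m = reta n w m"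
proof (cases m)
  case (Suc k)
  have "explosion_hit w (rsigma n w k) = (SUP N. rhit (- An N) w (rsigma n w k))"
    unfolding explosion_hit_def using hit_eq_rhit[OF cad] closed_An by (simp add: open_Compl)
  then show ?thesis using Suc wang_eta_eq[of n k] by (simp add: reta_def rsigma_eq del: wang_eta.simps)
qed (simp add: reta_def)

end

lemma (in good_cut) rpath_eq: "t \<ge> 0 \<Longrightarrow> wang_path n w t = rpath n t w"
proof -
  assume t: "t \<ge> 0"
  have eq: "\<eta> = reta n w" "\<sigma> = rsigma n w" by (auto simp: reta_eq rsigma_eq)
  define m where "m = (LEAST m. in_piece \<eta> \<sigma> t m)"
  have m: "in_piece \<eta> \<sigma> t m" unfolding m_def using covered[OF t] by (rule LeastI_ex)
  then obtain b d where bd: "\<sigma> m = ereal b" "gl m = ereal d" "0 \<le> b" "0 \<le> d" "d \<le> t" by (rule in_piece_cases)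
  have "wang_path n w t = w (b + (t - d))"
    unfolding wang_path_eq by (rule C_transform_piece[OF m t bd(1,2)])
  also have "\<dots> = w (max 0 (real_of_ereal (\<sigma> m) + (t - real_of_ereal (gl m))))"
    using bd by (simp add: max_def)
  also have "\<dots> = rpath n t w" unfolding rpath_def Let_def eq[symmetric] m_def[symmetric] ..
  finally show ?thesis .
qed

text \<open>At each time the glued path differs from the measurable \<open>rpath\<close> only on a
  null set, which the completion absorbs.\<close>

lemma wang_path_measurable:
  assumes sets: "sets P = sets path_space" and good: "AE w in P. good_cut w n"
  shows "wang_path n \<in> measurable (completion P) path_space"
  unfolding path_space_def
proof (rule measurable_restrict_space2)
  show "wang_path n \<in> space (completion P) \<rightarrow> cadlag_paths" using wang_path_cadlag by auto
  have sp: "space P = cadlag_paths" using sets_eq_imp_space_eq[OF sets] by (simp add: space_path_space)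
  show "wang_path n \<in> measurable (completion P) (\<Pi>\<^sub>M t\<in>{0..}. borel)"
  proof (rule measurable_PiM_single')
    fix t :: real assume t: "t \<in> {0..}"
    show "(\<lambda>w. wang_path n w t) \<in> borel_measurable (completion P)"
    proof (rule measurableI)
      fix A :: "bstate set"
      show "(\<lambda>w. wang_path n w t) -` A \<inter> space (completion P) \<in> sets (completion P)"
      proof (rule completion.in_sets_AE)
        show "rpath n t -` A \<inter> space P \<in> sets (completion P)"
        proof (rule sets_completionI_sets)
          show "rpath n t -` A \<inter> space P \<in> sets P"
            using measurable_sets[OF rpath_measurable[of n t], of A] sets_eq_imp_space_eq[OF sets] sets by simp
        qed
        show "AE w in completion P. w \<in> rpath n t -` A \<inter> space P \<longleftrightarrow> w \<in> (\<lambda>w. wang_path n w t) -` A \<inter> space (completion P)"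
        proof (rule AE_completion)
          show "AE w in P. w \<in> rpath n t -` A \<inter> space P \<longleftrightarrow> w \<in> (\<lambda>w. wang_path n w t) -` A \<inter> space (completion P)"
            using good by eventually_elim (use t good_cut.rpath_eq in auto)
        qed
      qed auto
    qed simp
  next
    show "wang_path n \<in> space (completion P) \<rightarrow> {0..} \<rightarrow>\<^sub>E space borel"
      using wang_path_cadlag by (auto simp: cadlag_paths_def PiE_def)
  qed
qed

text \<open>The times outside \<open>An n\<close> before a fixed time decrease to the times spent at
  \<infinity>, a null set, so the smallness required by \<open>wang_path_in_nbhd\<close> holds
  eventually.\<close>

lemma good_convergence:
  fixes F :: "(real \<Rightarrow> bstate) \<Rightarrow> real"
  assumes F: "continuous_map skorohod_topology euclideanreal F" and w: "w \<in> cadlag_paths"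
    and null: "emeasure lborel {t. 0 \<le> t \<and> w t = Infty} = 0"
    and good: "\<And>n. n \<ge> N0 \<Longrightarrow> good_cut w n"
  shows "(\<lambda>n. F (wang_path n w)) \<longlonglongrightarrow> F w"
proof (rule tendstoI)
  fix e :: real assume e: "e > 0"
  have "openin skorohod_topology {y \<in> topspace skorohod_topology. F y \<in> ball (F w) e}"
    using F by (rule openin_continuous_map_preimage) simp
  then have G: "skorohod_open {y \<in> cadlag_paths. F y \<in> ball (F w) e}"
    by (simp add: openin_skorohod topspace_skorohod)
  have "w \<in> {y \<in> cadlag_paths. F y \<in> ball (F w) e}" using w e by simp
  with G obtain T \<epsilon> where T: "\<epsilon> > 0" "skorohod_nbhd w T \<epsilon> \<subseteq> {y \<in> cadlag_paths. F y \<in> ball (F w) e}"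
    unfolding skorohod_open_def by blast
  \<comment> \<open>A neighbourhood shrinks under these changes, and
    \<open>wang_path_in_nbhd\<close> requires a nonnegative horizon and a radius of at most
    1.\<close>
  define T' \<epsilon>' where "T' = max T 0" and "\<epsilon>' = min \<epsilon> 1"
  have \<epsilon>': "0 < \<epsilon>'" "\<epsilon>' \<le> 1" using T(1) by (auto simp: \<epsilon>'_def)
  let ?A = "\<lambda>n. {t. 0 \<le> t \<and> t < T' + 1 \<and> w t \<notin> An n}"
  have m: "?A n \<in> sets lborel" for n
  proof -
    have "?A n = {t. 0 \<le> t \<and> w t \<in> - An n} \<inter> {..<T' + 1}" by auto
    then show ?thesis using path_occupation_sets[OF w, of "- An n"] by simp
  qed
  have "emeasure lborel (?A n) \<noteq> \<infinity>" for n
  proof -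
    have "emeasure lborel (?A n) \<le> emeasure lborel {0..T' + 1}" by (intro emeasure_mono) auto
    also have "\<dots> < \<infinity>" by (simp add: emeasure_lborel_Icc_eq)
    finally show ?thesis by simp
  qed
  moreover have "decseq ?A"
  proof (rule decseq_SucI)
    fix n
    have "An n \<subseteq> An (Suc n)" by (rule An_mono) simp
    then have "x \<notin> An n" if "x \<notin> An (Suc n)" for x using that by (meson subsetD)
    then show "?A (Suc n) \<subseteq> ?A n" by (intro Collect_mono impI) (elim conjE, intro conjI)
  qed
  ultimately have "(\<lambda>n. emeasure lborel (?A n)) \<longlonglongrightarrow> emeasure lborel (\<Inter>n. ?A n)"
    using m by (intro Lim_emeasure_decseq image_subsetI)
  moreover have "emeasure lborel (\<Inter>n. ?A n) \<le> emeasure lborel {t. 0 \<le> t \<and> w t = Infty}"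
  proof (rule emeasure_mono)
    show "(\<Inter>n. ?A n) \<subseteq> {t. 0 \<le> t \<and> w t = Infty}"
    proof
      fix x assume x: "x \<in> (\<Inter>n. ?A n)"
      then have "w x \<notin> An n" for n by (simp only: INT_iff mem_Collect_eq UNIV_I simp_thms)
      then have "w x = Infty" by (rule not_in_An)
      then show "x \<in> {t. 0 \<le> t \<and> w t = Infty}" using x by simp
    qed
    show "{t. 0 \<le> t \<and> w t = Infty} \<in> sets lborel" using path_occupation_sets[OF w, of "{Infty}"] by simp
  qed
  ultimately have "(\<lambda>n. emeasure lborel (?A n)) \<longlonglongrightarrow> 0" using null by simp
  then have "eventually (\<lambda>n. emeasure lborel (?A n) < ennreal \<epsilon>') sequentially"
    using \<epsilon>' by (intro order_tendstoD(2)) auto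
  moreover have "(\<lambda>n. 1 / (real n + 1)) \<longlonglongrightarrow> 0"
    using LIMSEQ_Suc[OF lim_1_over_n] by (simp add: add.commute)
  then have "eventually (\<lambda>n. 1 / (real n + 1) < \<epsilon>' / 2) sequentially"
    using \<epsilon>' by (intro order_tendstoD(2)) auto
  moreover have "eventually (\<lambda>n. n \<ge> N0) sequentially" by (rule eventually_ge_at_top)
  ultimately show "eventually (\<lambda>n. dist (F (wang_path n w)) (F w) < e) sequentially"
  proof eventually_elim
    case (elim n)
    then interpret good_cut w n using good by simp
    have "wang_path n w \<in> skorohod_nbhd w T' \<epsilon>'"
      using elim \<epsilon>' by (intro wang_path_in_nbhd) (auto simp: T'_def)
    also have "\<dots> \<subseteq> skorohod_nbhd w T \<epsilon>" by (rule skorohod_nbhd_mono) (auto simp: T'_def \<epsilon>'_def)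
    also note T(2)
    finally show ?case by (simp add: dist_commute)
  qed
qed

text \<open>The state \<open>j\<close> of the resolvent bound has to belong to \<open>An n\<close>;
  hence the restriction to \<open>n \<ge> j\<close>, which is harmless in the limit.\<close>

lemma (in chain_law) AE_good:
  assumes lb: "\<And>i. resolvent p 1 i j \<ge> \<delta>" "\<delta> > 0"
    and q: "\<And>k. (\<Sum>j\<le>Suc k. q k j) = 0"
  shows "AE w in P. \<forall>n\<ge>j. good_cut w n"
  using AE_no_exit_jump[OF q] AE_occupation_infinite[OF lb] AE_Omega AE_not_Infty[of 0, OF order_refl]
proof eventually_elim
  case (elim w)
  show ?case
  proof (intro allI impI)
    fix n assume "n \<ge> j"
    have c: "w \<in> cadlag_paths" using elim by (simp add: Omega_def)
    have "emeasure lborel {t. 0 \<le> t \<and> w t \<in> {St j, Cem}} \<le> emeasure lborel {t. 0 \<le> t \<and> w t \<in> An n}"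
    proof (rule emeasure_mono)
      show "{t. 0 \<le> t \<and> w t \<in> {St j, Cem}} \<subseteq> {t. 0 \<le> t \<and> w t \<in> An n}" using \<open>n \<ge> j\<close> by auto
      show "{t. 0 \<le> t \<and> w t \<in> An n} \<in> sets lborel" using path_occupation_sets[OF c, of "An n"] by simp
    qed
    then have "emeasure lborel {t. 0 \<le> t \<and> w t \<in> An n} = \<infinity>" using elim by (simp only: infinity_ennreal_def top_unique)
    then show "good_cut w n" using elim by unfold_locales auto
  qed
qed

subsection \<open>Initial distributions\<close>

lemma (in chain_law) measure_cyl_list:
  assumes "sorted (0 # map fst zs)" "set (map (\<lambda>z. (fst z, emb (snd z))) zs) = Z"
  shows "emeasure P (cyl Z) = (\<integral>\<^sup>+x. ennreal (chain_prob ext zs 0 x) \<partial>measure_pmf \<rho>)"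
proof -
  have b: "0 \<le> chain_prob ext zs s x \<and> chain_prob ext zs s x \<le> 1" if "sorted (s # map fst zs)" for s x
    using that
  proof (induction zs arbitrary: s x)
    case (Cons z zs)
    then have "0 \<le> chain_prob ext zs (fst z) (snd z) \<and> chain_prob ext zs (fst z) (snd z) \<le> 1" "0 \<le> fst z - s"
      by simp_all
    then show ?case using ext_nonneg[of "fst z - s" x "snd z"] ext_le_1[of "fst z - s" x "snd z"]
      by (auto intro: mult_le_one)
  qed simp
  have "measure P (cyl Z) = measure_pmf.expectation \<rho> (chain_prob ext zs 0)"
    using fdd[OF assms(1)] cyl_list[of zs] assms(2) by simp
  moreover have "(\<integral>\<^sup>+x. ennreal (chain_prob ext zs 0 x) \<partial>measure_pmf \<rho>) = ennreal (measure_pmf.expectation \<rho> (chain_prob ext zs 0))"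
    using b[OF assms(1)]
    by (intro nn_integral_eq_integral measure_pmf.integrable_const_bound[where B = 1]) auto
  ultimately show ?thesis by (simp add: emeasure_eq_measure)
qed

text \<open>Cylinder probabilities are expectations over the starting point, so both measures agree
  on cylinders. The kernel is measurable because the space of starting points is discrete.\<close>

lemma law_mixture:
  assumes Q: "Q_process q p" and law: "\<And>l. process_law p l (P l)"
  shows "(\<lambda>x. P (return_pmf x)) \<in> measurable (measure_pmf \<rho>) (subprob_algebra path_space)"
    and "P \<rho> = measure_pmf \<rho> \<bind> (\<lambda>x. P (return_pmf x))"
proof -
  have cl: "chain_law p q l (P l)" for l by unfold_locales (rule Q law)+
  show K: "(\<lambda>x. P (return_pmf x)) \<in> measurable (measure_pmf \<rho>) (subprob_algebra path_space)"
    using law by (auto simp: space_subprob_algebra process_law_def intro: prob_space_imp_subprob_space)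
  show "P \<rho> = measure_pmf \<rho> \<bind> (\<lambda>x. P (return_pmf x))"
  proof (rule path_measure_eqI)
    show "finite_measure (P \<rho>)" using law[of \<rho>] by (auto simp: process_law_def prob_space_def)
    show "sets (P \<rho>) = sets path_space" using law[of \<rho>] by (simp add: process_law_def)
    show "sets (measure_pmf \<rho> \<bind> (\<lambda>x. P (return_pmf x))) = sets path_space"
      by (rule sets_bind) (use law in \<open>auto simp: process_law_def\<close>)
    fix Z :: "(real \<times> bstate) set" assume Z: "finite Z" "fst ` Z \<subseteq> {0..}"
    have "emeasure (measure_pmf \<rho> \<bind> (\<lambda>x. P (return_pmf x))) (cyl Z) = (\<integral>\<^sup>+x. emeasure (P (return_pmf x)) (cyl Z) \<partial>measure_pmf \<rho>)"
      using K cyl_sets[OF Z] by (intro emeasure_bind) auto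
    also have "\<dots> = emeasure (P \<rho>) (cyl Z)"
    proof (cases "\<exists>t. (t, Infty) \<in> Z")
      case True
      then obtain t where t: "(t, Infty) \<in> Z" by blast
      then have "t \<ge> 0" using Z(2) by force
      have "emeasure (P l) (cyl Z) = 0" for l
      proof -
        have "cyl Z \<subseteq> cyl {(t, Infty)}" using t by (auto simp: cyl_def)
        moreover have "cyl Z \<in> sets (P l)" using cyl_sets[OF Z] law[of l] by (simp add: process_law_def)
        ultimately show ?thesis
          using null_sets_subset[OF chain_law.null_Infty[OF cl \<open>t \<ge> 0\<close>]] by blast
      qed
      then show ?thesis by simp
    next
      case False
      obtain zs where zs: "sorted (map fst zs)" "set (map (\<lambda>z. (fst z, emb (snd z))) zs) = Z"
        using sorted_cylinder[OF Z(1) False] by blast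
      have "\<forall>z\<in>set zs. 0 \<le> fst z" using Z(2) unfolding zs(2)[symmetric] by force
      then have so: "sorted (0 # map fst zs)" using zs(1) by auto
      show ?thesis
        unfolding chain_law.measure_cyl_list[OF cl so zs(2)] by simp
    qed
    finally show "emeasure (P \<rho>) (cyl Z) = emeasure (measure_pmf \<rho> \<bind> (\<lambda>x. P (return_pmf x))) (cyl Z)" ..
  qed
qed

text \<open>Functions of the glued path are measurable only for the completion of
  \<open>P \<rho>\<close>. Such a function is Borel off a null set of \<open>P \<rho>\<close>, which
  is also null for the law from \<open>x\<close>, for \<open>\<rho>\<close>-almost every
  \<open>x\<close>.\<close>

lemma nn_integral_law_mixture:
  assumes Q: "Q_process q p" and law: "\<And>l. process_law p l (P l)"
    and D: "D \<in> borel_measurable (completion (P \<rho>))"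
  shows "(\<integral>\<^sup>+w. D w \<partial>P \<rho>) = (\<integral>\<^sup>+x. \<integral>\<^sup>+w. D w \<partial>P (return_pmf x) \<partial>measure_pmf \<rho>)"
proof -
  note K = law_mixture(1)[OF Q law, of \<rho>] and mix = law_mixture(2)[OF Q law, of \<rho>]
  have sets: "sets (P l) = sets path_space" for l using law[of l] by (simp add: process_law_def)
  obtain D' where D': "D' \<in> borel_measurable (P \<rho>)" "AE w in P \<rho>. D w = D' w"
    using completion_ex_borel_measurable[OF D] by blast
  obtain N where N: "{w \<in> space (P \<rho>). D w \<noteq> D' w} \<subseteq> N" "emeasure (P \<rho>) N = 0" "N \<in> sets (P \<rho>)"
    using AE_E[OF D'(2)] by blast
  have "emeasure (measure_pmf \<rho> \<bind> (\<lambda>x. P (return_pmf x))) N = (\<integral>\<^sup>+x. emeasure (P (return_pmf x)) N \<partial>measure_pmf \<rho>)"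
    using K N(3) sets by (intro emeasure_bind) auto
  then have "(\<integral>\<^sup>+x. emeasure (P (return_pmf x)) N \<partial>measure_pmf \<rho>) = 0" using N(2) mix by simp
  then have *: "AE x in measure_pmf \<rho>. emeasure (P (return_pmf x)) N = 0"
    by (subst (asm) nn_integral_0_iff_AE) auto
  have "(\<integral>\<^sup>+w. D w \<partial>P \<rho>) = (\<integral>\<^sup>+w. D' w \<partial>P \<rho>)" by (rule nn_integral_cong_AE[OF D'(2)])
  also have "\<dots> = (\<integral>\<^sup>+w. D' w \<partial>(measure_pmf \<rho> \<bind> (\<lambda>x. P (return_pmf x))))" by (simp only: mix[symmetric])
  also have "\<dots> = (\<integral>\<^sup>+x. \<integral>\<^sup>+w. D' w \<partial>P (return_pmf x) \<partial>measure_pmf \<rho>)"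
  proof (rule nn_integral_bind[OF _ K])
    show "D' \<in> borel_measurable path_space" using D'(1) measurable_cong_sets[OF sets[of \<rho>] refl] by blast
  qed
  also have "\<dots> = (\<integral>\<^sup>+x. \<integral>\<^sup>+w. D w \<partial>P (return_pmf x) \<partial>measure_pmf \<rho>)"
  proof (rule nn_integral_cong_AE)
    show "AE x in measure_pmf \<rho>. (\<integral>\<^sup>+w. D' w \<partial>P (return_pmf x)) = (\<integral>\<^sup>+w. D w \<partial>P (return_pmf x))"
      using *
    proof eventually_elim
      case (elim x)
      have "space (P (return_pmf x)) = space (P \<rho>)" using sets_eq_imp_space_eq sets by metis
      then have "AE w in P (return_pmf x). D' w = D w"
        using elim N(1,3) sets by (intro AE_I[where N = N]) auto
      then show ?case by (rule nn_integral_cong_AE)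
    qed
  qed
  finally show ?thesis .
qed

text \<open>For fixed \<open>N\<close> the function \<open>g N\<close>, the supremum of
  \<open>r n\<close> over \<open>n \<ge> N\<close>, is a legitimate test function dominating all
  later \<open>r n\<close>; its expectation under the limit law is small for large \<open>N\<close>
  by dominated convergence.\<close>

lemma weak_convergence_moving_functions:
  fixes r :: "nat \<Rightarrow> 'a \<Rightarrow> real" and lam :: "nat \<Rightarrow> 'a pmf" and lam_lim :: "'a pmf"
  assumes r: "\<And>n x. 0 \<le> r n x" "\<And>n x. r n x \<le> C" "\<And>x. (\<lambda>n. r n x) \<longlonglongrightarrow> 0"
    and weak: "\<And>f :: 'a \<Rightarrow> real. bounded (range f) \<Longrightarrow>
       (\<lambda>n. measure_pmf.expectation (lam n) f) \<longlonglongrightarrow> measure_pmf.expectation lam_lim f"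
  shows "(\<lambda>n. measure_pmf.expectation (lam n) (r n)) \<longlonglongrightarrow> 0"
proof -
  define g where "g N x = (SUP n\<in>{N..}. r n x)" for N x
  have bdd: "bdd_above ((\<lambda>n. r n x) ` {N..})" for N x using r(2) by (intro bdd_aboveI[of _ C]) auto
  have rg: "r n x \<le> g N x" if "n \<ge> N" for n N x
    unfolding g_def using that by (intro cSUP_upper bdd) auto
  have gC: "g N x \<le> C" for N x unfolding g_def using r(2) by (intro cSUP_least) auto
  have g0: "0 \<le> g N x" for N x using r(1)[of N x] rg[of N N x] by simp
  have glim: "(\<lambda>N. g N x) \<longlonglongrightarrow> 0" for x
  proof (rule LIMSEQ_I)
    fix e :: real assume e: "e > 0"
    then obtain M where M: "\<And>n. n \<ge> M \<Longrightarrow> r n x < e / 2"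
      using order_tendstoD(2)[OF r(3)[of x], of "e / 2"] by (auto simp: eventually_sequentially)
    have "g N x \<le> e / 2" if "N \<ge> M" for N
      unfolding g_def
    proof (rule cSUP_least)
      show "r n x \<le> e / 2" if "n \<in> {N..}" for n using M[of n] that \<open>N \<ge> M\<close> by simp
    qed simp
    then show "\<exists>no. \<forall>n\<ge>no. norm (g n x - 0) < e" using e g0 by (intro exI[of _ M]) fastforce
  qed
  have int: "integrable (measure_pmf l) f" if "\<And>x. 0 \<le> f x" "\<And>x. f x \<le> C" for l and f :: "'a \<Rightarrow> real"
    using that by (intro measure_pmf.integrable_const_bound[where B = C]) auto
  have "(\<lambda>N. measure_pmf.expectation lam_lim (g N)) \<longlonglongrightarrow> measure_pmf.expectation lam_lim (\<lambda>_. 0)"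
    by (rule integral_dominated_convergence[where w = "\<lambda>_. C"]) (use g0 gC glim in auto)
  then have glim': "(\<lambda>N. measure_pmf.expectation lam_lim (g N)) \<longlonglongrightarrow> 0" by simp
  show ?thesis
  proof (rule LIMSEQ_I)
    fix e :: real assume e: "e > 0"
    then obtain N where N: "measure_pmf.expectation lam_lim (g N) < e"
      using order_tendstoD(2)[OF glim', of e] by (auto simp: eventually_sequentially)
    have "bounded (range (g N))" using g0 gC by (intro boundedI[of _ C]) auto
    from order_tendstoD(2)[OF weak[OF this] N]
    obtain M where M: "\<And>n. n \<ge> M \<Longrightarrow> measure_pmf.expectation (lam n) (g N) < e"
      by (auto simp: eventually_sequentially)
    have "norm (measure_pmf.expectation (lam n) (r n) - 0) < e" if n: "n \<ge> max M N" for n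
    proof -
      have "measure_pmf.expectation (lam n) (r n) \<le> measure_pmf.expectation (lam n) (g N)"
        using n by (intro integral_mono int r g0 gC rg) auto
      moreover have "0 \<le> measure_pmf.expectation (lam n) (r n)" using r(1) by simp
      ultimately show ?thesis using M[of n] n by simp
    qed
    then show "\<exists>no. \<forall>n\<ge>no. norm (measure_pmf.expectation (lam n) (r n) - 0) < e" by blast
  qed
qed

lemma (in explosive_bd) bd_row_sum: "(\<Sum>j\<le>Suc k. bd_matrix a b k j) = 0"
proof -
  have "(\<lambda>j. bd_matrix a b k j) sums (\<Sum>j\<le>Suc k. bd_matrix a b k j)"
    by (rule sums_finite) (auto simp: bd_matrix_def)
  moreover have "(\<lambda>j. bd_matrix a b k j) sums 0" using bd_matrix_sums[of k "\<lambda>_. 1"] by simp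
  ultimately show ?thesis by (rule sums_unique2)
qed

subsection \<open>Convergence of the laws\<close>

locale good_law_family =
  fixes P :: "nat option pmf \<Rightarrow> (real \<Rightarrow> bstate) measure" and p :: "real \<Rightarrow> nat \<Rightarrow> nat \<Rightarrow> real"
    and q :: "nat \<Rightarrow> nat \<Rightarrow> real" and F :: "(real \<Rightarrow> bstate) \<Rightarrow> real" and B :: real and j :: nat
  assumes Q: "Q_process q p" and law: "\<And>l. process_law p l (P l)"
    and good: "\<And>l. AE w in P l. \<forall>n\<ge>j. good_cut w n"
    and F: "continuous_map skorohod_topology euclideanreal F"
    and F_meas: "F \<in> borel_measurable path_space"
    and F_bound: "\<And>w. w \<in> cadlag_paths \<Longrightarrow> \<bar>F w\<bar> \<le> B"
begin

lemma cl: "chain_law p q l (P l)" by unfold_locales (rule Q law)+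

lemma sets_law: "sets (P l) = sets path_space" using law[of l] by (simp add: process_law_def)

lemma space_law: "space (P l) = cadlag_paths"
  using sets_eq_imp_space_eq[OF sets_law] by (simp add: space_path_space)

lemma prob_law: "prob_space (P l)" using law[of l] by (simp add: process_law_def)

lemma prob_completion: "prob_space (completion (P l))"
  using prob_space.emeasure_space_1[OF prob_law[of l]] by (intro prob_spaceI) simp

lemma F_law: "F \<in> borel_measurable (P l)"
  using F_meas measurable_cong_sets[OF sets_law refl] by blast

lemma wang_meas: "n \<ge> j \<Longrightarrow> wang_path n \<in> measurable (completion (P l)) path_space"
  using good[of l] by (intro wang_path_measurable sets_law) (auto elim: AE_mp)

lemma F_wang_meas: "n \<ge> j \<Longrightarrow> (\<lambda>w. F (wang_path n w)) \<in> borel_measurable (completion (P l))"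
  using measurable_compose[OF wang_meas F_meas] .

definition err :: "nat \<Rightarrow> (real \<Rightarrow> bstate) \<Rightarrow> ennreal" where
  "err n w = ennreal \<bar>F (wang_path n w) - F w\<bar>"

lemma err_meas: "n \<ge> j \<Longrightarrow> err n \<in> borel_measurable (completion (P l))"
  unfolding err_def using F_wang_meas[of n l] measurable_completion[OF F_law] by measurable

lemma err_le: "w \<in> cadlag_paths \<Longrightarrow> err n w \<le> ennreal (2 * B)"
  unfolding err_def using F_bound[of w] F_bound[OF wang_path_cadlag, of n w] by (intro ennreal_leI) linarith

text \<open>The mean error from a deterministic start. It does not involve the initial laws, so it
  can serve as a sequence of test functions.\<close>

definition merr :: "nat \<Rightarrow> nat option \<Rightarrow> real" where
  "merr n x = enn2real (\<integral>\<^sup>+w. err n w \<partial>P (return_pmf x))"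

lemma int_err_le: "(\<integral>\<^sup>+w. err n w \<partial>P l) \<le> ennreal (2 * B)"
proof -
  have "(\<integral>\<^sup>+w. err n w \<partial>P l) \<le> (\<integral>\<^sup>+w. ennreal (2 * B) \<partial>P l)"
    by (intro nn_integral_mono err_le) (simp add: space_law)
  also have "\<dots> = ennreal (2 * B)" by (simp add: prob_space.emeasure_space_1[OF prob_law])
  finally show ?thesis .
qed

lemma B_nonneg: "0 \<le> B"
  using F_bound[OF wang_path_cadlag, of 0 undefined] by linarith

lemma ennreal_merr: "ennreal (merr n x) = (\<integral>\<^sup>+w. err n w \<partial>P (return_pmf x))"
  unfolding merr_def using int_err_le[of "return_pmf x" n]
  by (intro ennreal_enn2real) (auto simp: le_less_trans)

lemma merr_le: "merr n x \<le> 2 * B"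
proof -
  have "ennreal (merr n x) \<le> ennreal (2 * B)" unfolding ennreal_merr by (rule int_err_le)
  then show ?thesis using B_nonneg by (simp add: ennreal_le_iff)
qed

lemma merr_tendsto: "(\<lambda>n. merr n x) \<longlonglongrightarrow> 0"
proof -
  let ?M = "completion (P (return_pmf x))"
  \<comment> \<open>The shift by \<open>j\<close> is due to measurability of the glued path being
    known only from \<open>j\<close> on.\<close>
  have "(\<lambda>n. \<integral>\<^sup>+w. err (n + j) w \<partial>?M) \<longlonglongrightarrow> (\<integral>\<^sup>+w. 0 \<partial>?M)"
  proof (rule nn_integral_dominated_convergence[where w = "\<lambda>_. ennreal (2 * B)"])
    show "AE w in ?M. err (n + j) w \<le> ennreal (2 * B)" for n
      by (intro AE_I2 err_le) (simp add: space_law)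
    show "(\<integral>\<^sup>+w. ennreal (2 * B) \<partial>?M) < \<infinity>"
      using prob_space.emeasure_space_1[OF prob_law[of "return_pmf x"]]
      by simp
    have "AE w in P (return_pmf x). (\<lambda>n. F (wang_path n w)) \<longlonglongrightarrow> F w"
      using good[of "return_pmf x"] chain_law.AE_occupation_Infty[OF cl, of "return_pmf x"] AE_space
    proof eventually_elim
      case (elim w)
      then show ?case using good_convergence[OF F, of w j] by (auto simp: space_law)
    qed
    then have "AE w in P (return_pmf x). (\<lambda>n. err (n + j) w) \<longlonglongrightarrow> 0"
    proof eventually_elim
      case (elim w)
      have "(\<lambda>n. \<bar>F (wang_path n w) - F w\<bar>) \<longlonglongrightarrow> \<bar>F w - F w\<bar>" by (intro tendsto_intros elim)
      then have "(\<lambda>n. ennreal \<bar>F (wang_path n w) - F w\<bar>) \<longlonglongrightarrow> ennreal 0"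
        by (intro tendsto_ennrealI) simp
      from LIMSEQ_ignore_initial_segment[OF this, of j] show ?case by (simp add: err_def)
    qed
    then show "AE w in ?M. (\<lambda>n. err (n + j) w) \<longlonglongrightarrow> 0" by (rule AE_completion)
  qed (use err_meas in auto)
  then have "(\<lambda>n. ennreal (merr (n + j) x)) \<longlonglongrightarrow> ennreal 0"
    by (simp add: ennreal_merr nn_integral_completion)
  then have "(\<lambda>n. merr (n + j) x) \<longlonglongrightarrow> 0"
    by (rule tendsto_ennrealD) (auto simp: merr_def)
  then show ?thesis by (rule LIMSEQ_offset)
qed

text \<open>The path and its glued version live on the same probability space, so the difference of
  the integrals is at most the mean of the pathwise error, which is a mixture over the starting
  point.\<close>

lemma wang_law_error:
  assumes n: "n \<ge> j"
  shows "\<bar>(\<integral>w. F w \<partial>wang_law n (P \<rho>)) - (\<integral>w. F w \<partial>P \<rho>)\<bar> \<le> measure_pmf.expectation \<rho> (merr n)"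
proof -
  let ?M = "completion (P \<rho>)"
  interpret M: prob_space ?M by (rule prob_completion)
  have 1: "integrable ?M (\<lambda>w. F (wang_path n w))"
    using F_wang_meas[OF n] F_bound[OF wang_path_cadlag] by (intro M.integrable_const_bound[where B = B]) auto
  have 2: "integrable ?M F"
    using measurable_completion[OF F_law] F_bound
    by (intro M.integrable_const_bound[where B = B]) (auto simp: space_law intro!: AE_I2)
  have "(\<integral>w. F w \<partial>wang_law n (P \<rho>)) - (\<integral>w. F w \<partial>P \<rho>) = (\<integral>w. F (wang_path n w) - F w \<partial>?M)"
    unfolding wang_law_def integral_distr[OF wang_meas[OF n] F_meas] integral_completion[OF F_law, symmetric]
    using 1 2 by (simp add: Bochner_Integration.integral_diff)
  then have "ennreal \<bar>(\<integral>w. F w \<partial>wang_law n (P \<rho>)) - (\<integral>w. F w \<partial>P \<rho>)\<bar> \<le> (\<integral>\<^sup>+w. err n w \<partial>?M)"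
    using integral_norm_bound_ennreal[OF Bochner_Integration.integrable_diff[OF 1 2]] by (simp add: err_def)
  also have "\<dots> = (\<integral>\<^sup>+x. ennreal (merr n x) \<partial>measure_pmf \<rho>)"
    unfolding nn_integral_completion ennreal_merr
    by (rule nn_integral_law_mixture[OF Q law err_meas[OF n]])
  also have "\<dots> = ennreal (measure_pmf.expectation \<rho> (merr n))"
    by (intro nn_integral_eq_integral measure_pmf.integrable_const_bound[where B = "2 * B"])
       (use merr_le in \<open>auto simp: merr_def\<close>)
  finally show ?thesis
    by (subst (asm) ennreal_le_iff) (auto simp: merr_def)
qed

text \<open>Adding the bound \<open>B\<close> makes the integrand nonnegative, which reduces the
  claim to \<open>nn_integral_law_mixture\<close>.\<close>

lemma integral_law_mixture:
  "(\<integral>w. F w \<partial>P \<rho>) = measure_pmf.expectation \<rho> (\<lambda>x. \<integral>w. F w \<partial>P (return_pmf x))"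
proof -
  have bound: "\<bar>F w\<bar> \<le> B" if "w \<in> space (P l)" for w l using that F_bound by (simp add: space_law)
  have int: "integrable (P l) F" for l
    using F_law bound by (intro finite_measure.integrable_const_bound[where B = B] AE_I2)
      (auto intro: prob_space.finite_measure prob_law)
  have nn: "(\<integral>\<^sup>+w. ennreal (F w + B) \<partial>P l) = ennreal ((\<integral>w. F w \<partial>P l) + B)" for l
  proof -
    interpret prob_space "P l" by (rule prob_law)
    have "(\<integral>\<^sup>+w. ennreal (F w + B) \<partial>P l) = ennreal (\<integral>w. F w + B \<partial>P l)"
    proof (rule nn_integral_eq_integral)
      show "AE w in P l. 0 \<le> F w + B"
      proof (rule AE_I2)
        fix w assume "w \<in> space (P l)"
        then show "0 \<le> F w + B" using bound[of w l] by linarith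
      qed
    qed (use int[of l] in simp)
    also have "(\<integral>w. F w + B \<partial>P l) = (\<integral>w. F w \<partial>P l) + B"
      using int[of l] prob_space by simp
    finally show ?thesis .
  qed
  let ?\<phi> = "\<lambda>x. \<integral>w. F w \<partial>P (return_pmf x)"
  have \<phi>: "\<bar>\<integral>w. F w \<partial>P l\<bar> \<le> B" for l
  proof -
    interpret prob_space "P l" by (rule prob_law)
    have "\<bar>\<integral>w. F w \<partial>P l\<bar> \<le> (\<integral>w. \<bar>F w\<bar> \<partial>P l)" by (rule integral_abs_bound)
    also have "\<dots> \<le> (\<integral>w. B \<partial>P l)" using int[of l] bound[of _ l] by (intro integral_mono) auto
    also have "\<dots> = B" using prob_space by simp
    finally show ?thesis .
  qed
  have int\<phi>: "integrable (measure_pmf \<rho>) ?\<phi>"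
    using \<phi> by (intro measure_pmf.integrable_const_bound[where B = B]) auto
  have "(\<lambda>w. ennreal (F w + B)) \<in> borel_measurable (completion (P \<rho>))"
    using measurable_completion[OF F_law[of \<rho>]] by measurable
  from nn_integral_law_mixture[OF Q law this]
  have "ennreal ((\<integral>w. F w \<partial>P \<rho>) + B) = (\<integral>\<^sup>+x. ennreal (?\<phi> x + B) \<partial>measure_pmf \<rho>)"
    unfolding nn .
  also have "\<dots> = ennreal (measure_pmf.expectation \<rho> (\<lambda>x. ?\<phi> x + B))"
  proof (rule nn_integral_eq_integral)
    show "AE x in measure_pmf \<rho>. 0 \<le> ?\<phi> x + B"
    proof (rule AE_I2)
      fix x show "0 \<le> ?\<phi> x + B" using \<phi>[of "return_pmf x"] by linarith
    qed
  qed (use int\<phi> in simp)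
  also have "measure_pmf.expectation \<rho> (\<lambda>x. ?\<phi> x + B) = measure_pmf.expectation \<rho> ?\<phi> + B"
    using int\<phi> by simp
  finally have "(\<integral>w. F w \<partial>P \<rho>) + B = measure_pmf.expectation \<rho> ?\<phi> + B"
  proof (rule ennreal_inj[THEN iffD1, rotated 2])
    show "0 \<le> (\<integral>w. F w \<partial>P \<rho>) + B" using \<phi>[of \<rho>] by linarith
    have "- B \<le> measure_pmf.expectation \<rho> ?\<phi>"
      using integral_mono[of "measure_pmf \<rho>" "\<lambda>_. - B" ?\<phi>] int\<phi> \<phi>
      by (auto simp: abs_le_iff minus_le_iff)
    then show "0 \<le> measure_pmf.expectation \<rho> ?\<phi> + B" by linarith
  qed
  then show ?thesis by simp
qed

text \<open>The integral under the law from \<open>x\<close> is a fixed bounded function of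
  \<open>x\<close>, to which weak convergence applies directly; replacing a path by its glued
  version costs at most the mean of \<open>merr n\<close>, a sequence of test functions tending to
  0.\<close>

lemma wang_laws_converge:
  assumes weak: "\<And>f :: nat option \<Rightarrow> real. bounded (range f) \<Longrightarrow>
      (\<lambda>n. measure_pmf.expectation (lam n) f) \<longlonglongrightarrow> measure_pmf.expectation lam_lim f"
  shows "(\<lambda>n. \<integral>w. F w \<partial>wang_law n (P (lam n))) \<longlonglongrightarrow> (\<integral>w. F w \<partial>P lam_lim)"
proof -
  let ?\<phi> = "\<lambda>x. \<integral>w. F w \<partial>P (return_pmf x)"
  have "bounded (range ?\<phi>)"
  proof (rule boundedI)
    fix y assume "y \<in> range ?\<phi>"
    then obtain x where y: "y = ?\<phi> x" by blast
    interpret prob_space "P (return_pmf x)" by (rule prob_law)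
    have "norm (?\<phi> x) \<le> (\<integral>w. norm (F w) \<partial>P (return_pmf x))" by (rule integral_norm_bound)
    also have "\<dots> \<le> (\<integral>w. B \<partial>P (return_pmf x))"
      using F_law F_bound B_nonneg by (intro integral_mono integrable_const_bound[where B = B] AE_I2) (auto simp: space_law)
    also have "\<dots> = B" using prob_space by simp
    finally show "norm y \<le> B" unfolding y .
  qed
  from weak[OF this] have 1: "(\<lambda>n. \<integral>w. F w \<partial>P (lam n)) \<longlonglongrightarrow> (\<integral>w. F w \<partial>P lam_lim)"
    unfolding integral_law_mixture[symmetric] .
  have 2: "(\<lambda>n. measure_pmf.expectation (lam n) (merr n)) \<longlonglongrightarrow> 0"
    by (rule weak_convergence_moving_functions[where C = "2 * B", OF _ merr_le merr_tendsto weak])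
       (simp_all add: merr_def)
  have "(\<lambda>n. (\<integral>w. F w \<partial>wang_law n (P (lam n))) - (\<integral>w. F w \<partial>P (lam n))) \<longlonglongrightarrow> 0"
  proof (rule Lim_null_comparison[OF _ 2])
    show "\<forall>\<^sub>F n in sequentially. norm ((\<integral>w. F w \<partial>wang_law n (P (lam n))) - (\<integral>w. F w \<partial>P (lam n))) \<le> measure_pmf.expectation (lam n) (merr n)"
      unfolding eventually_sequentially using wang_law_error by (intro exI[of _ j]) simp
  qed
  from tendsto_add[OF this 1] show ?thesis by simp
qed

end

theorem theorem6p1:
  fixes a b :: "nat \<Rightarrow> real"
    and pmin p :: "real \<Rightarrow> nat \<Rightarrow> nat \<Rightarrow> real"
    and \<gamma> \<beta> :: real and \<nu> :: "nat \<Rightarrow> real"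
    and P :: "nat option pmf \<Rightarrow> (real \<Rightarrow> bstate) measure"
    and lam :: "nat \<Rightarrow> nat option pmf" and lam_lim :: "nat option pmf"
    and F :: "(real \<Rightarrow> bstate) \<Rightarrow> real"
  assumes "birth_death a b"
    and "infinity_regular a b \<or> infinity_exit a b"
    and "minimal_backward_solution (bd_matrix a b) pmin"
    and "(\<gamma>, \<beta>, \<nu>) \<in> Q_Feller a b"
    and "Q_process (bd_matrix a b) p"
    and "determined_by a b pmin \<gamma> \<beta> \<nu> p"
    and "\<And>l. process_law p l (P l)"
    and "\<And>f :: nat option \<Rightarrow> real. bounded (range f) \<Longrightarrow>
           (\<lambda>n. measure_pmf.expectation (lam n) f) \<longlonglongrightarrow> measure_pmf.expectation lam_lim f"
    and "continuous_map skorohod_topology euclideanreal F"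
    and "bounded (F ` cadlag_paths)"
  shows "(\<lambda>n. \<integral>w. F w \<partial>wang_law n (P (lam n))) \<longlonglongrightarrow> (\<integral>w. F w \<partial>P lam_lim)"
proof (cases "F \<in> borel_measurable path_space")
  case False
  \<comment> \<open>The Borel sets of the Skorohod topology are those of \<open>path_space\<close>, so this case is void; but that
    is not needed, as the Bochner integral of a non-measurable function is 0 by convention.\<close>
  have zero: "(\<integral>w. F w \<partial>M) = 0" if "sets M = sets path_space" for M
  proof (rule not_integrable_integral_eq, rule notI)
    assume "integrable M F"
    then have "F \<in> borel_measurable M" by (rule borel_measurable_integrable)
    then show False using False measurable_cong_sets[OF that refl] by blast
  qed
  have "sets (P l) = sets path_space" for l using assms(7)[of l] by (simp add: process_law_def)
  then show ?thesis by (simp add: zero wang_law_def)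
next
  case True
  interpret explosive_bd_min a b pmin
    using assms(1-3) by unfold_locales (auto simp: infinity_regular_def infinity_exit_def)
  have "(\<gamma>, \<beta>, \<nu>) \<in> Q_params a b" using assms(4) by (simp add: Q_Feller_def)
  \<comment> \<open>The pair of \<open>j\<close> and \<delta> depends on the process only, so the
    same threshold for \<open>n\<close> serves all initial laws.\<close>
  then have "\<exists>j. \<exists>\<delta>>0. \<forall>i. resolvent p 1 i j \<ge> \<delta>"
    by (rule resolvent_lower_bound[OF assms(2) _ assms(6)]) auto
  then obtain j \<delta> where lb: "\<delta> > 0" "\<And>i. resolvent p 1 i j \<ge> \<delta>" by auto
  obtain B where B: "\<And>w. w \<in> cadlag_paths \<Longrightarrow> \<bar>F w\<bar> \<le> B"
    using assms(10) by (auto simp: bounded_iff)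
  interpret good_law_family P p "bd_matrix a b" F B j
  proof
    fix l
    interpret chain_law p "bd_matrix a b" l "P l" by unfold_locales (rule assms(5,7))+
    show "AE w in P l. \<forall>n\<ge>j. good_cut w n" by (rule AE_good[OF lb(2,1) bd_row_sum])
  qed (rule assms(5,7,9) True B | assumption)+
  show ?thesis by (rule wang_laws_converge[OF assms(8)])
qed

end
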